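(* Let $\mathcal{A}$ be a plus-one generated arrangement of lines in $\mathbb{P}^2=\mathbb{P}^2(\mathbb{C})$ of exponents $(a,b)$ and level $d$, with $d>b$. Let $l\in\mathcal{A}$ and suppose $h=|l\cap\mathcal{A}|=b+1$. Then $\mathcal{A}\setminus\{l\}$ is plus-one generated of exponents $(a-1,b)$ and level $d-1$.
   Context: An arrangement $\mathcal{A}$ is a finite set of $n=|\mathcal{A}|$ distinct lines in $\mathbb{P}^2=\mathbb{P}^2(\mathbb{C})$, with defining polynomial $f_{\mathcal{A}}=\prod_{H\in\mathcal{A}}\alpha_H$, where $\alpha_H\in\mathbb{C}[x,y,z]$ is a linear form defining $H$. The vector bundle associated to $\mathcal{A}$ is the rank $2$ vector bundle $\mathcal{T}_{\mathcal{A}}=\ker\big(\nabla f_{\mathcal{A}}:\mathcal{O}_{\mathbb{P}^2}^3\to\mathcal{O}_{\mathbb{P}^2}(n-1)\big)$, where $\nabla f_{\mathcal{A}}=[\partial_x f_{\mathcal{A}}\ \partial_y f_{\mathcal{A}}\ \partial_z f_{\mathcal{A}}]$. $\mathcal{A}$ is plus-one generated of exponents (type) $(a,b)$ and level $d$, where $a\le b\le d$, if there is an exact sequence $$0\to\mathcal{O}_{\mathbb{P}^2}(-1-d)\to\mathcal{O}_{\mathbb{P}^2}(-d)\oplus\mathcal{O}_{\mathbb{P}^2}(-b)\oplus\mathcal{O}_{\mathbb{P}^2}(-a)\to\mathcal{T}_{\mathcal{A}}\to0.$$ For $l\in\mathcal{A}$, $|l\cap\mathcal{A}|$ is the number of distinct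 points of $l$ at which $l$ meets the other lines of $\mathcal{A}$. *)

theory Defs
  imports "HOL-Analysis.Analysis"
begin

section \<open>The projective plane and its Zariski topology\<close>

text \<open>A point of the plane is the punctured line of its homogeneous coordinate vectors, so that
  for a set \<open>U\<close> of points, \<open>\<Union>U\<close> is the punctured affine cone over \<open>U\<close>.\<close>

type_synonym point = "(complex ^ 3) set"

definition P2 :: "point set"
  where "P2 = {{c *s v | c. c \<noteq> 0} | v. v \<noteq> 0}"

text \<open>Homogeneous polynomials of degree \<open>k\<close> in three variables, as functions (the ground field is
  infinite); the zero polynomial belongs to every degree.\<close>

definition homog_poly :: "nat \<Rightarrow> (complex ^ 3 \<Rightarrow> complex) set"
  where "homog_poly k =
    {F. \<exists>c. F = (\<lambda>v. \<Sum>(i, j) \<in> {(i, j). i + j \<le> k}. c i j * v $ 1 ^ i * v $ 2 ^ j * v $ 3 ^ (k - i - j))}"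

definition nonvanishing :: "(complex ^ 3 \<Rightarrow> complex) \<Rightarrow> point set"
  where "nonvanishing F = {p \<in> P2. \<forall>v\<in>p. F v \<noteq> 0}"

definition zariski :: "point topology"
  where "zariski = topology_generated_by {nonvanishing F | F k. F \<in> homog_poly k}"


section \<open>Sheaves of modules\<close>

text \<open>All sheaves needed here are subsheaves of finite direct sums of twists of the structure sheaf.
  A section over \<open>U\<close> is therefore a function on the cone \<open>\<Union>U\<close> with values in \<open>\<complex>\<^sup>n\<close>; it is extended
  by zero outside the cone, so that equality of sections is equality of functions.\<close>

type_synonym 'n sect = "complex ^ 3 \<Rightarrow> complex ^ 'n"
type_synonym 'n sheaf = "point set \<Rightarrow> 'n sect set"
type_synonym ('m, 'n) sheaf_map = "point set \<Rightarrow> 'm sect \<Rightarrow> 'n sect"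

definition restr :: "point set \<Rightarrow> 'n::finite sect \<Rightarrow> 'n sect"
  where "restr V s = (\<lambda>v. if v \<in> \<Union>V then s v else 0)"

text \<open>Sections of the \<open>k\<close>-th twist are the functions on the cone that are locally quotients of
  homogeneous polynomials whose degrees differ by \<open>k\<close>. For \<open>k = 0\<close> this is the structure sheaf.\<close>

definition twist :: "int \<Rightarrow> point set \<Rightarrow> (complex ^ 3 \<Rightarrow> complex) set"
  where "twist k U = {s. (\<forall>v. v \<notin> \<Union>U \<longrightarrow> s v = 0) \<and>
    (\<forall>p\<in>U. \<exists>V. openin zariski V \<and> p \<in> V \<and> V \<subseteq> U \<and>
      (\<exists>m e. \<exists>F\<in>homog_poly m. \<exists>G\<in>homog_poly e. int m - int e = k \<and>
        (\<forall>v\<in>\<Union>V. G v \<noteq> 0 \<and> s v = F v / G v)))}"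

definition twist_sum :: "int ^ 'n \<Rightarrow> 'n sheaf"
  where "twist_sum k U = {s. \<forall>i. (\<lambda>v. s v $ i) \<in> twist (k $ i) U}"

definition sheaf_hom :: "'m::finite sheaf \<Rightarrow> 'n::finite sheaf \<Rightarrow> ('m, 'n) sheaf_map \<Rightarrow> bool"
  where "sheaf_hom E F \<phi> \<longleftrightarrow>
    (\<forall>U. openin zariski U \<longrightarrow>
      (\<forall>s\<in>E U. \<phi> U s \<in> F U) \<and>
      (\<forall>s\<in>E U. \<forall>t\<in>E U. \<phi> U (\<lambda>v. s v + t v) = (\<lambda>v. \<phi> U s v + \<phi> U t v)) \<and>
      (\<forall>r\<in>twist 0 U. \<forall>s\<in>E U. \<phi> U (\<lambda>v. r v *s s v) = (\<lambda>v. r v *s \<phi> U s v)) \<and>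
      (\<forall>V. openin zariski V \<and> V \<subseteq> U \<longrightarrow> (\<forall>s\<in>E U. \<phi> V (restr V s) = restr V (\<phi> U s))))"

definition sheaf_kernel :: "'m::finite sheaf \<Rightarrow> ('m, 'n::finite) sheaf_map \<Rightarrow> 'm sheaf"
  where "sheaf_kernel E \<phi> U = {s \<in> E U. \<phi> U s = (\<lambda>v. 0)}"

text \<open>The image sheaf, i.e. the sheafification of the presheaf image: sections that locally lift.\<close>

definition sheaf_image :: "'m::finite sheaf \<Rightarrow> 'n::finite sheaf \<Rightarrow> ('m, 'n) sheaf_map \<Rightarrow> 'n sheaf"
  where "sheaf_image E F \<phi> U = {t \<in> F U. \<forall>p\<in>U. \<exists>V. openin zariski V \<and> p \<in> V \<and> V \<subseteq> U \<and>
    (\<exists>s\<in>E V. \<phi> V s = restr V t)}"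

definition short_exact ::
  "'l::finite sheaf \<Rightarrow> 'm::finite sheaf \<Rightarrow> 'n::finite sheaf \<Rightarrow> ('l, 'm) sheaf_map \<Rightarrow> ('m, 'n) sheaf_map \<Rightarrow> bool"
  where "short_exact E F G \<phi> \<psi> \<longleftrightarrow> sheaf_hom E F \<phi> \<and> sheaf_hom F G \<psi> \<and>
    (\<forall>U. openin zariski U \<longrightarrow>
      sheaf_kernel E \<phi> U = {\<lambda>v. 0} \<and>
      sheaf_kernel F \<psi> U = sheaf_image E F \<phi> U \<and>
      sheaf_image F G \<psi> U = G U)"


section \<open>Line arrangements\<close>

definition line_of_form :: "complex ^ 3 \<Rightarrow> point set"
  where "line_of_form \<alpha> = {p \<in> P2. \<forall>v\<in>p. scalar_product \<alpha> v = 0}"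

definition arrangement :: "point set set \<Rightarrow> bool"
  where "arrangement A \<longleftrightarrow> finite A \<and> (\<forall>H\<in>A. \<exists>\<alpha>. \<alpha> \<noteq> 0 \<and> H = line_of_form \<alpha>)"

text \<open>Coefficients of a linear form defining the line \<open>H\<close>, unique up to a nonzero scalar.\<close>

definition form_of_line :: "point set \<Rightarrow> complex ^ 3"
  where "form_of_line H = (SOME \<alpha>. \<alpha> \<noteq> 0 \<and> H = line_of_form \<alpha>)"

definition defining_poly :: "point set set \<Rightarrow> complex ^ 3 \<Rightarrow> complex"
  where "defining_poly A v = (\<Prod>H\<in>A. scalar_product (form_of_line H) v)"

definition gradient :: "(complex ^ 3 \<Rightarrow> complex) \<Rightarrow> complex ^ 3 \<Rightarrow> complex ^ 3"
  where "gradient f v = (\<chi> i. deriv (\<lambda>t. f (v + t *s axis i 1)) 0)"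

definition gradient_map :: "point set set \<Rightarrow> (3, 1) sheaf_map"
  where "gradient_map A U s = (\<lambda>v. vector [scalar_product (gradient (defining_poly A) v) (s v)])"

text \<open>The target of \<open>gradient_map A\<close> on \<open>\<O>\<^sup>3\<close> is the twist by \<open>card A - 1\<close>; the kernel does not depend
  on naming it.\<close>

definition T_bundle :: "point set set \<Rightarrow> 3 sheaf"
  where "T_bundle A = sheaf_kernel (twist_sum (vector [0, 0, 0])) (gradient_map A)"

definition plus_one_generated :: "point set set \<Rightarrow> int \<Rightarrow> int \<Rightarrow> int \<Rightarrow> bool"
  where "plus_one_generated A a b d \<longleftrightarrow> a \<le> b \<and> b \<le> d \<and>
    (\<exists>\<phi> \<psi>. short_exact (twist_sum (vector [-1 - d] :: int ^ 1))
      (twist_sum (vector [-d, -b, -a] :: int ^ 3)) (T_bundle A) \<phi> \<psi>)"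

definition intersection_points :: "point set \<Rightarrow> point set set \<Rightarrow> point set"
  where "intersection_points l A = {p \<in> l. \<exists>H\<in>A - {l}. p \<in> H}"

end

theory Submission
  imports Defs "HOL-Complex_Analysis.Complex_Analysis"
    "HOL-Computational_Algebra.Fundamental_Theorem_Algebra"
begin

text \<open>The bundle of an arrangement is, up to isomorphism, the sheaf of vector fields tangent to all
  its lines modulo the Euler field \<open>v \<mapsto> v\<close>, because subtracting a multiple of the Euler field makes
  a tangent field annihilate the defining polynomial (\<open>tangent_normalize\<close>). For a line \<open>l\<close> with
  equation \<open>\<alpha>\<close> and \<open>h\<close> intersection points, take the component of a tangent field along \<open>l\<close>
  transverse to the Euler field (\<open>wedge\<close>). It vanishes at the \<open>h\<close> points, and it is zero exactly when
  the field is, modulo the Euler field, \<open>\<alpha>\<close> times a field tangent to the other lines. This is the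
  exact sequence
  \<open>0 \<rightarrow> T\<^bsub>A - l\<^esub>(-1) \<rightarrow> T\<^bsub>A\<^esub> \<rightarrow> O\<^bsub>l\<^esub>(1 - h) \<rightarrow> 0\<close>.

  For \<open>h = b + 1\<close> the generators of degrees \<open>d\<close>, \<open>b\<close>, \<open>a\<close> are sent to binary forms of degrees \<open>d - b\<close>,
  \<open>0\<close>, \<open>a - b\<close>. The map is onto near every point of \<open>l\<close>, as constant vector fields show, whereas a
  form of degree \<open>d - b > 0\<close> has a zero; hence a generator of degree \<open>b\<close> is sent to a nonzero constant
  (\<open>transverse_generator\<close>). Multiples of it can be subtracted from the two other generators, so that
  these become divisible by \<open>\<alpha>\<close> (\<open>presentation_delete_middle\<close>). In the relation among the three
  generators the coefficient of the middle one is then divisible by \<open>\<alpha>\<close> as well, since no other term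
  contributes along \<open>l\<close>. Dividing by \<open>\<alpha>\<close> gives generators of degrees \<open>d - 1\<close>, \<open>b\<close>, \<open>a - 1\<close> for the
  smaller arrangement and their single relation (\<open>presentation_delete\<close>).

  The sheaf language is removed first: a homomorphism between sums of twists is a matrix of regular
  functions on the cone (\<open>sheaf_hom_columns\<close>), so that a plus-one generated arrangement is one with
  explicit generators and one relation (\<open>presentation\<close>). Two tools replace algebraic geometry on
  these functions. They are continuous in the classical topology, so identities that hold off a line
  hold on it; and on \<open>l\<close> Liouville's theorem identifies global sections with binary forms.\<close>
(* v $ i would otherwise also parse as a power series coefficient *)
no_notation fps_nth (infixl \<open>$\<close> 75)

section \<open>Homogeneous polynomials\<close>

lemma finite_exponents: "finite {(i, j). i + j \<le> (k::nat)}"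
  by (rule finite_subset[of _ "{..k} \<times> {..k}"]) auto

lemma homog_poly_monomial:
  assumes "i + j \<le> k"
  shows "(\<lambda>v. c * v $ 1 ^ i * v $ 2 ^ j * v $ 3 ^ (k - i - j)) \<in> homog_poly k"
proof -
  have "(\<lambda>v::complex^3. c * v $ 1 ^ i * v $ 2 ^ j * v $ 3 ^ (k - i - j)) =
    (\<lambda>v. \<Sum>(i', j') \<in> {(i', j'). i' + j' \<le> k}.
       (if i' = i \<and> j' = j then c else 0) * v $ 1 ^ i' * v $ 2 ^ j' * v $ 3 ^ (k - i' - j'))"
    (is "_ = (\<lambda>v. ?S v)")
  proof
    fix v :: "complex^3"
    have "?S v = (\<Sum>q \<in> {(i', j'). i' + j' \<le> k}.
       if q = (i, j) then c * v $ 1 ^ i * v $ 2 ^ j * v $ 3 ^ (k - i - j) else 0)"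
      by (rule sum.cong) (auto split: if_splits)
    also have "\<dots> = c * v $ 1 ^ i * v $ 2 ^ j * v $ 3 ^ (k - i - j)"
      using assms by (simp add: finite_exponents)
    finally show "c * v $ 1 ^ i * v $ 2 ^ j * v $ 3 ^ (k - i - j) = ?S v" ..
  qed
  then show ?thesis
    unfolding homog_poly_def by (intro CollectI exI)
qed

lemma homog_poly_zero: "(\<lambda>v. 0) \<in> homog_poly k"
  using homog_poly_monomial[of 0 0 k 0] by simp

lemma homog_poly_add:
  assumes "F \<in> homog_poly k" "G \<in> homog_poly k"
  shows "(\<lambda>v. F v + G v) \<in> homog_poly k"
proof -
  obtain c d where F: "F = (\<lambda>v. \<Sum>(i, j) \<in> {(i, j). i + j \<le> k}. c i j * v $ 1 ^ i * v $ 2 ^ j * v $ 3 ^ (k - i - j))"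
    and G: "G = (\<lambda>v. \<Sum>(i, j) \<in> {(i, j). i + j \<le> k}. d i j * v $ 1 ^ i * v $ 2 ^ j * v $ 3 ^ (k - i - j))"
    using assms unfolding homog_poly_def by blast
  have "(\<lambda>v. F v + G v) = (\<lambda>v. \<Sum>(i, j) \<in> {(i, j). i + j \<le> k}.
      (c i j + d i j) * v $ 1 ^ i * v $ 2 ^ j * v $ 3 ^ (k - i - j))"
    unfolding F G sum.distrib[symmetric] by (intro ext sum.cong) (auto simp: algebra_simps)
  then show ?thesis
    unfolding homog_poly_def by (intro CollectI exI[of _ "\<lambda>i j. c i j + d i j"])
qed

lemma homog_poly_sum:
  assumes "\<And>i. i \<in> I \<Longrightarrow> F i \<in> homog_poly k"
  shows "(\<lambda>v. \<Sum>i\<in>I. F i v) \<in> homog_poly k"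
  using assms by (induction I rule: infinite_finite_induct) (auto intro: homog_poly_zero homog_poly_add)

lemma homog_poly_monomial_induct [consumes 1, case_names monomial add]:
  fixes P :: "(complex ^ 3 \<Rightarrow> complex) \<Rightarrow> bool"
  assumes "F \<in> homog_poly k"
    and mono: "\<And>c i j. i + j \<le> k \<Longrightarrow> P (\<lambda>v. c * v $ 1 ^ i * v $ 2 ^ j * v $ 3 ^ (k - i - j))"
    and add: "\<And>F G. P F \<Longrightarrow> P G \<Longrightarrow> P (\<lambda>v. F v + G v)"
  shows "P F"
proof -
  obtain c where F: "F = (\<lambda>v. \<Sum>(i, j) \<in> {(i, j). i + j \<le> k}. c i j * v $ 1 ^ i * v $ 2 ^ j * v $ 3 ^ (k - i - j))"
    using assms(1) unfolding homog_poly_def by blast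
  have zero: "P (\<lambda>v. 0)"
    using mono[of 0 0 0] by simp
  have "P (\<lambda>v. \<Sum>(i, j) \<in> I. c i j * v $ 1 ^ i * v $ 2 ^ j * v $ 3 ^ (k - i - j))"
    if "finite I" "I \<subseteq> {(i, j). i + j \<le> k}" for I
    using that
  proof (induction I rule: finite_induct)
    case empty
    then show ?case using zero by simp
  next
    case (insert x I)
    obtain i j where x: "x = (i, j)" by force
    then have "P (\<lambda>v. c i j * v $ 1 ^ i * v $ 2 ^ j * v $ 3 ^ (k - i - j))"
      using insert.prems by (intro mono) auto
    with insert show ?case
      unfolding x by (simp add: add)
  qed
  then show ?thesis
    unfolding F using finite_exponents by blast
qed

lemma homog_poly_coord_mult:
  assumes "F \<in> homog_poly k"
  shows "(\<lambda>v. v $ n * F v) \<in> homog_poly (Suc k)"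
  using assms
proof (induction rule: homog_poly_monomial_induct)
  case (monomial c i j)
  have "n = 1 \<or> n = 2 \<or> n = 3" by (rule exhaust_3)
  then show ?case
  proof (elim disjE)
    assume "n = 1"
    then show ?thesis using homog_poly_monomial[of "Suc i" j "Suc k" c] monomial
      by (simp add: algebra_simps)
  next
    assume "n = 2"
    then show ?thesis using homog_poly_monomial[of i "Suc j" "Suc k" c] monomial
      by (simp add: algebra_simps)
  next
    assume "n = 3"
    then show ?thesis using homog_poly_monomial[of i j "Suc k" c] monomial
      by (simp add: algebra_simps Suc_diff_le)
  qed
next
  case (add F G)
  then show ?case using homog_poly_add[of "\<lambda>v. v $ n * F v" "Suc k" "\<lambda>v. v $ n * G v"]
    by (simp add: algebra_simps)
qed

lemma homog_poly_const: "(\<lambda>v. c) \<in> homog_poly 0"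
  using homog_poly_monomial[of 0 0 0 c] by simp

text \<open>Every form arises from constants by adding forms and multiplying by coordinates, so that
  a property can be checked on these three operations.\<close>

lemma homog_poly_induct [consumes 1, case_names const add coord]:
  fixes P :: "nat \<Rightarrow> (complex ^ 3 \<Rightarrow> complex) \<Rightarrow> bool"
  assumes F: "F \<in> homog_poly k"
    and const: "\<And>c. P 0 (\<lambda>v. c)"
    and add: "\<And>k F G. F \<in> homog_poly k \<Longrightarrow> G \<in> homog_poly k \<Longrightarrow> P k F \<Longrightarrow> P k G \<Longrightarrow> P k (\<lambda>v. F v + G v)"
    and coord: "\<And>k F n. F \<in> homog_poly k \<Longrightarrow> P k F \<Longrightarrow> P (Suc k) (\<lambda>v. v $ n * F v)"
  shows "P k F"
proof -
  have pw: "(\<lambda>v. v $ n ^ i * H v) \<in> homog_poly (i + m) \<and> P (i + m) (\<lambda>v. v $ n ^ i * H v)"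
    if "H \<in> homog_poly m" "P m H" for H m n i
  proof (induction i)
    case 0
    then show ?case using that by simp
  next
    case (Suc i)
    then show ?case
      using homog_poly_coord_mult[of _ _ n] coord[of _ _ n] by (simp add: mult.assoc)
  qed
  have "F \<in> homog_poly k \<and> P k F"
    using F
  proof (induction rule: homog_poly_monomial_induct)
    case (monomial c i j)
    have 1: "(\<lambda>v. v $ 3 ^ (k - i - j) * c) \<in> homog_poly (k - i - j) \<and> P (k - i - j) (\<lambda>v. v $ 3 ^ (k - i - j) * c)"
      using pw[of "\<lambda>v. c" 0 3 "k - i - j"] homog_poly_const const by simp
    have 2: "(\<lambda>v. v $ 2 ^ j * (v $ 3 ^ (k - i - j) * c)) \<in> homog_poly (j + (k - i - j)) \<and>
        P (j + (k - i - j)) (\<lambda>v. v $ 2 ^ j * (v $ 3 ^ (k - i - j) * c))"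
      using pw 1 by blast
    have 3: "(\<lambda>v. v $ 1 ^ i * (v $ 2 ^ j * (v $ 3 ^ (k - i - j) * c))) \<in> homog_poly (i + (j + (k - i - j))) \<and>
        P (i + (j + (k - i - j))) (\<lambda>v. v $ 1 ^ i * (v $ 2 ^ j * (v $ 3 ^ (k - i - j) * c)))"
      using pw 2 by blast
    then show ?case
      using monomial by (simp add: mult_ac)
  next
    case (add F G)
    then show ?case using assms(3) homog_poly_add by blast
  qed
  then show ?thesis ..
qed

lemma homog_poly_mult:
  assumes "F \<in> homog_poly k" "G \<in> homog_poly m"
  shows "(\<lambda>v. F v * G v) \<in> homog_poly (k + m)"
  using assms
proof (induction rule: homog_poly_induct)
  case (const c)
  from const show ?case
  proof (induction rule: homog_poly_induct)
    case (const d)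
    then show ?case by (simp add: homog_poly_const)
  next
    case (add k F G)
    then show ?case using homog_poly_add[of "\<lambda>v. c * F v" k "\<lambda>v. c * G v"] by (simp add: algebra_simps)
  next
    case (coord k F n)
    then show ?case using homog_poly_coord_mult[of "\<lambda>v. c * F v" k n] by (simp add: mult_ac)
  qed
next
  case (add k F H)
  then show ?case using homog_poly_add[of "\<lambda>v. F v * G v" "k + m" "\<lambda>v. H v * G v"] by (simp add: algebra_simps)
next
  case (coord k F n)
  then show ?case using homog_poly_coord_mult[of "\<lambda>v. F v * G v" "k + m" n] by (simp add: mult_ac)
qed

lemma homog_poly_cmult: "F \<in> homog_poly k \<Longrightarrow> (\<lambda>v. c * F v) \<in> homog_poly k"
  using homog_poly_mult[OF homog_poly_const] by simp

lemma homog_poly_power: "F \<in> homog_poly k \<Longrightarrow> (\<lambda>v. F v ^ n) \<in> homog_poly (n * k)"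
  by (induction n) (auto intro: homog_poly_const homog_poly_mult)

lemma homog_poly_coord: "(\<lambda>v. v $ n) \<in> homog_poly (Suc 0)"
  using homog_poly_coord_mult[OF homog_poly_const[of 1]] by simp

lemma homog_poly_linear: "scalar_product \<alpha> \<in> homog_poly (Suc 0)"
proof -
  have "scalar_product \<alpha> = (\<lambda>v. \<Sum>i\<in>UNIV. \<alpha> $ i * v $ i)"
    by (auto simp: scalar_product_def)
  also have "\<dots> \<in> homog_poly (Suc 0)"
    by (intro homog_poly_sum homog_poly_cmult homog_poly_coord)
  finally show ?thesis .
qed

lemma homog_poly_scale:
  assumes "F \<in> homog_poly k"
  shows "F (c *s v) = c ^ k * F v"
  using assms by (induction rule: homog_poly_induct) (auto simp: algebra_simps)

lemma homog_poly_continuous: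
  assumes "F \<in> homog_poly k"
  shows "continuous_on S F"
  using assms by (induction rule: homog_poly_induct) (auto intro!: continuous_intros)

lemma homog_poly_along_line:
  assumes "F \<in> homog_poly k"
  shows "\<exists>p. \<forall>t. F (a + t *s b) = poly p t"
  using assms
proof (induction rule: homog_poly_induct)
  case (const c)
  show ?case by (rule exI[of _ "[:c:]"]) simp
next
  case (add k F G)
  then obtain p q where "\<forall>t. F (a + t *s b) = poly p t" "\<forall>t. G (a + t *s b) = poly q t" by blast
  then show ?case by (intro exI[of _ "p + q"]) simp
next
  case (coord k F n)
  then obtain p where "\<forall>t. F (a + t *s b) = poly p t" by blast
  then show ?case by (intro exI[of _ "[:a $ n, b $ n:] * p"]) (simp add: algebra_simps)
qed

lemma scalar_product_add: "scalar_product \<alpha> (v + w) = scalar_product \<alpha> v + scalar_product \<alpha> (w::complex^'n)"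
  by (simp add: scalar_product_def algebra_simps sum.distrib)

lemma scalar_product_diff: "scalar_product \<alpha> (v - w) = scalar_product \<alpha> v - scalar_product \<alpha> (w::complex^'n)"
  by (simp add: scalar_product_def algebra_simps sum_subtractf)

lemma scalar_product_scale: "scalar_product \<alpha> (c *s v) = c * scalar_product \<alpha> (v::complex^'n)"
  by (simp add: scalar_product_def sum_distrib_left mult_ac)

lemma scalar_product_zero [simp]: "scalar_product \<alpha> 0 = (0::complex)" "scalar_product 0 v = (0::complex)"
  by (simp_all add: scalar_product_def)

lemma scalar_product_axis [simp]: "scalar_product \<alpha> (axis i (c::complex)) = \<alpha> $ i * c"
  by (simp add: scalar_product_def axis_def if_distrib cong: if_cong)

lemmas scalar_product_simps = scalar_product_add scalar_product_diff scalar_product_scale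

lemma exists_scalar_product_eq:
  assumes "(\<alpha>::complex^'n) \<noteq> 0"
  obtains e where "scalar_product \<alpha> e = c"
proof -
  obtain i where "\<alpha> $ i \<noteq> 0" using assms by (metis vec_eq_iff zero_index)
  then have "scalar_product \<alpha> (axis i (c / \<alpha> $ i)) = c" by simp
  then show ?thesis using that by blast
qed

text \<open>Taylor expansion in one direction: the increment of a form along \<open>\<alpha>(v) e\<close> is a multiple of
  \<open>\<alpha>\<close>. With \<open>\<alpha>(e) = -1\<close> the shifted point lies on the line, which gives the factor theorem below.\<close>

lemma homog_poly_shift:
  assumes "F \<in> homog_poly k"
  shows "\<exists>F'. (k = 0 \<longrightarrow> F' = (\<lambda>v. 0)) \<and> F' \<in> homog_poly (k - 1) \<and>
    (\<forall>v. F (v + scalar_product \<alpha> v *s e) = F v + scalar_product \<alpha> v * F' v)"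
  using assms
proof (induction rule: homog_poly_induct)
  case (const c)
  show ?case by (rule exI[of _ "\<lambda>v. 0"]) (simp add: homog_poly_zero)
next
  case (add k F G)
  then obtain F' G' where "k = 0 \<longrightarrow> F' = (\<lambda>v. 0)" "k = 0 \<longrightarrow> G' = (\<lambda>v. 0)"
    "F' \<in> homog_poly (k - 1)" "G' \<in> homog_poly (k - 1)"
    "\<forall>v. F (v + scalar_product \<alpha> v *s e) = F v + scalar_product \<alpha> v * F' v"
    "\<forall>v. G (v + scalar_product \<alpha> v *s e) = G v + scalar_product \<alpha> v * G' v" by blast
  then show ?case
    by (intro exI[of _ "\<lambda>v. F' v + G' v"]) (auto simp: algebra_simps intro: homog_poly_add)
next
  case (coord k F n)
  then obtain F' where F': "k = 0 \<longrightarrow> F' = (\<lambda>v. 0)" "F' \<in> homog_poly (k - 1)"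
    "\<forall>v. F (v + scalar_product \<alpha> v *s e) = F v + scalar_product \<alpha> v * F' v" by blast
  have "(\<lambda>v. (v $ n + e $ n * scalar_product \<alpha> v) * F' v) \<in> homog_poly k"
  proof (cases "k = 0")
    case True
    then show ?thesis using F' homog_poly_zero by simp
  next
    case False
    have "(\<lambda>v. (v $ n + e $ n * scalar_product \<alpha> v) * F' v) \<in> homog_poly (Suc 0 + (k - 1))"
      by (intro homog_poly_mult homog_poly_add homog_poly_cmult homog_poly_coord homog_poly_linear F')
    then show ?thesis using False by simp
  qed
  then have "(\<lambda>v. e $ n * F v + (v $ n + e $ n * scalar_product \<alpha> v) * F' v) \<in> homog_poly k"
    by (intro homog_poly_add homog_poly_cmult coord)
  then show ?case
    using F'(3) by (intro exI[of _ "\<lambda>v. e $ n * F v + (v $ n + e $ n * scalar_product \<alpha> v) * F' v"])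
      (auto simp: algebra_simps)
qed

lemma homog_poly_factor:
  assumes "F \<in> homog_poly k" "\<alpha> \<noteq> 0" "\<And>v. scalar_product \<alpha> v = 0 \<Longrightarrow> F v = 0"
  shows "\<exists>F'. (k = 0 \<longrightarrow> F' = (\<lambda>v. 0)) \<and> F' \<in> homog_poly (k - 1) \<and> (\<forall>v. F v = scalar_product \<alpha> v * F' v)"
proof -
  obtain e where e: "scalar_product \<alpha> e = - 1"
    using exists_scalar_product_eq[OF assms(2)] .
  obtain F' where F': "k = 0 \<longrightarrow> F' = (\<lambda>v. 0)" "F' \<in> homog_poly (k - 1)"
    "\<forall>v. F (v + scalar_product \<alpha> v *s e) = F v + scalar_product \<alpha> v * F' v"
    using homog_poly_shift[OF assms(1), of \<alpha> e] by blast
  have "F (v + scalar_product \<alpha> v *s e) = 0" for v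
    by (rule assms(3)) (simp add: scalar_product_simps e)
  then have "F v = scalar_product \<alpha> v * (- 1 * F' v)" for v
    using F'(3) by (simp add: add_eq_0_iff)
  then show ?thesis
    using F' by (intro exI[of _ "\<lambda>v. - 1 * F' v"]) (use homog_poly_cmult[of F' "k - 1" "- 1"] in auto)
qed

section \<open>Points and Zariski-open sets\<close>

definition pt :: "complex ^ 3 \<Rightarrow> point"
  where "pt v = {c *s v | c. c \<noteq> 0}"

lemma P2_eq: "P2 = pt ` (- {0})"
  by (auto simp: P2_def pt_def)

lemma pt_self: "v \<in> pt v"
  unfolding pt_def by (rule CollectI, rule exI[of _ 1]) simp

lemma pt_scale: "c \<noteq> 0 \<Longrightarrow> pt (c *s v) = pt v"
proof -
  have sub: "pt (c *s v) \<subseteq> pt v" if "c \<noteq> 0" for c :: complex and v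
    using that by (auto simp: pt_def)
  assume "c \<noteq> 0"
  then show ?thesis
    using sub[of c v] sub[of "inverse c" "c *s v"] by simp
qed

lemma pt_eqI: "w \<in> pt v \<Longrightarrow> pt w = pt v"
  by (auto simp: pt_def[of v] pt_scale)

lemma in_point:
  assumes "p \<in> P2" "v \<in> p"
  shows "v \<noteq> 0" "p = pt v"
proof -
  obtain w where w: "w \<noteq> 0" "p = pt w" using assms(1) by (auto simp: P2_eq)
  then show "v \<noteq> 0" using assms(2) by (auto simp: pt_def)
  show "p = pt v" using pt_eqI assms(2) w by blast
qed

lemma pt_in_P2: "v \<noteq> 0 \<Longrightarrow> pt v \<in> P2"
  by (auto simp: P2_eq)

lemma in_cone_iff: "U \<subseteq> P2 \<Longrightarrow> v \<in> \<Union>U \<longleftrightarrow> v \<noteq> 0 \<and> pt v \<in> U"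
  using in_point pt_self by blast

lemma in_cone_P2: "v \<in> \<Union>P2 \<longleftrightarrow> v \<noteq> 0"
  by (subst in_cone_iff) (auto intro: pt_in_P2)

lemma cone_nonvanishing:
  assumes "F \<in> homog_poly k"
  shows "v \<in> \<Union>(nonvanishing F) \<longleftrightarrow> v \<noteq> 0 \<and> F v \<noteq> 0"
proof -
  have *: "pt v \<in> nonvanishing F \<longleftrightarrow> F v \<noteq> 0" if "v \<noteq> 0"
    using that homog_poly_scale[OF assms] pt_in_P2[OF that] pt_self
    by (auto simp: nonvanishing_def pt_def)
  show ?thesis
    by (subst in_cone_iff) (use * in \<open>auto simp: nonvanishing_def\<close>)
qed

lemma openin_nonvanishing: "F \<in> homog_poly k \<Longrightarrow> openin zariski (nonvanishing F)"
  unfolding zariski_def by (rule topology_generated_by_Basis, rule CollectI, rule exI, rule exI, rule conjI[OF refl])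

lemma topspace_zariski: "topspace zariski = P2"
proof
  show "topspace zariski \<subseteq> P2"
  proof
    fix p assume "p \<in> topspace zariski"
    then obtain F where "p \<in> nonvanishing F"
      unfolding zariski_def topology_generated_by_topspace by (elim UnionE CollectE exE conjE) simp
    then show "p \<in> P2" unfolding nonvanishing_def by simp
  qed
  have "nonvanishing (\<lambda>v. 1) = P2" unfolding nonvanishing_def by simp
  then show "P2 \<subseteq> topspace zariski"
    using openin_subset[OF openin_nonvanishing[OF homog_poly_const[of 1]]] by simp
qed

lemma openin_P2: "openin zariski P2"
  using openin_topspace[of zariski] by (simp add: topspace_zariski)

lemma openin_subset_P2: "openin zariski U \<Longrightarrow> U \<subseteq> P2"
  using openin_subset topspace_zariski by blast

lemma cone_Int_P2:
  assumes "U \<subseteq> P2" "V \<subseteq> P2"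
  shows "\<Union>(U \<inter> V) = \<Union>U \<inter> \<Union>V"
proof (rule set_eqI)
  have "U \<inter> V \<subseteq> P2" using assms(1) by (rule le_infI1)
  then show "v \<in> \<Union>(U \<inter> V) \<longleftrightarrow> v \<in> \<Union>U \<inter> \<Union>V" for v
    unfolding Int_iff by (simp only: in_cone_iff assms Int_iff) blast
qed

lemma cone_Int: "openin zariski U \<Longrightarrow> openin zariski V \<Longrightarrow> \<Union>(U \<inter> V) = \<Union>U \<inter> \<Union>V"
  by (intro cone_Int_P2 openin_subset_P2)

lemma open_cone:
  assumes "openin zariski U"
  shows "open (\<Union>U)"
proof -
  have "generate_topology_on {nonvanishing F | F k. F \<in> homog_poly k} U"
    using assms unfolding zariski_def by (simp add: openin_topology_generated_by_iff)
  then have "U \<subseteq> P2 \<and> open (\<Union>U)"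
  proof (induction rule: generate_topology_on.induct)
    case Empty
    then show ?case by simp
  next
    case (Int a b)
    then have "\<Union>(a \<inter> b) = \<Union>a \<inter> \<Union>b"
      by (intro cone_Int_P2) auto
    with Int show ?case by auto
  next
    case (UN K)
    then have "open (\<Union>k\<in>K. \<Union>k)" by (intro open_UN) auto
    moreover have "\<Union>(\<Union>K) = (\<Union>k\<in>K. \<Union>k)" by auto
    ultimately show ?case using UN by (metis Union_least)
  next
    case (Basis s)
    then obtain F k where s: "s = nonvanishing F" "F \<in> homog_poly k" by auto
    have "\<Union>s = - {0} \<inter> F -` (- {0})"
      using cone_nonvanishing[OF s(2)] s(1) by auto
    moreover have "open (F -` (- {0}))"
      using homog_poly_continuous[OF s(2), of UNIV] by (intro open_vimage) auto
    ultimately show ?case using s(1) by (auto simp: nonvanishing_def)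
  qed
  then show ?thesis ..
qed

lemma cone_scale: "U \<subseteq> P2 \<Longrightarrow> v \<in> \<Union>U \<Longrightarrow> c \<noteq> 0 \<Longrightarrow> c *s v \<in> \<Union>U"
  by (simp add: in_cone_iff pt_scale del: Union_iff)

section \<open>Regular functions on the cone\<close>

definition quotient_on :: "int \<Rightarrow> point set \<Rightarrow> (complex ^ 3 \<Rightarrow> complex) \<Rightarrow> bool"
  where "quotient_on k V s \<longleftrightarrow> (\<exists>m e. \<exists>F\<in>homog_poly m. \<exists>G\<in>homog_poly e. int m - int e = k \<and>
    (\<forall>v\<in>\<Union>V. G v \<noteq> 0 \<and> s v = F v / G v))"

definition regular_on :: "int \<Rightarrow> point set \<Rightarrow> (complex ^ 3 \<Rightarrow> complex) \<Rightarrow> bool"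
  where "regular_on k U s \<longleftrightarrow> (\<forall>p\<in>U. \<exists>V. openin zariski V \<and> p \<in> V \<and> V \<subseteq> U \<and> quotient_on k V s)"

lemma twist_iff: "s \<in> twist k U \<longleftrightarrow> (\<forall>v. v \<notin> \<Union>U \<longrightarrow> s v = 0) \<and> regular_on k U s"
  unfolding twist_def regular_on_def quotient_on_def by (rule mem_Collect_eq)

lemma quotient_onI:
  assumes "F \<in> homog_poly m" "G \<in> homog_poly e" "int m - int e = k"
    "\<And>v. v \<in> \<Union>V \<Longrightarrow> G v \<noteq> 0" "\<And>v. v \<in> \<Union>V \<Longrightarrow> s v = F v / G v"
  shows "quotient_on k V s"
  unfolding quotient_on_def
  by (rule exI[of _ m], rule exI[of _ e], rule bexI[OF _ assms(1)], rule bexI[OF _ assms(2)])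
    (use assms(3-5) in \<open>simp del: Union_iff\<close>)

lemma quotient_onE:
  assumes "quotient_on k V s"
  obtains F m G e where "F \<in> homog_poly m" "G \<in> homog_poly e" "int m - int e = k"
    "\<forall>v. v \<in> \<Union>V \<longrightarrow> G v \<noteq> 0" "\<forall>v. v \<in> \<Union>V \<longrightarrow> s v = F v / G v"
proof -
  obtain F m G e where "F \<in> homog_poly m" "G \<in> homog_poly e" "int m - int e = k"
    and *: "\<forall>v\<in>\<Union>V. G v \<noteq> 0 \<and> s v = F v / G v"
    using assms unfolding quotient_on_def by (elim exE bexE conjE)
  then show thesis by (intro that[of F m G e]) (auto dest: bspec[OF *] simp del: Union_iff)
qed

lemma quotient_on_cong:
  assumes "quotient_on k V s" "\<And>v. v \<in> \<Union>V \<Longrightarrow> s v = s' v"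
  shows "quotient_on k V s'"
  using assms unfolding quotient_on_def by simp

lemma quotient_on_subset: "quotient_on k V s \<Longrightarrow> W \<subseteq> V \<Longrightarrow> quotient_on k W s"
  unfolding quotient_on_def by (elim exE bexE) (intro exI bexI; blast)

lemma quotient_on_add:
  assumes "quotient_on k V s" "quotient_on k V t"
  shows "quotient_on k V (\<lambda>v. s v + t v)"
proof -
  obtain F m G e where 1: "F \<in> homog_poly m" "G \<in> homog_poly e" "int m - int e = k"
    "\<forall>v. v \<in> \<Union>V \<longrightarrow> G v \<noteq> 0" "\<forall>v. v \<in> \<Union>V \<longrightarrow> s v = F v / G v" using assms(1) by (rule quotient_onE)
  obtain F' m' G' e' where 2: "F' \<in> homog_poly m'" "G' \<in> homog_poly e'" "int m' - int e' = k"
    "\<forall>v. v \<in> \<Union>V \<longrightarrow> G' v \<noteq> 0" "\<forall>v. v \<in> \<Union>V \<longrightarrow> t v = F' v / G' v" using assms(2) by (rule quotient_onE)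
  have "m' + e = m + e'" using 1(3) 2(3) by linarith
  then have "(\<lambda>v. F v * G' v + F' v * G v) \<in> homog_poly (m + e')"
    using homog_poly_add[OF homog_poly_mult[OF 1(1) 2(2)], of "\<lambda>v. F' v * G v"] homog_poly_mult[OF 2(1) 1(2)] by simp
  then show ?thesis
    by (rule quotient_onI[OF _ homog_poly_mult[OF 1(2) 2(2)]])
      (use 1 2 in \<open>auto simp: add_divide_eq_iff divide_add_eq_iff field_simps simp del: Union_iff\<close>)
qed

lemma quotient_on_mult:
  assumes "quotient_on k V s" "quotient_on j V t"
  shows "quotient_on (k + j) V (\<lambda>v. s v * t v)"
proof -
  obtain F m G e where 1: "F \<in> homog_poly m" "G \<in> homog_poly e" "int m - int e = k"
    "\<forall>v. v \<in> \<Union>V \<longrightarrow> G v \<noteq> 0" "\<forall>v. v \<in> \<Union>V \<longrightarrow> s v = F v / G v" using assms(1) by (rule quotient_onE)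
  obtain F' m' G' e' where 2: "F' \<in> homog_poly m'" "G' \<in> homog_poly e'" "int m' - int e' = j"
    "\<forall>v. v \<in> \<Union>V \<longrightarrow> G' v \<noteq> 0" "\<forall>v. v \<in> \<Union>V \<longrightarrow> t v = F' v / G' v" using assms(2) by (rule quotient_onE)
  show ?thesis
    by (rule quotient_onI[OF homog_poly_mult[OF 1(1) 2(1)] homog_poly_mult[OF 1(2) 2(2)]])
      (use 1 2 in \<open>auto simp del: Union_iff\<close>)
qed

lemma quotient_on_homog: "F \<in> homog_poly k \<Longrightarrow> quotient_on (int k) V F"
  by (rule quotient_onI[OF _ homog_poly_const[of 1]]) auto

lemma regular_onD:
  assumes "regular_on k U s" "v \<in> \<Union>U"
  obtains V where "openin zariski V" "v \<in> \<Union>V" "V \<subseteq> U" "quotient_on k V s"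
  using assms unfolding regular_on_def by blast

lemma regular_onI:
  assumes "U \<subseteq> P2"
    and "\<And>v. v \<in> \<Union>U \<Longrightarrow> \<exists>V. openin zariski V \<and> v \<in> \<Union>V \<and> V \<subseteq> U \<and> quotient_on k V s"
  shows "regular_on k U s"
  unfolding regular_on_def
proof
  fix p assume p: "p \<in> U"
  then obtain v where v: "p = pt v" "v \<noteq> 0" using assms(1) unfolding P2_eq by auto
  have "v \<in> \<Union>U" using v p pt_self by blast
  then obtain V where V: "openin zariski V" "v \<in> \<Union>V" "V \<subseteq> U" "quotient_on k V s"
    using assms(2) by meson
  then have "p \<in> V" using in_cone_iff[OF openin_subset_P2[OF V(1)]] v(1) by simp
  then show "\<exists>V. openin zariski V \<and> p \<in> V \<and> V \<subseteq> U \<and> quotient_on k V s"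
    using V by (intro exI[of _ V]) simp
qed

lemma regular_on_subset:
  assumes "regular_on k U s" "openin zariski V" "V \<subseteq> U"
  shows "regular_on k V s"
proof (rule regular_onI[OF openin_subset_P2[OF assms(2)]])
  fix v assume v: "v \<in> \<Union>V"
  then have "v \<in> \<Union>U" using assms(3) by blast
  then obtain W where W: "openin zariski W" "v \<in> \<Union>W" "quotient_on k W s"
    using assms(1) by (elim regular_onD)
  then show "\<exists>W. openin zariski W \<and> v \<in> \<Union>W \<and> W \<subseteq> V \<and> quotient_on k W s"
    using v assms(2) by (intro exI[of _ "W \<inter> V"] conjI openin_Int)
      (simp_all add: cone_Int quotient_on_subset del: Union_iff)
qed

lemma regular_on_cong:
  assumes "regular_on k U s" "\<And>v. v \<in> \<Union>U \<Longrightarrow> s v = s' v"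
  shows "regular_on k U s'"
  unfolding regular_on_def
proof
  fix p assume "p \<in> U"
  then obtain V where V: "openin zariski V" "p \<in> V" "V \<subseteq> U" "quotient_on k V s"
    using assms(1) unfolding regular_on_def by meson
  have "quotient_on k V s'"
    by (rule quotient_on_cong[OF V(4)]) (rule assms(2), use V(3) in blast)
  then show "\<exists>V. openin zariski V \<and> p \<in> V \<and> V \<subseteq> U \<and> quotient_on k V s'"
    using V by (intro exI[of _ V]) simp
qed

lemma regular_on_local:
  assumes "U \<subseteq> P2"
    and "\<And>v. v \<in> \<Union>U \<Longrightarrow> \<exists>V. openin zariski V \<and> v \<in> \<Union>V \<and> V \<subseteq> U \<and> regular_on k V s"
  shows "regular_on k U s"
proof (rule regular_onI[OF assms(1)])
  fix v assume "v \<in> \<Union>U"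
  then obtain V where V: "openin zariski V" "v \<in> \<Union>V" "V \<subseteq> U" "regular_on k V s"
    using assms(2) by meson
  obtain W where "openin zariski W" "v \<in> \<Union>W" "W \<subseteq> V" "quotient_on k W s"
    using V(4,2) by (rule regular_onD)
  then show "\<exists>V. openin zariski V \<and> v \<in> \<Union>V \<and> V \<subseteq> U \<and> quotient_on k V s"
    using V(3) by (intro exI[of _ W]) simp
qed

lemma regular_on_op:
  assumes "openin zariski U" "regular_on k U s" "regular_on j U t"
    and "\<And>V. quotient_on k V s \<Longrightarrow> quotient_on j V t \<Longrightarrow> quotient_on i V r"
  shows "regular_on i U r"
proof (rule regular_onI[OF openin_subset_P2[OF assms(1)]])
  fix v assume v: "v \<in> \<Union>U"
  obtain V where V: "openin zariski V" "v \<in> \<Union>V" "V \<subseteq> U" "quotient_on k V s"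
    using assms(2) v by (rule regular_onD)
  obtain W where W: "openin zariski W" "v \<in> \<Union>W" "W \<subseteq> U" "quotient_on j W t"
    using assms(3) v by (rule regular_onD)
  have "quotient_on i (V \<inter> W) r"
    by (rule assms(4)) (use V(4) W(4) quotient_on_subset in auto)
  then show "\<exists>V. openin zariski V \<and> v \<in> \<Union>V \<and> V \<subseteq> U \<and> quotient_on i V r"
    using V W by (intro exI[of _ "V \<inter> W"] conjI openin_Int)
      (simp_all add: cone_Int le_infI1 del: Union_iff)
qed

lemma regular_on_add:
  "openin zariski U \<Longrightarrow> regular_on k U s \<Longrightarrow> regular_on k U t \<Longrightarrow> regular_on k U (\<lambda>v. s v + t v)"
  by (rule regular_on_op[OF _ _ _ quotient_on_add])

lemma regular_on_mult:
  "openin zariski U \<Longrightarrow> regular_on k U s \<Longrightarrow> regular_on j U t \<Longrightarrow> regular_on (k + j) U (\<lambda>v. s v * t v)"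
  by (rule regular_on_op[OF _ _ _ quotient_on_mult])

lemma regular_on_mult':
  "openin zariski U \<Longrightarrow> regular_on k U s \<Longrightarrow> regular_on j U t \<Longrightarrow> k + j = i \<Longrightarrow> regular_on i U (\<lambda>v. s v * t v)"
  using regular_on_mult by blast

lemma regular_on_homog: "openin zariski U \<Longrightarrow> F \<in> homog_poly k \<Longrightarrow> regular_on (int k) U F"
  by (rule regular_onI[OF openin_subset_P2])
    (auto intro!: exI[of _ U] quotient_on_homog simp del: Union_iff)

lemma regular_on_linear: "openin zariski U \<Longrightarrow> regular_on 1 U (scalar_product \<alpha>)"
  using regular_on_homog[OF _ homog_poly_linear] by simp

lemma regular_on_coord: "openin zariski U \<Longrightarrow> regular_on 1 U (\<lambda>v. v $ i)"
  using regular_on_homog[OF _ homog_poly_coord] by simp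

lemma regular_on_const: "openin zariski U \<Longrightarrow> regular_on 0 U (\<lambda>v. c)"
  using regular_on_homog[OF _ homog_poly_const] by simp

lemma regular_on_cmult: "openin zariski U \<Longrightarrow> regular_on k U s \<Longrightarrow> regular_on k U (\<lambda>v. c * s v)"
  using regular_on_mult[OF _ regular_on_const] by simp

lemma regular_on_uminus: "openin zariski U \<Longrightarrow> regular_on k U s \<Longrightarrow> regular_on k U (\<lambda>v. - s v)"
  using regular_on_cmult[of U k s "-1"] by simp

lemma regular_on_diff:
  "openin zariski U \<Longrightarrow> regular_on k U s \<Longrightarrow> regular_on k U t \<Longrightarrow> regular_on k U (\<lambda>v. s v - t v)"
  using regular_on_add[OF _ _ regular_on_uminus, of U k s t] by simp

definition chart :: "3 \<Rightarrow> point set"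
  where "chart i = nonvanishing (\<lambda>v. v $ i)"

lemma openin_chart: "openin zariski (chart i)"
  unfolding chart_def by (rule openin_nonvanishing[OF homog_poly_coord])

lemma cone_chart: "v \<in> \<Union>(chart i) \<longleftrightarrow> v $ i \<noteq> 0"
  unfolding chart_def by (subst cone_nonvanishing[OF homog_poly_coord]) auto

lemma exists_chart:
  assumes "v \<noteq> (0 :: complex ^ 3)"
  obtains i where "v \<in> \<Union>(chart i)"
  using assms unfolding cone_chart by (auto simp: vec_eq_iff)

lemma regular_on_coord_powi:
  assumes "openin zariski U" "U \<subseteq> chart i"
  shows "regular_on k U (\<lambda>v. v $ i powi k)"
proof (rule regular_onI[OF openin_subset_P2[OF assms(1)]])
  fix v assume v: "v \<in> \<Union>U"
  have nz: "w $ i \<noteq> 0" if "w \<in> \<Union>U" for w :: "complex ^ 3"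
    using that assms(2) cone_chart[of w i] by blast
  have "quotient_on k U (\<lambda>v. v $ i powi k)"
  proof (cases "k \<ge> 0")
    case True
    have "(\<lambda>v. v $ i ^ nat k) \<in> homog_poly (nat k)"
      using homog_poly_power[OF homog_poly_coord, of i "nat k"] by simp
    from quotient_on_homog[OF this, of U] show ?thesis
      using True by (simp add: power_int_def)
  next
    case False
    have "(\<lambda>v. v $ i ^ nat (- k)) \<in> homog_poly (nat (- k))"
      using homog_poly_power[OF homog_poly_coord, of i "nat (- k)"] by simp
    then show ?thesis
      by (rule quotient_onI[OF homog_poly_const[of 1]])
        (use False nz in \<open>auto simp: power_int_def field_simps simp del: Union_iff\<close>)
  qed
  then show "\<exists>V. openin zariski V \<and> v \<in> \<Union>V \<and> V \<subseteq> U \<and> quotient_on k V (\<lambda>v. v $ i powi k)"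
    using assms(1) v by (intro exI[of _ U]) simp
qed

lemma regular_on_zero:
  assumes "openin zariski U"
  shows "regular_on k U (\<lambda>v. 0)"
proof (rule regular_on_local[OF openin_subset_P2[OF assms]])
  fix v assume v: "v \<in> \<Union>U"
  then have "v \<noteq> 0" using in_cone_iff[OF openin_subset_P2[OF assms]] by blast
  then obtain i where i: "v \<in> \<Union>(chart i)" by (rule exists_chart)
  have o: "openin zariski (U \<inter> chart i)" using assms openin_chart by (rule openin_Int)
  have "regular_on k (U \<inter> chart i) (\<lambda>v. 0)"
    using regular_on_cmult[OF o regular_on_coord_powi[OF o, of i k], of 0] by simp
  then show "\<exists>V. openin zariski V \<and> v \<in> \<Union>V \<and> V \<subseteq> U \<and> regular_on k V (\<lambda>v. 0)"
    using o v i by (intro exI[of _ "U \<inter> chart i"]) (simp add: cone_Int[OF assms openin_chart] del: Union_iff)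
qed

lemma regular_on_sum:
  assumes "openin zariski U" "\<And>i. i \<in> I \<Longrightarrow> regular_on k U (s i)"
  shows "regular_on k U (\<lambda>v. \<Sum>i\<in>I. s i v)"
  using assms(2) by (induction I rule: infinite_finite_induct)
    (auto intro: regular_on_zero regular_on_add assms(1))

lemma regular_on_scale:
  assumes "openin zariski U" "regular_on k U s" "v \<in> \<Union>U" "c \<noteq> 0"
  shows "s (c *s v) = c powi k * s v"
proof -
  obtain V where V: "openin zariski V" "v \<in> \<Union>V" "V \<subseteq> U" "quotient_on k V s"
    using assms(2,3) by (rule regular_onD)
  obtain F m G e where 1: "F \<in> homog_poly m" "G \<in> homog_poly e" "int m - int e = k"
    "\<forall>v. v \<in> \<Union>V \<longrightarrow> G v \<noteq> 0" "\<forall>v. v \<in> \<Union>V \<longrightarrow> s v = F v / G v" using V(4) by (rule quotient_onE)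
  have cv: "c *s v \<in> \<Union>V" using cone_scale[OF openin_subset_P2] V assms(4) by blast
  have "c powi k = c ^ m / c ^ e"
    using 1(3)[symmetric] assms(4) by (simp add: power_int_diff)
  then show ?thesis
    using 1(5)[rule_format, OF V(2)] 1(5)[rule_format, OF cv] by (simp add: homog_poly_scale[OF 1(1)] homog_poly_scale[OF 1(2)])
qed

lemma continuous_on_line: "continuous_on S (\<lambda>t. a + t *s (b :: complex ^ 'n))"
proof -
  have "(\<lambda>t. a + t *s b) = (\<lambda>t. \<chi> i. a $ i + t * b $ i)"
    by (auto simp: vec_eq_iff)
  then show ?thesis by (simp only:) (auto intro!: continuous_intros)
qed

lemma isCont_line: "isCont (\<lambda>t. a + t *s (b :: complex ^ 'n)) t"
  using continuous_on_line[where S=UNIV and a=a and b=b] by (simp add: continuous_on_eq_continuous_at)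

lemma regular_on_isCont:
  assumes "openin zariski U" "regular_on k U s" "v \<in> \<Union>U"
  shows "isCont s v"
proof -
  obtain V where V: "openin zariski V" "v \<in> \<Union>V" "V \<subseteq> U" "quotient_on k V s"
    using assms(2,3) by (rule regular_onD)
  obtain F m G e where 1: "F \<in> homog_poly m" "G \<in> homog_poly e" "int m - int e = k"
    "\<forall>v. v \<in> \<Union>V \<longrightarrow> G v \<noteq> 0" "\<forall>v. v \<in> \<Union>V \<longrightarrow> s v = F v / G v" using V(4) by (rule quotient_onE)
  have "continuous_on (\<Union>V) (\<lambda>v. F v / G v)"
    using 1(4) by (intro continuous_on_divide homog_poly_continuous[OF 1(1)] homog_poly_continuous[OF 1(2)]) blast
  then have "continuous_on (\<Union>V) s"
    using 1(5) by (subst continuous_on_cong[OF refl]) auto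
  then show ?thesis
    using continuous_on_eq_continuous_at[OF open_cone[OF V(1)]] V(2) by blast
qed

text \<open>Sections are continuous for the classical topology, so that an identity holding at the points
  of a punctured disc holds at its centre. This replaces the usual irreducibility arguments.\<close>

lemma regular_zero_by_density:
  assumes "openin zariski U" "regular_on k U s" "v \<in> \<Union>U"
    and "\<forall>\<^sub>F t in at 0. v + t *s e \<in> \<Union>U \<longrightarrow> s (v + t *s e) = 0"
  shows "s v = 0"
proof -
  have line: "((\<lambda>t. v + t *s e) \<longlongrightarrow> v) (at 0)"
    using isCont_line[where a=v and b=e and t=0] unfolding isCont_def by simp
  have "\<forall>\<^sub>F t in at 0. v + t *s e \<in> \<Union>U"
    using topological_tendstoD[OF line open_cone[OF assms(1)] assms(3)] .
  with assms(4) have "\<forall>\<^sub>F t in at 0. s (v + t *s e) = 0"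
    by eventually_elim blast
  then have "((\<lambda>t. s (v + t *s e)) \<longlongrightarrow> 0) (at 0)"
    by (simp add: tendsto_eventually)
  moreover have "((\<lambda>t. s (v + t *s e)) \<longlongrightarrow> s v) (at 0)"
    using isCont_tendsto_compose[OF regular_on_isCont[OF assms(1-3)] line] .
  ultimately show ?thesis
    using tendsto_unique[OF at_neq_bot] by blast
qed

lemma eventually_at_avoid_finite: "finite T \<Longrightarrow> \<forall>\<^sub>F t in at (x::complex). t \<notin> T"
  using islimpt_finite[of T x] by (auto simp: islimpt_iff_eventually)

lemma eventually_linear_nonzero:
  assumes "scalar_product \<beta> e \<noteq> 0"
  shows "\<forall>\<^sub>F t in at (0::complex). scalar_product \<beta> (v + t *s e) \<noteq> 0"
proof -
  have "\<forall>\<^sub>F t in at 0. t \<notin> {- scalar_product \<beta> v / scalar_product \<beta> e}"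
    by (rule eventually_at_avoid_finite) simp
  then show ?thesis
  proof eventually_elim
    case (elim t)
    then show ?case
      using assms by (auto simp: scalar_product_simps add_eq_0_iff field_simps)
  qed
qed

lemma regular_zero_off_line:
  assumes "openin zariski U" "regular_on k U s" "\<alpha> \<noteq> 0"
    and "\<And>v. v \<in> \<Union>U \<Longrightarrow> scalar_product \<alpha> v \<noteq> 0 \<Longrightarrow> s v = 0"
    and "v \<in> \<Union>U"
  shows "s v = 0"
proof -
  obtain e where e: "scalar_product \<alpha> e = 1" using exists_scalar_product_eq[OF assms(3)] .
  have "\<forall>\<^sub>F t in at 0. scalar_product \<alpha> (v + t *s e) \<noteq> 0"
    by (rule eventually_linear_nonzero) (simp add: e)
  then have "\<forall>\<^sub>F t in at 0. v + t *s e \<in> \<Union>U \<longrightarrow> s (v + t *s e) = 0"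
    by eventually_elim (use assms(4) in blast)
  then show ?thesis using regular_zero_by_density assms by blast
qed

lemma regular_zero_on_line:
  assumes "openin zariski U" "regular_on k U s"
    and "\<And>v. v \<in> \<Union>U \<Longrightarrow> scalar_product \<alpha> v = 0 \<Longrightarrow> scalar_product \<beta> v \<noteq> 0 \<Longrightarrow> s v = 0"
    and "scalar_product \<alpha> e = 0" "scalar_product \<beta> e \<noteq> 0"
    and "v \<in> \<Union>U" "scalar_product \<alpha> v = 0"
  shows "s v = 0"
proof -
  have "\<forall>\<^sub>F t in at 0. scalar_product \<beta> (v + t *s e) \<noteq> 0"
    by (rule eventually_linear_nonzero) (simp add: assms)
  then have "\<forall>\<^sub>F t in at 0. v + t *s e \<in> \<Union>U \<longrightarrow> s (v + t *s e) = 0"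
  proof eventually_elim
    case (elim t)
    have "scalar_product \<alpha> (v + t *s e) = 0" by (simp add: scalar_product_simps assms)
    with elim show ?case using assms(3) by blast
  qed
  then show ?thesis using regular_zero_by_density assms(1,2,6) by blast
qed

lemma regular_on_holomorphic_line:
  assumes "openin zariski U" "regular_on k U s" "\<And>t. a + t *s b \<in> \<Union>U"
  shows "(\<lambda>t. s (a + t *s b)) holomorphic_on UNIV"
proof (rule analytic_imp_holomorphic, subst analytic_on_analytic_at, intro ballI)
  fix t
  obtain V where V: "openin zariski V" "a + t *s b \<in> \<Union>V" "V \<subseteq> U" "quotient_on k V s"
    using assms(2,3) by (rule regular_onD)
  obtain F m G e where 1: "F \<in> homog_poly m" "G \<in> homog_poly e" "int m - int e = k"
    "\<forall>v. v \<in> \<Union>V \<longrightarrow> G v \<noteq> 0" "\<forall>v. v \<in> \<Union>V \<longrightarrow> s v = F v / G v" using V(4) by (rule quotient_onE)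
  obtain p q where p: "\<And>t. F (a + t *s b) = poly p t" and q: "\<And>t. G (a + t *s b) = poly q t"
    using homog_poly_along_line[OF 1(1)] homog_poly_along_line[OF 1(2)] by metis
  define S where "S = (\<lambda>t. a + t *s b) -` \<Union>V"
  have "open S"
    unfolding S_def by (rule open_vimage[OF open_cone[OF V(1)] continuous_on_line])
  moreover have "t \<in> S" using V(2) by (simp add: S_def)
  moreover have "(\<lambda>t. poly p t / poly q t) holomorphic_on S"
    using 1(4) by (intro holomorphic_on_divide holomorphic_intros)
      (auto simp: S_def q[symmetric])
  then have "(\<lambda>t. s (a + t *s b)) holomorphic_on S"
    by (rule holomorphic_transform) (use 1(5) p q in \<open>auto simp: S_def\<close>)
  ultimately show "(\<lambda>t. s (a + t *s b)) analytic_on {t}"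
    unfolding analytic_at by blast
qed

section \<open>Division by a linear form\<close>

text \<open>Joining a point of the open set to any other point of the line \<open>\<alpha> = 0\<close>, the form restricts to a
  polynomial in one variable with infinitely many zeros.\<close>

lemma homog_poly_zero_on_line:
  assumes "F \<in> homog_poly k" "open C" "a \<in> C" "scalar_product \<alpha> a = 0"
    and "\<And>v. v \<in> C \<Longrightarrow> scalar_product \<alpha> v = 0 \<Longrightarrow> F v = 0"
    and "scalar_product \<alpha> v = 0"
  shows "F v = 0"
proof -
  obtain p where p: "\<And>t. F (a + t *s (v - a)) = poly p t"
    using homog_poly_along_line[OF assms(1)] by blast
  have line: "((\<lambda>t. a + t *s (v - a)) \<longlongrightarrow> a) (at 0)"
    using isCont_line[where a=a and b="v - a" and t=0] unfolding isCont_def by simp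
  have "\<forall>\<^sub>F t in at 0. a + t *s (v - a) \<in> C"
    using topological_tendstoD[OF line assms(2,3)] .
  then have ev: "\<forall>\<^sub>F t in at 0. poly p t = 0"
    by eventually_elim (use p assms in \<open>simp add: scalar_product_simps flip: p\<close>)
  have "p = 0"
  proof (rule ccontr)
    assume "p \<noteq> 0"
    then have "finite {t. poly p t = 0}" by (rule poly_roots_finite)
    then have "\<forall>\<^sub>F t in at 0. t \<notin> {t. poly p t = 0}" by (rule eventually_at_avoid_finite)
    with ev have "\<forall>\<^sub>F t in at (0::complex). False" by eventually_elim simp
    then show False by simp
  qed
  then show ?thesis using p[of 1] by simp
qed

text \<open>Off the line \<open>\<alpha>\<close> is invertible. At a point of the line the numerator of a local quotient vanishes
  along the line nearby, hence on all of it, and the factor theorem applies.\<close>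

lemma regular_on_divide_local:
  assumes "openin zariski U" "regular_on k U s" "\<alpha> \<noteq> 0"
    and "\<And>v. v \<in> \<Union>U \<Longrightarrow> scalar_product \<alpha> v = 0 \<Longrightarrow> s v = 0"
    and "v \<in> \<Union>U"
  shows "\<exists>V s'. openin zariski V \<and> v \<in> \<Union>V \<and> V \<subseteq> U \<and> regular_on (k - 1) V s' \<and>
    (\<forall>w\<in>\<Union>V. s w = scalar_product \<alpha> w * s' w)"
proof -
  obtain V where V: "openin zariski V" "v \<in> \<Union>V" "V \<subseteq> U" "quotient_on k V s"
    using assms(2,5) by (rule regular_onD)
  have VP: "V \<subseteq> P2" using openin_subset_P2 V(1) .
  obtain F m G e where 1: "F \<in> homog_poly m" "G \<in> homog_poly e" "int m - int e = k"
    "\<forall>v. v \<in> \<Union>V \<longrightarrow> G v \<noteq> 0" "\<forall>v. v \<in> \<Union>V \<longrightarrow> s v = F v / G v" using V(4) by (rule quotient_onE)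
  show ?thesis
  proof (cases "scalar_product \<alpha> v = 0")
    case False
    define W where "W = V \<inter> nonvanishing (scalar_product \<alpha>)"
    have N: "openin zariski (nonvanishing (scalar_product \<alpha>))"
      by (rule openin_nonvanishing[OF homog_poly_linear])
    have W: "openin zariski W" "W \<subseteq> V" unfolding W_def using V(1) N by auto
    have Wc: "w \<in> \<Union>W \<longleftrightarrow> w \<in> \<Union>V \<and> scalar_product \<alpha> w \<noteq> 0" for w
      unfolding W_def cone_Int[OF V(1) N] Int_iff cone_nonvanishing[OF homog_poly_linear]
      using in_cone_iff[OF VP] by blast
    have "quotient_on (k - 1) W (\<lambda>w. s w / scalar_product \<alpha> w)"
      by (rule quotient_onI[OF 1(1) homog_poly_mult[OF 1(2) homog_poly_linear]])
        (use 1 Wc in \<open>auto simp del: Union_iff\<close>)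
    then have "regular_on (k - 1) W (\<lambda>w. s w / scalar_product \<alpha> w)"
      using W(1) by (intro regular_onI[OF openin_subset_P2]) (auto simp del: Union_iff)
    then show ?thesis
      using W V(2,3) Wc False by (intro exI[of _ W] exI[of _ "\<lambda>w. s w / scalar_product \<alpha> w"])
        (auto simp del: Union_iff)
  next
    case True
    have "F w = 0" if "w \<in> \<Union>V" "scalar_product \<alpha> w = 0" for w
    proof -
      have "w \<in> \<Union>U" using that V(3) by blast
      then show ?thesis using assms(4)[of w] that 1(4,5) by (simp del: Union_iff)
    qed
    then have "F w = 0" if "scalar_product \<alpha> w = 0" for w
      using homog_poly_zero_on_line[OF 1(1) open_cone[OF V(1)] V(2) True] that by blast
    from homog_poly_factor[OF 1(1) assms(3) this]
    obtain F' where F': "m = 0 \<longrightarrow> F' = (\<lambda>v. 0)" "F' \<in> homog_poly (m - 1)"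
      "\<And>v. F v = scalar_product \<alpha> v * F' v" by blast
    have r: "regular_on (k - 1) V (\<lambda>w. F' w / G w)"
    proof (cases "m = 0")
      case True
      then show ?thesis using F'(1) regular_on_zero[OF V(1)] by simp
    next
      case False
      have "quotient_on (k - 1) V (\<lambda>w. F' w / G w)"
        by (rule quotient_onI[OF F'(2) 1(2)]) (use 1 False in \<open>auto simp del: Union_iff\<close>)
      then show ?thesis
        using V(1) by (intro regular_onI[OF openin_subset_P2]) (auto simp del: Union_iff)
    qed
    then show ?thesis
      using V 1(5) F'(3) by (intro exI[of _ V] exI[of _ "\<lambda>w. F' w / G w"]) (auto simp del: Union_iff)
  qed
qed

text \<open>The local quotients by \<open>\<alpha>\<close> glue, since they agree off the line and hence everywhere.\<close>

lemma regular_on_divide: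
  assumes "openin zariski U" "regular_on k U s" "\<alpha> \<noteq> 0"
    and "\<And>v. v \<in> \<Union>U \<Longrightarrow> scalar_product \<alpha> v = 0 \<Longrightarrow> s v = 0"
  obtains s' where "regular_on (k - 1) U s'" "\<And>v. v \<in> \<Union>U \<Longrightarrow> s v = scalar_product \<alpha> v * s' v"
proof -
  have "\<forall>v. \<exists>V s'. v \<in> \<Union>U \<longrightarrow> openin zariski V \<and> v \<in> \<Union>V \<and> V \<subseteq> U \<and> regular_on (k - 1) V s' \<and>
      (\<forall>w\<in>\<Union>V. s w = scalar_product \<alpha> w * s' w)"
    using regular_on_divide_local[OF assms] by meson
  then obtain V q where Vq: "\<And>v. v \<in> \<Union>U \<Longrightarrow> openin zariski (V v) \<and> v \<in> \<Union>(V v) \<and> V v \<subseteq> U \<and>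
      regular_on (k - 1) (V v) (q v) \<and> (\<forall>w\<in>\<Union>(V v). s w = scalar_product \<alpha> w * q v w)"
    by metis
  define s' where "s' v = q v v" for v
  have agree: "q v w = s' w" if v: "v \<in> \<Union>U" and w: "w \<in> \<Union>(V v)" for v w
  proof -
    have wU: "w \<in> \<Union>U" using Vq[OF v] w by blast
    define I where "I = V v \<inter> V w"
    have ov: "openin zariski (V v)" and ow: "openin zariski (V w)" using Vq v wU by auto
    have oI: "openin zariski I" unfolding I_def using ov ow by (rule openin_Int)
    have rv: "regular_on (k - 1) I (q v)" "regular_on (k - 1) I (q w)"
      using regular_on_subset[OF _ oI, of "k - 1" "V v"] regular_on_subset[OF _ oI, of "k - 1" "V w"]
        Vq[OF v] Vq[OF wU] by (auto simp: I_def)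
    have wI: "w \<in> \<Union>I" unfolding I_def cone_Int[OF ov ow] using w Vq[OF wU] by blast
    have "q v w - q w w = 0"
    proof (rule regular_zero_off_line[OF oI regular_on_diff[OF oI rv] assms(3) _ wI])
      fix x assume x: "x \<in> \<Union>I" "scalar_product \<alpha> x \<noteq> 0"
      then have "x \<in> \<Union>(V v)" "x \<in> \<Union>(V w)" unfolding I_def cone_Int[OF ov ow] by auto
      then have "s x = scalar_product \<alpha> x * q v x" "s x = scalar_product \<alpha> x * q w x"
        using Vq[OF v] Vq[OF wU] by blast+
      then show "q v x - q w x = 0" using x(2) by simp
    qed
    then show ?thesis by (simp add: s'_def)
  qed
  show ?thesis
  proof (rule that)
    show "regular_on (k - 1) U s'"
    proof (rule regular_on_local[OF openin_subset_P2[OF assms(1)]])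
      fix v assume v: "v \<in> \<Union>U"
      have "regular_on (k - 1) (V v) s'"
        by (rule regular_on_cong[of "k - 1" "V v" "q v"]) (use Vq[OF v] agree[OF v] in blast)+
      then show "\<exists>V. openin zariski V \<and> v \<in> \<Union>V \<and> V \<subseteq> U \<and> regular_on (k - 1) V s'"
        using Vq[OF v] by blast
    qed
  next
    fix v assume v: "v \<in> \<Union>U"
    then show "s v = scalar_product \<alpha> v * s' v"
      using Vq[OF v] unfolding s'_def by blast
  qed
qed

section \<open>Homomorphisms out of sums of twists\<close>

definition vregular_on :: "int \<Rightarrow> point set \<Rightarrow> (complex ^ 3 \<Rightarrow> complex ^ 'n) \<Rightarrow> bool"
  where "vregular_on k U s \<longleftrightarrow> (\<forall>i. regular_on k U (\<lambda>v. s v $ i))"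

lemma restr_in: "v \<in> \<Union>U \<Longrightarrow> restr U s v = s v"
  unfolding restr_def by (rule if_P)

lemma restr_out: "v \<notin> \<Union>U \<Longrightarrow> restr U s v = 0"
  unfolding restr_def by (rule if_not_P)

lemma twist_sum_iff:
  fixes k :: "int ^ 'n::finite"
  shows
  "s \<in> twist_sum k U \<longleftrightarrow> (\<forall>v. v \<notin> \<Union>U \<longrightarrow> s v = 0) \<and> (\<forall>i. regular_on (k $ i) U (\<lambda>v. s v $ i))"
  unfolding twist_sum_def twist_iff mem_Collect_eq vec_eq_iff zero_index by (iprover intro: iffI allI conjI elim: conjE)

lemma restr_twist_sum:
  fixes k :: "int ^ 'n::finite"
  assumes "\<And>i. regular_on (k $ i) U (\<lambda>v. s v $ i)"
  shows "restr U s \<in> twist_sum k U"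
  unfolding twist_sum_iff
proof (intro conjI allI impI restr_out)
  fix i
  show "regular_on (k $ i) U (\<lambda>v. restr U s v $ i)"
    by (rule regular_on_cong[OF assms]) (simp add: restr_in del: Union_iff)
qed

lemma sheaf_homD:
  assumes "sheaf_hom E F \<phi>" "openin zariski U"
  shows "s \<in> E U \<Longrightarrow> \<phi> U s \<in> F U"
    and "s \<in> E U \<Longrightarrow> t \<in> E U \<Longrightarrow> \<phi> U (\<lambda>v. s v + t v) = (\<lambda>v. \<phi> U s v + \<phi> U t v)"
    and "r \<in> twist 0 U \<Longrightarrow> s \<in> E U \<Longrightarrow> \<phi> U (\<lambda>v. r v *s s v) = (\<lambda>v. r v *s \<phi> U s v)"
    and "openin zariski V \<Longrightarrow> V \<subseteq> U \<Longrightarrow> s \<in> E U \<Longrightarrow> \<phi> V (restr V s) = restr V (\<phi> U s)"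
  using assms(1)[unfolded sheaf_hom_def, rule_format, OF assms(2)] by simp_all

lemma twist_sum_zero: "openin zariski U \<Longrightarrow> (\<lambda>v. 0) \<in> twist_sum k U"
  unfolding twist_sum_iff by (simp add: regular_on_zero)

lemma twist_sum_add:
  "openin zariski U \<Longrightarrow> s \<in> twist_sum k U \<Longrightarrow> t \<in> twist_sum k U \<Longrightarrow> (\<lambda>v. s v + t v) \<in> twist_sum k U"
  unfolding twist_sum_iff by (simp add: regular_on_add)

lemma twist_sum_sum:
  assumes "openin zariski U" "\<And>j. j \<in> J \<Longrightarrow> t j \<in> twist_sum k U"
  shows "(\<lambda>v. \<Sum>j\<in>J. t j v) \<in> twist_sum k U"
  using assms(2) by (induction J rule: infinite_finite_induct)
    (simp_all add: twist_sum_zero twist_sum_add assms(1))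

lemma twist_sum_mult:
  assumes "openin zariski U" "r \<in> twist 0 U" "s \<in> twist_sum k U"
  shows "(\<lambda>v. r v *s s v) \<in> twist_sum k U"
  using assms regular_on_mult[OF assms(1), of 0 r] unfolding twist_sum_iff twist_iff by simp

lemma sheaf_hom_sum:
  assumes "sheaf_hom (twist_sum k) F \<phi>" "openin zariski U" "\<And>j. j \<in> J \<Longrightarrow> t j \<in> twist_sum k U"
  shows "\<phi> U (\<lambda>v. \<Sum>j\<in>J. t j v) = (\<lambda>v. \<Sum>j\<in>J. \<phi> U (t j) v)"
proof -
  have "(\<lambda>v. 0) \<in> twist 0 U" using assms(2) unfolding twist_iff by (simp add: regular_on_zero)
  from sheaf_homD(3)[OF assms(1,2) this twist_sum_zero[OF assms(2)]]
  have zero: "\<phi> U (\<lambda>v. 0) = (\<lambda>v. 0)" by simp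
  show ?thesis
    using assms(3)
  proof (induction J rule: infinite_finite_induct)
    case (insert j J)
    then have "\<phi> U (\<lambda>v. t j v + (\<Sum>j\<in>J. t j v)) = (\<lambda>v. \<phi> U (t j) v + \<phi> U (\<lambda>v. \<Sum>j\<in>J. t j v) v)"
      by (intro sheaf_homD(2)[OF assms(1,2)] twist_sum_sum assms(2)) auto
    with insert show ?case by simp
  qed (simp_all add: zero)
qed

definition chart_section :: "int ^ 'm::finite \<Rightarrow> 3 \<Rightarrow> 'm \<Rightarrow> 'm sect"
  where "chart_section k i j = restr (chart i) (\<lambda>v. axis j (v $ i powi k $ j))"

lemma chart_section_in_twist_sum: "chart_section k i j \<in> twist_sum k (chart i)"
  unfolding chart_section_def
proof (rule restr_twist_sum)
  fix j'
  show "regular_on (k $ j') (chart i) (\<lambda>v. axis j (v $ i powi k $ j) $ j')"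
  proof (cases "j' = j")
    case True
    then show ?thesis using regular_on_coord_powi[OF openin_chart subset_refl] by (simp add: axis_def)
  next
    case False
    then show ?thesis using regular_on_zero[OF openin_chart] by (simp add: axis_def)
  qed
qed

text \<open>A sum of twists is generated, over each coordinate chart, by one power of the coordinate for
  each summand. The images of these generators, rescaled to remove the power, agree on overlaps and
  form the columns of a matrix of global regular functions that represents the homomorphism.\<close>

lemma sheaf_hom_columns:
  fixes k :: "int ^ 'm::finite" and d :: "int ^ 'n::finite"
  assumes hom: "sheaf_hom (twist_sum k) F \<phi>"
    and sub: "\<And>U. openin zariski U \<Longrightarrow> F U \<subseteq> twist_sum d U"
  obtains \<theta> where "\<And>i j. regular_on (d $ i - k $ j) P2 (\<lambda>v. \<theta> j v $ i)"
    and "\<And>U s. openin zariski U \<Longrightarrow> s \<in> twist_sum k U \<Longrightarrow> \<phi> U s = (\<lambda>v. \<Sum>j\<in>UNIV. s v $ j *s \<theta> j v)"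
proof -
  define E where "E = chart_section k"
  define N where "N i j v = v $ i powi (- k $ j) *s \<phi> (chart i) (E i j) v" for i j v
  note Ein = chart_section_in_twist_sum[of k, folded E_def]
  have E: "E i j v = axis j (v $ i powi k $ j)" if "v \<in> \<Union>(chart i)" for i j v
    unfolding E_def chart_section_def using that by (rule restr_in)
  have A: "\<phi> U s v = (\<Sum>j\<in>UNIV. s v $ j *s N i j v)"
    if U: "openin zariski U" "U \<subseteq> chart i" and s: "s \<in> twist_sum k U" and v: "v \<in> \<Union>U" for U i s v
  proof -
    define r where "r j v = s v $ j * (v $ i powi (- k $ j))" for j and v :: "complex ^ 3"
    have r: "r j \<in> twist 0 U" for j
      unfolding twist_iff
    proof (intro conjI allI impI)
      show "r j v = 0" if "v \<notin> \<Union>U" for v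
        using s that unfolding twist_sum_iff r_def by (simp del: Union_iff)
      show "regular_on 0 U (r j)"
        unfolding r_def
        by (rule regular_on_mult'[OF U(1) _ regular_on_coord_powi[OF U], of "k $ j"])
          (use s in \<open>simp_all add: twist_sum_iff\<close>)
    qed
    have res: "restr U (E i j) \<in> twist_sum k U" for j
      using regular_on_subset[OF _ U] Ein[of i j] by (intro restr_twist_sum) (auto simp: twist_sum_iff)
    have nz: "w $ i \<noteq> 0" if "w \<in> \<Union>U" for w :: "complex ^ 3"
      using that U(2) cone_chart[of w i] by blast
    have "s = (\<lambda>w. \<Sum>j\<in>UNIV. r j w *s restr U (E i j) w)"
    proof
      fix w
      show "s w = (\<Sum>j\<in>UNIV. r j w *s restr U (E i j) w)"
      proof (cases "w \<in> \<Union>U")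
        case True
        then have "w \<in> \<Union>(chart i)" using U(2) by blast
        then show ?thesis
          using True nz[OF True]
          by (simp add: vec_eq_iff restr_in E r_def axis_def if_distrib power_int_minus cong: if_cong del: Union_iff)
      next
        case False
        then show ?thesis using s by (simp add: restr_out twist_sum_iff del: Union_iff)
      qed
    qed
    then have "\<phi> U s = \<phi> U (\<lambda>w. \<Sum>j\<in>UNIV. r j w *s restr U (E i j) w)" by simp
    also have "\<dots> = (\<lambda>w. \<Sum>j\<in>UNIV. \<phi> U (\<lambda>w. r j w *s restr U (E i j) w) w)"
      by (intro sheaf_hom_sum[OF hom U(1)] twist_sum_mult U(1) r res)
    also have "\<dots> = (\<lambda>w. \<Sum>j\<in>UNIV. r j w *s \<phi> U (restr U (E i j)) w)"
      by (simp add: sheaf_homD(3)[OF hom U(1) r res])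
    also have "\<dots> = (\<lambda>w. \<Sum>j\<in>UNIV. r j w *s restr U (\<phi> (chart i) (E i j)) w)"
      by (simp add: sheaf_homD(4)[OF hom openin_chart U Ein])
    finally show ?thesis
      using v by (simp add: restr_in N_def r_def del: Union_iff)
  qed
  have B: "\<phi> U s v = (\<Sum>j\<in>UNIV. s v $ j *s N i j v)"
    if U: "openin zariski U" and s: "s \<in> twist_sum k U" and v: "v \<in> \<Union>U" "v \<in> \<Union>(chart i)" for U i s v
  proof -
    define V where "V = U \<inter> chart i"
    have V: "openin zariski V" "V \<subseteq> U" "V \<subseteq> chart i" "v \<in> \<Union>V"
      unfolding V_def cone_Int[OF U openin_chart] using v U openin_chart by auto
    have "restr V s \<in> twist_sum k V"
      using regular_on_subset[OF _ V(1,2)] s by (intro restr_twist_sum) (auto simp: twist_sum_iff)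
    from A[OF V(1,3) this V(4)] show ?thesis
      using sheaf_homD(4)[OF hom U V(1,2) s] V(4) by (simp add: restr_in del: Union_iff)
  qed
  have NN: "N i j v = N i' j v" if "v \<in> \<Union>(chart i)" "v \<in> \<Union>(chart i')" for i i' j v
  proof -
    have *: "\<phi> (chart i) (E i j) v = v $ i powi k $ j *s N i'' j v" if "v \<in> \<Union>(chart i'')" for i''
    proof -
      have "\<phi> (chart i) (E i j) v = (\<Sum>j'\<in>UNIV. E i j v $ j' *s N i'' j' v)"
        by (rule B[OF openin_chart Ein \<open>v \<in> \<Union>(chart i)\<close> that])
      also have "\<dots> = (\<Sum>j'\<in>UNIV. if j' = j then v $ i powi k $ j *s N i'' j v else 0)"
        by (rule sum.cong) (simp_all add: E[OF \<open>v \<in> \<Union>(chart i)\<close>] axis_def)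
      finally show ?thesis by simp
    qed
    have "v $ i \<noteq> 0" using that(1) by (simp add: cone_chart del: Union_iff)
    then show ?thesis
      using *[OF that(1)] *[OF that(2)] by (simp add: vector_mul_lcancel)
  qed
  define \<theta> where "\<theta> j v = N (SOME i. v \<in> \<Union>(chart i)) j v" for j v
  have \<theta>: "\<theta> j v = N i j v" if "v \<in> \<Union>(chart i)" for i j v
    unfolding \<theta>_def by (rule NN[OF _ that]) (rule someI[of "\<lambda>i. v \<in> \<Union>(chart i)", OF that])
  show thesis
  proof (rule that)
    fix i j
    show "regular_on (d $ i - k $ j) P2 (\<lambda>v. \<theta> j v $ i)"
    proof (rule regular_on_local[OF subset_refl])
      fix v assume "v \<in> \<Union>P2"
      then have "v \<noteq> 0" by (simp add: in_cone_P2 del: Union_iff)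
      then obtain i' where i': "v \<in> \<Union>(chart i')" by (rule exists_chart)
      have "\<phi> (chart i') (E i' j) \<in> twist_sum d (chart i')"
        using sheaf_homD(1)[OF hom openin_chart Ein] sub[OF openin_chart] by blast
      then have "regular_on (d $ i - k $ j) (chart i') (\<lambda>v. (v $ i' powi (- k $ j)) * \<phi> (chart i') (E i' j) v $ i)"
        by (intro regular_on_mult'[OF openin_chart regular_on_coord_powi[OF openin_chart subset_refl]])
          (simp_all add: twist_sum_iff)
      then have "regular_on (d $ i - k $ j) (chart i') (\<lambda>v. \<theta> j v $ i)"
        by (rule regular_on_cong) (simp add: \<theta> N_def del: Union_iff)
      then show "\<exists>V. openin zariski V \<and> v \<in> \<Union>V \<and> V \<subseteq> P2 \<and> regular_on (d $ i - k $ j) V (\<lambda>v. \<theta> j v $ i)"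
        using openin_chart i' openin_subset_P2[OF openin_chart] by blast
    qed
  next
    fix U s assume U: "openin zariski U" and s: "s \<in> twist_sum k U"
    show "\<phi> U s = (\<lambda>v. \<Sum>j\<in>UNIV. s v $ j *s \<theta> j v)"
    proof
      fix v
      show "\<phi> U s v = (\<Sum>j\<in>UNIV. s v $ j *s \<theta> j v)"
      proof (cases "v \<in> \<Union>U")
        case True
        then have "v \<noteq> 0" using in_cone_iff[OF openin_subset_P2[OF U]] by blast
        then obtain i where i: "v \<in> \<Union>(chart i)" by (rule exists_chart)
        show ?thesis using B[OF U s True i] \<theta>[OF i] by simp
      next
        case False
        have "\<phi> U s \<in> twist_sum d U" using sheaf_homD(1)[OF hom U s] sub[OF U] by blast
        then show ?thesis using s False by (simp add: twist_sum_iff del: Union_iff)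
      qed
    qed
  qed
qed

text \<open>Conversely any matrix of functions defines a homomorphism, as soon as its values are sections of the
  target.\<close>

lemma sheaf_hom_of_columns:
  assumes "\<And>U s. openin zariski U \<Longrightarrow> s \<in> twist_sum k U \<Longrightarrow> (\<lambda>v. \<Sum>j\<in>UNIV. s v $ j *s \<theta> j v) \<in> F U"
  shows "sheaf_hom (twist_sum k) F (\<lambda>U s v. \<Sum>j\<in>UNIV. s v $ j *s \<theta> j v)"
  unfolding sheaf_hom_def
proof (intro allI impI conjI ballI)
  fix U s t r V assume U: "openin zariski U" and s: "s \<in> twist_sum k U"
  show "(\<lambda>v. \<Sum>j\<in>UNIV. s v $ j *s \<theta> j v) \<in> F U" using assms U s .
  show "(\<lambda>v. \<Sum>j\<in>UNIV. (s v + t v) $ j *s \<theta> j v) =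
      (\<lambda>v. (\<Sum>j\<in>UNIV. s v $ j *s \<theta> j v) + (\<Sum>j\<in>UNIV. t v $ j *s \<theta> j v))"
    by (simp add: vector_sadd_rdistrib sum.distrib)
  show "(\<lambda>v. \<Sum>j\<in>UNIV. (r v *s s v) $ j *s \<theta> j v) = (\<lambda>v. r v *s (\<Sum>j\<in>UNIV. s v $ j *s \<theta> j v))"
    by (simp add: vec.scale_sum_right vector_smult_assoc)
  show "(\<lambda>v. \<Sum>j\<in>UNIV. restr V s v $ j *s \<theta> j v) = restr V (\<lambda>v. \<Sum>j\<in>UNIV. s v $ j *s \<theta> j v)"
    by (rule ext) (simp add: restr_def)
qed

section \<open>Presentations by generators and one relation\<close>

text \<open>Generators \<open>\<theta>\<close> of degrees \<open>\<kappa>\<close> with a single relation \<open>g\<close> in degree \<open>e\<close>, for the sheaf of vector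
  fields cut out by \<open>D\<close> modulo those that satisfy \<open>Z\<close>. Two instances occur: the kernel of the
  gradient with \<open>Z\<close> saying that a field is zero, and the fields tangent to all lines modulo the
  multiples of the Euler field \<open>v \<mapsto> v\<close>.\<close>

definition presentation ::
  "(complex ^ 3 \<Rightarrow> complex ^ 3 \<Rightarrow> bool) \<Rightarrow> (point set \<Rightarrow> 3 sect \<Rightarrow> bool) \<Rightarrow> int ^ 3 \<Rightarrow> int \<Rightarrow>
    (3 \<Rightarrow> 3 sect) \<Rightarrow> 3 sect \<Rightarrow> bool"
  where "presentation Z D \<kappa> e \<theta> g \<longleftrightarrow>
    (\<forall>j. vregular_on (\<kappa> $ j) P2 (\<theta> j) \<and> D P2 (\<theta> j)) \<and>
    (\<forall>j. regular_on (e - \<kappa> $ j) P2 (\<lambda>v. g v $ j)) \<and>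
    (\<forall>v. v \<noteq> 0 \<longrightarrow> Z v (\<Sum>j\<in>UNIV. g v $ j *s \<theta> j v)) \<and>
    (\<forall>U r. openin zariski U \<longrightarrow> regular_on (- e) U r \<longrightarrow> (\<forall>v\<in>\<Union>U. r v *s g v = 0) \<longrightarrow> (\<forall>v\<in>\<Union>U. r v = 0)) \<and>
    (\<forall>U s. openin zariski U \<longrightarrow> (\<forall>j. regular_on (- \<kappa> $ j) U (\<lambda>v. s v $ j)) \<longrightarrow>
      (\<forall>v\<in>\<Union>U. Z v (\<Sum>j\<in>UNIV. s v $ j *s \<theta> j v)) \<longrightarrow>
      (\<forall>v\<in>\<Union>U. \<exists>V r. openin zariski V \<and> v \<in> \<Union>V \<and> V \<subseteq> U \<and> regular_on (- e) V r \<and>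
        (\<forall>w\<in>\<Union>V. s w = r w *s g w))) \<and>
    (\<forall>U t. openin zariski U \<longrightarrow> vregular_on 0 U t \<longrightarrow> D U t \<longrightarrow>
      (\<forall>v\<in>\<Union>U. \<exists>V s. openin zariski V \<and> v \<in> \<Union>V \<and> V \<subseteq> U \<and> (\<forall>j. regular_on (- \<kappa> $ j) V (\<lambda>v. s v $ j)) \<and>
        (\<forall>w\<in>\<Union>V. Z w (t w - (\<Sum>j\<in>UNIV. s w $ j *s \<theta> j w)))))"

lemma presentationI:
  fixes \<kappa> :: "int ^ 3"
  assumes "\<And>j. vregular_on (\<kappa> $ j) P2 (\<theta> j)" "\<And>j. D P2 (\<theta> j)"
    and "\<And>j. regular_on (e - \<kappa> $ j) P2 (\<lambda>v. g v $ j)"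
    and "\<And>v. v \<noteq> 0 \<Longrightarrow> Z v (\<Sum>j\<in>UNIV. g v $ j *s \<theta> j v)"
    and "\<And>U r v. openin zariski U \<Longrightarrow> regular_on (- e) U r \<Longrightarrow> (\<And>v. v \<in> \<Union>U \<Longrightarrow> r v *s g v = 0) \<Longrightarrow>
      v \<in> \<Union>U \<Longrightarrow> r v = 0"
    and "\<And>U s v. openin zariski U \<Longrightarrow> (\<And>j. regular_on (- \<kappa> $ j) U (\<lambda>v. s v $ j)) \<Longrightarrow>
      (\<And>v. v \<in> \<Union>U \<Longrightarrow> Z v (\<Sum>j\<in>UNIV. s v $ j *s \<theta> j v)) \<Longrightarrow> v \<in> \<Union>U \<Longrightarrow>
      \<exists>V r. openin zariski V \<and> v \<in> \<Union>V \<and> V \<subseteq> U \<and> regular_on (- e) V r \<and> (\<forall>w\<in>\<Union>V. s w = r w *s g w)"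
    and "\<And>U t v. openin zariski U \<Longrightarrow> vregular_on 0 U t \<Longrightarrow> D U t \<Longrightarrow> v \<in> \<Union>U \<Longrightarrow>
      \<exists>V s. openin zariski V \<and> v \<in> \<Union>V \<and> V \<subseteq> U \<and> (\<forall>j. regular_on (- \<kappa> $ j) V (\<lambda>v. s v $ j)) \<and>
        (\<forall>w\<in>\<Union>V. Z w (t w - (\<Sum>j\<in>UNIV. s w $ j *s \<theta> j w)))"
  shows "presentation Z D \<kappa> e \<theta> g"
  unfolding presentation_def
  apply (intro conjI)
       apply (use assms(1,2) in blast)
      apply (use assms(3) in blast)
     apply (use assms(4) in blast)
    apply (intro allI impI ballI, erule (1) assms(5), erule bspec, assumption+)
   apply (intro allI impI ballI, erule assms(6), erule spec, erule bspec, assumption+)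
  apply (intro allI impI ballI, erule (3) assms(7))
  done

lemma presentationD:
  fixes \<kappa> :: "int ^ 3"
  assumes "presentation Z D \<kappa> e \<theta> g"
  shows "vregular_on (\<kappa> $ j) P2 (\<theta> j)" "D P2 (\<theta> j)"
    and "regular_on (e - \<kappa> $ j) P2 (\<lambda>v. g v $ j)"
    and "v \<noteq> 0 \<Longrightarrow> Z v (\<Sum>j\<in>UNIV. g v $ j *s \<theta> j v)"
  by (rule assms[unfolded presentation_def, THEN conjunct1, rule_format, THEN conjunct1]
      assms[unfolded presentation_def, THEN conjunct1, rule_format, THEN conjunct2]
      assms[unfolded presentation_def, THEN conjunct2, THEN conjunct1, rule_format]
      assms[unfolded presentation_def, THEN conjunct2, THEN conjunct2, THEN conjunct1, rule_format]; assumption?)+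

lemma presentation_injective:
  assumes "presentation Z D \<kappa> e \<theta> g" "openin zariski U" "regular_on (- e) U r"
    "\<And>v. v \<in> \<Union>U \<Longrightarrow> r v *s g v = 0" "v \<in> \<Union>U"
  shows "r v = 0"
proof -
  have *: "\<forall>U r. openin zariski U \<longrightarrow> regular_on (- e) U r \<longrightarrow> (\<forall>v\<in>\<Union>U. r v *s g v = 0) \<longrightarrow> (\<forall>v\<in>\<Union>U. r v = 0)"
    using assms(1) unfolding presentation_def by (elim conjE)
  show ?thesis by (rule *[rule_format]) (fact assms)+
qed

lemma presentation_relation:
  fixes \<kappa> :: "int ^ 3"
  assumes "presentation Z D \<kappa> e \<theta> g" "openin zariski U" "\<And>j. regular_on (- \<kappa> $ j) U (\<lambda>v. s v $ j)"
    "\<And>v. v \<in> \<Union>U \<Longrightarrow> Z v (\<Sum>j\<in>UNIV. s v $ j *s \<theta> j v)" "v \<in> \<Union>U"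
  obtains V r where "openin zariski V" "v \<in> \<Union>V" "V \<subseteq> U" "regular_on (- e) V r"
    "\<forall>w\<in>\<Union>V. s w = r w *s g w"
proof -
  have *: "\<forall>U s. openin zariski U \<longrightarrow> (\<forall>j. regular_on (- \<kappa> $ j) U (\<lambda>v. s v $ j)) \<longrightarrow>
      (\<forall>v\<in>\<Union>U. Z v (\<Sum>j\<in>UNIV. s v $ j *s \<theta> j v)) \<longrightarrow>
      (\<forall>v\<in>\<Union>U. \<exists>V r. openin zariski V \<and> v \<in> \<Union>V \<and> V \<subseteq> U \<and> regular_on (- e) V r \<and>
        (\<forall>w\<in>\<Union>V. s w = r w *s g w))"
    using assms(1) unfolding presentation_def by (elim conjE)
  have "\<exists>V r. openin zariski V \<and> v \<in> \<Union>V \<and> V \<subseteq> U \<and> regular_on (- e) V r \<and> (\<forall>w\<in>\<Union>V. s w = r w *s g w)"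
    by (rule *[rule_format]) (fact assms)+
  then show ?thesis by (elim exE conjE) (rule that)
qed

lemma presentation_generate:
  fixes \<kappa> :: "int ^ 3"
  assumes "presentation Z D \<kappa> e \<theta> g" "openin zariski U" "vregular_on 0 U t" "D U t" "v \<in> \<Union>U"
  obtains V s where "openin zariski V" "v \<in> \<Union>V" "V \<subseteq> U" "\<forall>j. regular_on (- \<kappa> $ j) V (\<lambda>v. s v $ j)"
    "\<forall>w\<in>\<Union>V. Z w (t w - (\<Sum>j\<in>UNIV. s w $ j *s \<theta> j w))"
proof -
  have *: "\<forall>U t. openin zariski U \<longrightarrow> vregular_on 0 U t \<longrightarrow> D U t \<longrightarrow>
      (\<forall>v\<in>\<Union>U. \<exists>V s. openin zariski V \<and> v \<in> \<Union>V \<and> V \<subseteq> U \<and> (\<forall>j. regular_on (- \<kappa> $ j) V (\<lambda>v. s v $ j)) \<and>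
        (\<forall>w\<in>\<Union>V. Z w (t w - (\<Sum>j\<in>UNIV. s w $ j *s \<theta> j w))))"
    using assms(1) unfolding presentation_def by (elim conjE)
  have "\<exists>V s. openin zariski V \<and> v \<in> \<Union>V \<and> V \<subseteq> U \<and> (\<forall>j. regular_on (- \<kappa> $ j) V (\<lambda>v. s v $ j)) \<and>
        (\<forall>w\<in>\<Union>V. Z w (t w - (\<Sum>j\<in>UNIV. s w $ j *s \<theta> j w)))"
    by (rule *[rule_format]) (fact assms)+
  then show ?thesis by (elim exE conjE) (rule that)
qed

definition gradient_zero :: "point set set \<Rightarrow> point set \<Rightarrow> 3 sect \<Rightarrow> bool"
  where "gradient_zero A U t \<longleftrightarrow> (\<forall>v\<in>\<Union>U. scalar_product (gradient (defining_poly A) v) (t v) = 0)"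

lemma T_bundle_iff:
  "t \<in> T_bundle A U \<longleftrightarrow> (\<forall>v. v \<notin> \<Union>U \<longrightarrow> t v = 0) \<and> vregular_on 0 U t \<and> gradient_zero A U t"
proof -
  have zero: "(vector [0, 0, 0] :: int ^ 3) $ i = 0" for i
    using exhaust_3[of i] by auto
  have vec: "(vector [x] :: complex ^ 1) = 0 \<longleftrightarrow> x = 0" for x
    by (simp add: vec_eq_iff forall_1 vector_def)
  show ?thesis
    unfolding T_bundle_def sheaf_kernel_def gradient_map_def twist_sum_iff vregular_on_def gradient_zero_def
      mem_Collect_eq fun_eq_iff vec zero
    using scalar_product_zero(1) by metis
qed

lemma restr_T_bundle:
  assumes "vregular_on 0 U t" "gradient_zero A U t"
  shows "restr U t \<in> T_bundle A U"
  unfolding T_bundle_iff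
proof (intro conjI allI impI restr_out)
  show "vregular_on 0 U (restr U t)"
    using assms(1) restr_twist_sum[of 0 U t] unfolding vregular_on_def twist_sum_iff by simp
  show "gradient_zero A U (restr U t)"
    using assms(2) unfolding gradient_zero_def by (simp add: restr_in del: Union_iff)
qed

text \<open>Exactness of the sequence, read off on sections: the columns of the two matrices are the generators
  and the relation, and the conditions for exactness are the last four clauses of
  \<open>presentation\<close>.\<close>

lemma plus_one_generated_presentation:
  assumes "plus_one_generated A a b d"
  obtains \<theta> g where "presentation (\<lambda>v w. w = 0) (gradient_zero A) (vector [d, b, a]) (1 + d) \<theta> g"
proof -
  define \<kappa> :: "int ^ 3" where "\<kappa> = vector [d, b, a]"
  define e where "e = 1 + d"
  have \<kappa>: "(vector [-d, -b, -a] :: int ^ 3) = - \<kappa>"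
    by (simp add: \<kappa>_def vec_eq_iff forall_3)
  have "\<forall>i. (vector [-1 - d] :: int ^ 1) $ i = - e"
    by (simp add: forall_1 e_def vector_def)
  then have e: "(vector [-1 - d] :: int ^ 1) $ i = - e" for i by blast
  obtain \<phi> \<psi> where ex: "short_exact (twist_sum (vector [-1 - d] :: int ^ 1)) (twist_sum (- \<kappa>)) (T_bundle A) \<phi> \<psi>"
    using assms unfolding plus_one_generated_def \<kappa> by blast
  have hom\<phi>: "sheaf_hom (twist_sum (vector [-1 - d] :: int ^ 1)) (twist_sum (- \<kappa>)) \<phi>"
    and hom\<psi>: "sheaf_hom (twist_sum (- \<kappa>)) (T_bundle A) \<psi>"
    using ex unfolding short_exact_def by blast+
  have exU: "sheaf_kernel (twist_sum (vector [-1 - d] :: int ^ 1)) \<phi> U = {\<lambda>v. 0}"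
      "sheaf_kernel (twist_sum (- \<kappa>)) \<psi> U =
        sheaf_image (twist_sum (vector [-1 - d] :: int ^ 1)) (twist_sum (- \<kappa>)) \<phi> U"
      "sheaf_image (twist_sum (- \<kappa>)) (T_bundle A) \<psi> U = T_bundle A U" if "openin zariski U" for U
    using ex[unfolded short_exact_def, THEN conjunct2, THEN conjunct2, rule_format, OF that] by auto
  have "T_bundle A U \<subseteq> twist_sum 0 U" for U
    unfolding T_bundle_iff[abs_def] subset_iff twist_sum_iff vregular_on_def by simp
  then obtain \<theta> where \<theta>: "\<And>i j. regular_on ((0 :: int ^ 3) $ i - (- \<kappa>) $ j) P2 (\<lambda>v. \<theta> j v $ i)"
      "\<And>U s. openin zariski U \<Longrightarrow> s \<in> twist_sum (- \<kappa>) U \<Longrightarrow> \<psi> U s = (\<lambda>v. \<Sum>j\<in>UNIV. s v $ j *s \<theta> j v)"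
    using sheaf_hom_columns[OF hom\<psi>] by blast
  obtain \<gamma> where \<gamma>: "\<And>i j. regular_on ((- \<kappa>) $ i - (vector [-1 - d] :: int ^ 1) $ j) P2 (\<lambda>v. \<gamma> j v $ i)"
      "\<And>U s. openin zariski U \<Longrightarrow> s \<in> twist_sum (vector [-1 - d] :: int ^ 1) U \<Longrightarrow>
        \<phi> U s = (\<lambda>v. \<Sum>j\<in>UNIV. s v $ j *s \<gamma> j v)"
    using sheaf_hom_columns[OF hom\<phi>] by blast
  define g where "g = \<gamma> 1"
  have \<phi>: "\<phi> U s = (\<lambda>v. s v $ 1 *s g v)"
    if "openin zariski U" "s \<in> twist_sum (vector [-1 - d] :: int ^ 1) U" for U s
    using \<gamma>(2)[OF that] by (simp add: g_def UNIV_1)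
  have "presentation (\<lambda>v w. w = 0) (gradient_zero A) \<kappa> e \<theta> g"
  proof (rule presentationI)
    fix j
    show "vregular_on (\<kappa> $ j) P2 (\<theta> j)"
      unfolding vregular_on_def using \<theta>(1)[of _ j] by simp
    show "gradient_zero A P2 (\<theta> j)"
      unfolding gradient_zero_def
    proof
      fix v assume "v \<in> \<Union>P2"
      then have "v \<noteq> 0" by (simp add: in_cone_P2 del: Union_iff)
      then obtain i where i: "v \<in> \<Union>(chart i)" by (rule exists_chart)
      have "\<psi> (chart i) (chart_section (- \<kappa>) i j) \<in> T_bundle A (chart i)"
        by (rule sheaf_homD(1)[OF hom\<psi> openin_chart chart_section_in_twist_sum])
      then have "scalar_product (gradient (defining_poly A) v) (\<psi> (chart i) (chart_section (- \<kappa>) i j) v) = 0"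
        using i unfolding T_bundle_iff gradient_zero_def by blast
      moreover have "\<psi> (chart i) (chart_section (- \<kappa>) i j) v = v $ i powi (- \<kappa> $ j) *s \<theta> j v"
      proof -
        have "\<psi> (chart i) (chart_section (- \<kappa>) i j) v = (\<Sum>j'\<in>UNIV. chart_section (- \<kappa>) i j v $ j' *s \<theta> j' v)"
          using \<theta>(2)[OF openin_chart chart_section_in_twist_sum] by simp
        also have "\<dots> = (\<Sum>j'\<in>UNIV. if j' = j then v $ i powi (- \<kappa> $ j) *s \<theta> j v else 0)"
          by (rule sum.cong) (simp_all add: chart_section_def restr_in[OF i] axis_def)
        finally show ?thesis by simp
      qed
      moreover have "v $ i \<noteq> 0" using i by (simp add: cone_chart del: Union_iff)
      ultimately show "scalar_product (gradient (defining_poly A) v) (\<theta> j v) = 0"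
        by (simp add: scalar_product_scale)
    qed
    show "regular_on (e - \<kappa> $ j) P2 (\<lambda>v. g v $ j)"
      using \<gamma>(1)[of j 1] by (simp add: g_def e_def algebra_simps)
  next
    fix v :: "complex ^ 3" assume "v \<noteq> 0"
    then obtain i where i: "v \<in> \<Union>(chart i)" by (rule exists_chart)
    define r :: "1 sect" where "r = chart_section (vector [-1 - d]) i 1"
    have r: "r \<in> twist_sum (vector [-1 - d] :: int ^ 1) (chart i)"
      unfolding r_def by (rule chart_section_in_twist_sum)
    have \<phi>r: "\<phi> (chart i) r \<in> twist_sum (- \<kappa>) (chart i)"
      by (rule sheaf_homD(1)[OF hom\<phi> openin_chart r])
    have "\<phi> (chart i) r \<in> sheaf_image (twist_sum (vector [-1 - d] :: int ^ 1)) (twist_sum (- \<kappa>)) \<phi> (chart i)"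
      unfolding sheaf_image_def mem_Collect_eq
    proof (intro conjI ballI \<phi>r exI bexI)
      show "\<phi> (chart i) r = restr (chart i) (\<phi> (chart i) r)"
        using \<phi>r unfolding twist_sum_iff by (auto simp: restr_def simp del: Union_iff)
    qed (use r openin_chart in auto)
    then have "\<phi> (chart i) r \<in> sheaf_kernel (twist_sum (- \<kappa>)) \<psi> (chart i)"
      using exU(2)[OF openin_chart] by simp
    then have "\<psi> (chart i) (\<phi> (chart i) r) = (\<lambda>v. 0)"
      unfolding sheaf_kernel_def by blast
    then have zero: "(\<Sum>j\<in>UNIV. \<phi> (chart i) r v $ j *s \<theta> j v) = 0"
      using \<theta>(2)[OF openin_chart \<phi>r] by metis
    have "\<phi> (chart i) r v = v $ i powi (- e) *s g v"
      using \<phi>[OF openin_chart r] by (simp add: r_def chart_section_def restr_in[OF i] e_def axis_def)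
    then have "v $ i powi (- e) *s (\<Sum>j\<in>UNIV. g v $ j *s \<theta> j v) = 0"
      using zero by (simp add: vec.scale_sum_right vector_smult_assoc)
    moreover have "v $ i powi (- e) \<noteq> 0" using i by (simp add: cone_chart del: Union_iff)
    ultimately show "(\<Sum>j\<in>UNIV. g v $ j *s \<theta> j v) = 0"
      by (simp only: vector_mul_eq_0) simp
  next
    fix U r v assume U: "openin zariski U" and r: "regular_on (- e) U r"
      and zero: "\<And>v. v \<in> \<Union>U \<Longrightarrow> r v *s g v = 0" and v: "v \<in> \<Union>U"
    define s :: "1 sect" where "s = restr U (\<lambda>v. vec (r v))"
    have s: "s \<in> twist_sum (vector [-1 - d] :: int ^ 1) U"
      unfolding s_def by (rule restr_twist_sum) (simp add: e r)
    have "\<phi> U s = (\<lambda>v. 0)"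
    proof
      show "\<phi> U s v = 0" for v
        using \<phi>[OF U s] zero[of v] by (cases "v \<in> \<Union>U") (simp_all add: s_def restr_in restr_out del: Union_iff)
    qed
    then have "s \<in> {\<lambda>v. 0}"
      unfolding exU(1)[OF U, symmetric] sheaf_kernel_def using s by blast
    then have "s v $ 1 = 0" by simp
    then show "r v = 0" by (simp add: s_def restr_in[OF v])
  next
    fix U s v assume U: "openin zariski U" and s: "\<And>j. regular_on (- \<kappa> $ j) U (\<lambda>v. s v $ j)"
      and zero: "\<And>v. v \<in> \<Union>U \<Longrightarrow> (\<Sum>j\<in>UNIV. s v $ j *s \<theta> j v) = 0" and v: "v \<in> \<Union>U"
    have s': "restr U s \<in> twist_sum (- \<kappa>) U"
      by (rule restr_twist_sum) (use s in simp)
    have "\<psi> U (restr U s) = (\<lambda>v. 0)"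
    proof
      show "\<psi> U (restr U s) v = 0" for v
        using \<theta>(2)[OF U s'] zero[of v] by (cases "v \<in> \<Union>U") (simp_all add: restr_in restr_out del: Union_iff)
    qed
    then have "restr U s \<in> sheaf_image (twist_sum (vector [-1 - d] :: int ^ 1)) (twist_sum (- \<kappa>)) \<phi> U"
      unfolding exU(2)[OF U, symmetric] sheaf_kernel_def using s' by blast
    moreover have "pt v \<in> U" using v in_cone_iff[OF openin_subset_P2[OF U]] by blast
    ultimately obtain V r where V: "openin zariski V" "pt v \<in> V" "V \<subseteq> U"
      and r: "r \<in> twist_sum (vector [-1 - d] :: int ^ 1) V" "\<phi> V r = restr V (restr U s)"
      unfolding sheaf_image_def by blast
    have "s w = r w $ 1 *s g w" if w: "w \<in> \<Union>V" for w
    proof -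
      have "w \<in> \<Union>U" using w V(3) by blast
      then show ?thesis using fun_cong[OF r(2), of w] \<phi>[OF V(1) r(1)] w by (simp add: restr_in del: Union_iff)
    qed
    moreover have "regular_on (- e) V (\<lambda>v. r v $ 1)" using r(1) unfolding twist_sum_iff e by simp
    ultimately show "\<exists>V r. openin zariski V \<and> v \<in> \<Union>V \<and> V \<subseteq> U \<and> regular_on (- e) V r \<and>
        (\<forall>w\<in>\<Union>V. s w = r w *s g w)"
      using V pt_self by (intro exI[of _ V] exI[of _ "\<lambda>v. r v $ 1"]) blast
  next
    fix U t v assume U: "openin zariski U" and t: "vregular_on 0 U t" "gradient_zero A U t" and v: "v \<in> \<Union>U"
    have "restr U t \<in> sheaf_image (twist_sum (- \<kappa>)) (T_bundle A) \<psi> U"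
      unfolding exU(3)[OF U] by (rule restr_T_bundle[OF t])
    moreover have "pt v \<in> U" using v in_cone_iff[OF openin_subset_P2[OF U]] by blast
    ultimately obtain V s where V: "openin zariski V" "pt v \<in> V" "V \<subseteq> U"
      and s: "s \<in> twist_sum (- \<kappa>) V" "\<psi> V s = restr V (restr U t)"
      unfolding sheaf_image_def by blast
    have "t w - (\<Sum>j\<in>UNIV. s w $ j *s \<theta> j w) = 0" if w: "w \<in> \<Union>V" for w
    proof -
      have "w \<in> \<Union>U" using w V(3) by blast
      then show ?thesis using fun_cong[OF s(2), of w] \<theta>(2)[OF V(1) s(1)] w by (simp add: restr_in del: Union_iff)
    qed
    moreover have "\<forall>j. regular_on (- \<kappa> $ j) V (\<lambda>v. s v $ j)" using s(1) unfolding twist_sum_iff by simp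
    ultimately show "\<exists>V s. openin zariski V \<and> v \<in> \<Union>V \<and> V \<subseteq> U \<and> (\<forall>j. regular_on (- \<kappa> $ j) V (\<lambda>v. s v $ j)) \<and>
        (\<forall>w\<in>\<Union>V. t w - (\<Sum>j\<in>UNIV. s w $ j *s \<theta> j w) = 0)"
      using V pt_self by (intro exI[of _ V] exI[of _ s]) blast
  qed
  then show thesis using that unfolding \<kappa>_def e_def by blast
qed

lemma plus_one_generatedI:
  assumes ab: "a \<le> b" "b \<le> d"
    and pres: "presentation (\<lambda>v w. w = 0) (gradient_zero A) (vector [d, b, a]) (1 + d) \<theta> g"
  shows "plus_one_generated A a b d"
proof -
  define \<kappa> :: "int ^ 3" where "\<kappa> = vector [d, b, a]"
  define e where "e = 1 + d"
  have \<kappa>: "(vector [-d, -b, -a] :: int ^ 3) = - \<kappa>"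
    by (simp add: \<kappa>_def vec_eq_iff forall_3)
  have "\<forall>i. (vector [-1 - d] :: int ^ 1) $ i = - e"
    by (simp add: forall_1 e_def vector_def)
  then have e: "(vector [-1 - d] :: int ^ 1) $ i = - e" for i by blast
  note pres = pres[folded \<kappa>_def e_def]
  define \<phi> :: "(1, 3) sheaf_map" where "\<phi> = (\<lambda>U s v. \<Sum>j\<in>UNIV. s v $ j *s g v)"
  define \<psi> :: "(3, 3) sheaf_map" where "\<psi> = (\<lambda>U s v. \<Sum>j\<in>UNIV. s v $ j *s \<theta> j v)"
  have \<phi>: "\<phi> U s v = s v $ 1 *s g v" for U s v
    unfolding \<phi>_def by (simp add: UNIV_1)
  have \<phi>_in: "\<phi> U s \<in> twist_sum (- \<kappa>) U"
    if U: "openin zariski U" and s: "s \<in> twist_sum (vector [-1 - d] :: int ^ 1) U" for U s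
    unfolding twist_sum_iff \<phi>
  proof (intro conjI allI impI)
    show "s v $ 1 *s g v = 0" if "v \<notin> \<Union>U" for v
      using s that unfolding twist_sum_iff by (simp del: Union_iff)
    fix j
    have g: "regular_on (e - \<kappa> $ j) U (\<lambda>v. g v $ j)"
      using regular_on_subset[OF presentationD(3)[OF pres] U openin_subset_P2[OF U]] .
    have "regular_on (- e) U (\<lambda>v. s v $ 1)" using s unfolding twist_sum_iff e by blast
    from regular_on_mult'[OF U this g] show "regular_on ((- \<kappa>) $ j) U (\<lambda>v. (s v $ 1 *s g v) $ j)"
      by simp
  qed
  have sum_reg: "regular_on 0 U (\<lambda>v. (\<Sum>j\<in>UNIV. s v $ j *s \<theta> j v) $ i)"
    if U: "openin zariski U" and s: "\<And>j. regular_on (- \<kappa> $ j) U (\<lambda>v. s v $ j)" for U s i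
  proof -
    have "regular_on (\<kappa> $ j) U (\<lambda>v. \<theta> j v $ i)" for j
      using regular_on_subset[OF _ U openin_subset_P2[OF U]] presentationD(1)[OF pres]
      unfolding vregular_on_def by blast
    then have "regular_on 0 U (\<lambda>v. s v $ j * \<theta> j v $ i)" for j
      by (rule regular_on_mult'[OF U s]) simp
    then have "regular_on 0 U (\<lambda>v. \<Sum>j\<in>UNIV. s v $ j * \<theta> j v $ i)"
      by (rule regular_on_sum[OF U])
    then show ?thesis by simp
  qed
  have \<psi>_in: "\<psi> U s \<in> T_bundle A U"
    if U: "openin zariski U" and s: "s \<in> twist_sum (- \<kappa>) U" for U s
    unfolding T_bundle_iff vregular_on_def gradient_zero_def
  proof (intro conjI allI impI ballI)
    show "\<psi> U s v = 0" if "v \<notin> \<Union>U" for v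
      using s that unfolding twist_sum_iff \<psi>_def by (simp del: Union_iff)
    show "regular_on 0 U (\<lambda>v. \<psi> U s v $ i)" for i
      unfolding \<psi>_def by (rule sum_reg[OF U]) (use s in \<open>simp add: twist_sum_iff\<close>)
    fix v assume "v \<in> \<Union>U"
    then have "v \<in> \<Union>P2" using openin_subset_P2[OF U] by blast
    then have "scalar_product (gradient (defining_poly A) v) (\<theta> j v) = 0" for j
      using presentationD(2)[OF pres, of j] unfolding gradient_zero_def by blast
    then show "scalar_product (gradient (defining_poly A) v) (\<psi> U s v) = 0"
      unfolding \<psi>_def sum_3 by (simp add: scalar_product_simps)
  qed
  have hom\<phi>: "sheaf_hom (twist_sum (vector [-1 - d] :: int ^ 1)) (twist_sum (- \<kappa>)) \<phi>"
    using \<phi>_in unfolding \<phi>_def by (rule sheaf_hom_of_columns)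
  have hom\<psi>: "sheaf_hom (twist_sum (- \<kappa>)) (T_bundle A) \<psi>"
    using \<psi>_in unfolding \<psi>_def by (rule sheaf_hom_of_columns)
  have "short_exact (twist_sum (vector [-1 - d] :: int ^ 1)) (twist_sum (- \<kappa>)) (T_bundle A) \<phi> \<psi>"
    unfolding short_exact_def
  proof (intro conjI hom\<phi> hom\<psi> allI impI)
    fix U assume U: "openin zariski U"
    show "sheaf_kernel (twist_sum (vector [-1 - d] :: int ^ 1)) \<phi> U = {\<lambda>v. 0}"
    proof (rule set_eqI)
      fix s
      have "s = (\<lambda>v. 0)" if s: "s \<in> twist_sum (vector [-1 - d] :: int ^ 1) U" "\<phi> U s = (\<lambda>v. 0)"
      proof
        fix v
        show "s v = 0"
        proof (cases "v \<in> \<Union>U")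
          case True
          have "s v $ 1 = 0"
          proof (rule presentation_injective[OF pres U _ _ True])
            show "regular_on (- e) U (\<lambda>v. s v $ 1)" using s(1) unfolding twist_sum_iff e by blast
            show "s v $ 1 *s g v = 0" for v using fun_cong[OF s(2), of v] unfolding \<phi> .
          qed
          then show ?thesis by (simp add: vec_eq_iff forall_1)
        qed (use s(1) in \<open>simp add: twist_sum_iff del: Union_iff\<close>)
      qed
      moreover have "(\<lambda>v. 0) \<in> twist_sum (vector [-1 - d] :: int ^ 1) U" by (rule twist_sum_zero[OF U])
      ultimately show "s \<in> sheaf_kernel (twist_sum (vector [-1 - d] :: int ^ 1)) \<phi> U \<longleftrightarrow> s \<in> {\<lambda>v. 0}"
        unfolding sheaf_kernel_def mem_Collect_eq singleton_iff by (auto simp: \<phi>[abs_def])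
    qed
    show "sheaf_kernel (twist_sum (- \<kappa>)) \<psi> U =
        sheaf_image (twist_sum (vector [-1 - d] :: int ^ 1)) (twist_sum (- \<kappa>)) \<phi> U"
    proof (intro equalityI subsetI)
      fix s assume "s \<in> sheaf_kernel (twist_sum (- \<kappa>)) \<psi> U"
      then have s: "s \<in> twist_sum (- \<kappa>) U" and zero: "\<psi> U s = (\<lambda>v. 0)" unfolding sheaf_kernel_def by blast+
      show "s \<in> sheaf_image (twist_sum (vector [-1 - d] :: int ^ 1)) (twist_sum (- \<kappa>)) \<phi> U"
        unfolding sheaf_image_def mem_Collect_eq
      proof (intro conjI ballI s)
        fix p assume p: "p \<in> U"
        then obtain v where v: "v \<in> p" "v \<in> \<Union>U" "p = pt v"
          using openin_subset_P2[OF U] pt_self unfolding P2_eq by blast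
        obtain V r where V: "openin zariski V" "v \<in> \<Union>V" "V \<subseteq> U" and r: "regular_on (- e) V r"
          "\<forall>w\<in>\<Union>V. s w = r w *s g w"
        proof (rule presentation_relation[OF pres U _ _ v(2)])
          show "regular_on (- \<kappa> $ j) U (\<lambda>v. s v $ j)" for j
            using s unfolding twist_sum_iff by simp
          show "(\<Sum>j\<in>UNIV. s v $ j *s \<theta> j v) = 0" for v
            using fun_cong[OF zero, of v] unfolding \<psi>_def .
        qed
        have "restr V (\<lambda>v. vec (r v)) \<in> twist_sum (vector [-1 - d] :: int ^ 1) V"
          by (rule restr_twist_sum) (simp add: e r(1))
        moreover have "\<phi> V (restr V (\<lambda>v. vec (r v))) = restr V s"
        proof
          show "\<phi> V (restr V (\<lambda>v. vec (r v))) w = restr V s w" for w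
            by (cases "w \<in> \<Union>V") (simp_all add: \<phi> restr_in restr_out bspec[OF r(2)] del: Union_iff)
        qed
        moreover have "p \<in> V" using V(2) in_cone_iff[OF openin_subset_P2[OF V(1)]] v(3) by blast
        ultimately show "\<exists>V. openin zariski V \<and> p \<in> V \<and> V \<subseteq> U \<and>
            (\<exists>r\<in>twist_sum (vector [-1 - d] :: int ^ 1) V. \<phi> V r = restr V s)"
          using V by blast
      qed
    next
      fix s assume "s \<in> sheaf_image (twist_sum (vector [-1 - d] :: int ^ 1)) (twist_sum (- \<kappa>)) \<phi> U"
      then have s: "s \<in> twist_sum (- \<kappa>) U"
        and loc: "\<forall>p\<in>U. \<exists>V. openin zariski V \<and> p \<in> V \<and> V \<subseteq> U \<and>
            (\<exists>r\<in>twist_sum (vector [-1 - d] :: int ^ 1) V. \<phi> V r = restr V s)"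
        unfolding sheaf_image_def by blast+
      have "\<psi> U s = (\<lambda>v. 0)"
      proof
        fix v
        show "\<psi> U s v = 0"
        proof (cases "v \<in> \<Union>U")
          case True
          then have v: "pt v \<in> U" "v \<noteq> 0" using in_cone_iff[OF openin_subset_P2[OF U]] by blast+
          obtain V r where V: "openin zariski V" "pt v \<in> V" and r: "\<phi> V r = restr V s"
            using bspec[OF loc v(1)] by blast
          have "v \<in> \<Union>V" using V(2) pt_self by blast
          then have "s v = r v $ 1 *s g v" using fun_cong[OF r, of v] by (simp add: \<phi> restr_in del: Union_iff)
          then have "\<psi> U s v = r v $ 1 *s (\<Sum>j\<in>UNIV. g v $ j *s \<theta> j v)"
            unfolding \<psi>_def by (simp add: vec.scale_sum_right vector_smult_assoc)
          then show ?thesis using presentationD(4)[OF pres v(2)] by simp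
        qed (use s in \<open>simp add: twist_sum_iff \<psi>_def del: Union_iff\<close>)
      qed
      then show "s \<in> sheaf_kernel (twist_sum (- \<kappa>)) \<psi> U" unfolding sheaf_kernel_def using s by blast
    qed
    show "sheaf_image (twist_sum (- \<kappa>)) (T_bundle A) \<psi> U = T_bundle A U"
    proof (intro equalityI subsetI)
      show "t \<in> T_bundle A U" if "t \<in> sheaf_image (twist_sum (- \<kappa>)) (T_bundle A) \<psi> U" for t
        using that unfolding sheaf_image_def by blast
    next
      fix t assume t: "t \<in> T_bundle A U"
      show "t \<in> sheaf_image (twist_sum (- \<kappa>)) (T_bundle A) \<psi> U"
        unfolding sheaf_image_def mem_Collect_eq
      proof (intro conjI ballI t)
        fix p assume p: "p \<in> U"
        then obtain v where v: "v \<in> p" "v \<in> \<Union>U" "p = pt v"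
          using openin_subset_P2[OF U] pt_self unfolding P2_eq by blast
        have t': "vregular_on 0 U t" "gradient_zero A U t" using t unfolding T_bundle_iff by blast+
        obtain V s where V: "openin zariski V" "v \<in> \<Union>V" "V \<subseteq> U"
          and s: "\<forall>j. regular_on (- \<kappa> $ j) V (\<lambda>v. s v $ j)"
          "\<forall>w\<in>\<Union>V. t w - (\<Sum>j\<in>UNIV. s w $ j *s \<theta> j w) = 0"
          by (rule presentation_generate[OF pres U t' v(2)])
        have "restr V s \<in> twist_sum (- \<kappa>) V"
          by (rule restr_twist_sum) (use s(1) in simp)
        moreover have "t w = (\<Sum>j\<in>UNIV. s w $ j *s \<theta> j w)" if "w \<in> \<Union>V" for w
          using bspec[OF s(2) that] by simp
        then have "\<psi> V (restr V s) = restr V t"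
        proof (intro ext)
          show "\<psi> V (restr V s) w = restr V t w" if "\<And>w. w \<in> \<Union>V \<Longrightarrow> t w = (\<Sum>j\<in>UNIV. s w $ j *s \<theta> j w)" for w
            using that[of w] by (cases "w \<in> \<Union>V") (simp_all add: \<psi>_def restr_in restr_out del: Union_iff)
        qed
        moreover have "p \<in> V" using V(2) in_cone_iff[OF openin_subset_P2[OF V(1)]] v(3) by blast
        ultimately show "\<exists>V. openin zariski V \<and> p \<in> V \<and> V \<subseteq> U \<and> (\<exists>s\<in>twist_sum (- \<kappa>) V. \<psi> V s = restr V t)"
          using V by blast
      qed
    qed
  qed
  then show ?thesis
    unfolding plus_one_generated_def \<kappa> using ab by blast
qed

section \<open>Fields tangent to an arrangement\<close>

abbreviation form :: "point set \<Rightarrow> complex ^ 3 \<Rightarrow> complex"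
  where "form H \<equiv> scalar_product (form_of_line H)"

lemma form_of_line:
  assumes "arrangement A" "H \<in> A"
  shows "form_of_line H \<noteq> 0" "H = line_of_form (form_of_line H)"
proof -
  have "\<exists>\<alpha>. \<alpha> \<noteq> 0 \<and> H = line_of_form \<alpha>" using assms unfolding arrangement_def by blast
  from someI_ex[OF this] show "form_of_line H \<noteq> 0" "H = line_of_form (form_of_line H)"
    unfolding form_of_line_def by blast+
qed

lemma pt_in_line_of_form: "v \<noteq> 0 \<Longrightarrow> pt v \<in> line_of_form \<alpha> \<longleftrightarrow> scalar_product \<alpha> v = 0"
  using pt_in_P2[of v] pt_self[of v]
  by (auto simp: line_of_form_def pt_def scalar_product_scale)

lemma pt_in_line:
  "arrangement A \<Longrightarrow> H \<in> A \<Longrightarrow> v \<noteq> 0 \<Longrightarrow> pt v \<in> H \<longleftrightarrow> form H v = 0"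
  using form_of_line(2) pt_in_line_of_form by metis

text \<open>If one form vanished on the zeros of the other, the two would be proportional and define the same
  line.\<close>

lemma distinct_lines_separated:
  assumes "arrangement A" "H \<in> A" "H' \<in> A" "H \<noteq> H'"
  obtains e where "form H e = 0" "form H' e \<noteq> 0"
proof -
  obtain e where e: "form H e = 1" using exists_scalar_product_eq[OF form_of_line(1)[OF assms(1,2)]] .
  obtain e' where e': "form H' e' = 1" using exists_scalar_product_eq[OF form_of_line(1)[OF assms(1,3)]] .
  have "\<exists>e. form H e = 0 \<and> form H' e \<noteq> 0"
  proof (rule ccontr)
    assume "\<not> ?thesis"
    then have ker: "form H' v = 0" if "form H v = 0" for v using that by blast
    have eq: "form H' v = form H v * form H' e" for v
      using ker[of "v - form H v *s e"] e by (simp add: scalar_product_simps)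
    have "form H' e \<noteq> 0" using eq[of e'] e' by auto
    then have "form H' v = 0 \<longleftrightarrow> form H v = 0" for v using eq[of v] by simp
    then have "line_of_form (form_of_line H) = line_of_form (form_of_line H')"
      unfolding line_of_form_def by simp
    then show False using form_of_line(2)[OF assms(1)] assms(2-4) by metis
  qed
  then show thesis using that by blast
qed

lemma gradient_defining_poly:
  assumes "finite A"
  shows "scalar_product (gradient (defining_poly A) v) w =
    (\<Sum>H\<in>A. form H w * (\<Prod>H'\<in>A - {H}. form H' v))"
proof -
  have "deriv (\<lambda>t. defining_poly A (v + t *s axis i 1)) 0 =
      (\<Sum>H\<in>A. form_of_line H $ i * (\<Prod>H'\<in>A - {H}. form H' v))" for i
  proof (rule DERIV_imp_deriv)
    have "((\<lambda>t. \<Prod>H\<in>A. form H v + t * form_of_line H $ i) has_field_derivative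
        (\<Sum>H\<in>A. form_of_line H $ i * (\<Prod>H'\<in>A - {H}. form H' v + 0 * form_of_line H' $ i))) (at 0)"
      by (rule has_field_derivative_prod) (auto intro!: derivative_eq_intros)
    then show "((\<lambda>t. defining_poly A (v + t *s axis i 1)) has_field_derivative
        (\<Sum>H\<in>A. form_of_line H $ i * (\<Prod>H'\<in>A - {H}. form H' v))) (at 0)"
      by (simp add: defining_poly_def scalar_product_simps)
  qed
  then have "scalar_product (gradient (defining_poly A) v) w =
      (\<Sum>i\<in>UNIV. (\<Sum>H\<in>A. form_of_line H $ i * (\<Prod>H'\<in>A - {H}. form H' v)) * w $ i)"
    by (simp add: scalar_product_def gradient_def)
  also have "\<dots> = (\<Sum>i\<in>UNIV. \<Sum>H\<in>A. form_of_line H $ i * w $ i * (\<Prod>H'\<in>A - {H}. form H' v))"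
    by (simp add: sum_distrib_right sum_distrib_left mult_ac)
  also have "\<dots> = (\<Sum>H\<in>A. \<Sum>i\<in>UNIV. form_of_line H $ i * w $ i * (\<Prod>H'\<in>A - {H}. form H' v))"
    by (rule sum.swap)
  also have "\<dots> = (\<Sum>H\<in>A. form H w * (\<Prod>H'\<in>A - {H}. form H' v))"
    by (simp add: scalar_product_def sum_distrib_right)
  finally show ?thesis .
qed

definition tangent :: "point set set \<Rightarrow> point set \<Rightarrow> 3 sect \<Rightarrow> bool"
  where "tangent A U t \<longleftrightarrow> (\<forall>H\<in>A. \<forall>v\<in>\<Union>U. form H v = 0 \<longrightarrow> form H (t v) = 0)"

text \<open>Linear dependence is expressed by minors, because minors of regular fields are regular functions:
  identities between them can be divided by \<open>\<alpha>\<close> and extended by continuity.\<close>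

definition parallel :: "complex ^ 3 \<Rightarrow> complex ^ 3 \<Rightarrow> bool"
  where "parallel v w \<longleftrightarrow> (\<forall>i j. v $ i * w $ j = v $ j * w $ i)"

lemma parallel_zero: "parallel v 0"
  by (simp add: parallel_def)

lemma parallel_multiple: "parallel v (c *s v)"
  by (simp add: parallel_def)

lemma parallel_add: "parallel v w \<Longrightarrow> parallel v w' \<Longrightarrow> parallel v (w + w')"
  by (simp add: parallel_def algebra_simps)

lemma parallel_diff: "parallel v w \<Longrightarrow> parallel v w' \<Longrightarrow> parallel v (w - w')"
  by (simp add: parallel_def algebra_simps)

lemma parallel_scale: "parallel v w \<Longrightarrow> parallel v (c *s w)"
  by (simp add: parallel_def mult.left_commute)

lemma parallelE:
  assumes "parallel v w" "v \<noteq> 0"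
  obtains m where "w = m *s v"
proof -
  obtain i where i: "v $ i \<noteq> 0" using assms(2) by (auto simp: vec_eq_iff)
  have "w = (w $ i / v $ i) *s v"
    using assms(1) i unfolding parallel_def by (simp add: vec_eq_iff field_simps)
  then show thesis by (rule that)
qed

lemma vregular_on_combination:
  assumes "openin zariski U" "\<And>j. regular_on (k - \<kappa> $ j) U (\<lambda>v. s v $ j)" "\<And>j. vregular_on (\<kappa> $ j) U (\<theta> j)"
  shows "vregular_on k U (\<lambda>v. \<Sum>j\<in>UNIV. s v $ j *s \<theta> j v)"
  unfolding vregular_on_def
proof
  fix i
  have "regular_on k U (\<lambda>v. s v $ j * \<theta> j v $ i)" for j
    by (rule regular_on_mult'[OF assms(1) assms(2)]) (use assms(3) in \<open>auto simp: vregular_on_def\<close>)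
  then show "regular_on k U (\<lambda>v. (\<Sum>j\<in>UNIV. s v $ j *s \<theta> j v) $ i)"
    using regular_on_sum[OF assms(1), of UNIV k "\<lambda>j v. s v $ j * \<theta> j v $ i"] by simp
qed

lemma vregular_on_subset:
  "vregular_on k U s \<Longrightarrow> openin zariski V \<Longrightarrow> V \<subseteq> U \<Longrightarrow> vregular_on k V s"
  unfolding vregular_on_def using regular_on_subset by blast

lemma vregular_on_diff:
  "openin zariski U \<Longrightarrow> vregular_on k U s \<Longrightarrow> vregular_on k U t \<Longrightarrow> vregular_on k U (\<lambda>v. s v - t v)"
  unfolding vregular_on_def by (simp add: regular_on_diff)

lemma vregular_on_smult:
  "openin zariski U \<Longrightarrow> regular_on j U r \<Longrightarrow> vregular_on i U s \<Longrightarrow> j + i = k \<Longrightarrow>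
    vregular_on k U (\<lambda>v. r v *s s v)"
  unfolding vregular_on_def by (auto intro: regular_on_mult')

lemma vregular_on_euler: "openin zariski U \<Longrightarrow> vregular_on 1 U (\<lambda>v. v)"
  unfolding vregular_on_def by (simp add: regular_on_coord)

lemma regular_on_form:
  assumes "openin zariski U" "vregular_on k U t"
  shows "regular_on k U (\<lambda>v. scalar_product \<alpha> (t v))"
  unfolding scalar_product_def
  by (intro regular_on_sum regular_on_cmult assms(1)) (use assms(2) in \<open>simp add: vregular_on_def\<close>)

text \<open>The linear factors are stripped one at a time, each by continuity across its line.\<close>

lemma regular_zero_off_arrangement:
  assumes "openin zariski U" "regular_on k U s" "finite B" "\<And>H. H \<in> B \<Longrightarrow> form_of_line H \<noteq> 0"
    and "\<And>v. v \<in> \<Union>U \<Longrightarrow> s v * (\<Prod>H\<in>B. form H v) = 0" "v \<in> \<Union>U"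
  shows "s v = 0"
  using assms(3,2,4-)
proof (induction B arbitrary: s k v rule: finite_induct)
  case (insert H B)
  have 0: "s v * form H v = 0" if "v \<in> \<Union>U" for v
  proof (rule insert.IH[OF _ _ _ that])
    show "regular_on (k + 1) U (\<lambda>v. s v * form H v)"
      by (rule regular_on_mult[OF assms(1) insert.prems(1) regular_on_linear[OF assms(1)]])
    show "form_of_line H' \<noteq> 0" if "H' \<in> B" for H' using that insert.prems(2) by blast
    show "s v * form H v * (\<Prod>H\<in>B. form H v) = 0" if "v \<in> \<Union>U" for v
      using insert.prems(3)[OF that] insert.hyps by (simp add: mult.assoc)
  qed
  show ?case
    by (rule regular_zero_off_line[OF assms(1) insert.prems(1) insert.prems(2)[OF insertI1] _ insert.prems(4)])
      (use 0 in auto)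
qed simp

text \<open>The same along the line \<open>\<alpha> = 0\<close>, where each factor must not vanish identically.\<close>

lemma regular_zero_on_line_off_others:
  assumes "openin zariski U" "regular_on k U s" "finite B"
    and "\<And>H. H \<in> B \<Longrightarrow> \<exists>e. scalar_product \<alpha> e = 0 \<and> form H e \<noteq> 0"
    and "\<And>v. v \<in> \<Union>U \<Longrightarrow> scalar_product \<alpha> v = 0 \<Longrightarrow> s v * (\<Prod>H\<in>B. form H v) = 0"
    and "v \<in> \<Union>U" "scalar_product \<alpha> v = 0"
  shows "s v = 0"
  using assms(3,2,4-)
proof (induction B arbitrary: s k v rule: finite_induct)
  case (insert H B)
  have 0: "s v * form H v = 0" if "v \<in> \<Union>U" "scalar_product \<alpha> v = 0" for v
  proof (rule insert.IH[OF _ _ _ that])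
    show "regular_on (k + 1) U (\<lambda>v. s v * form H v)"
      by (rule regular_on_mult[OF assms(1) insert.prems(1) regular_on_linear[OF assms(1)]])
    show "\<exists>e. scalar_product \<alpha> e = 0 \<and> form H' e \<noteq> 0" if "H' \<in> B" for H' using that insert.prems(2) by blast
    show "s v * form H v * (\<Prod>H\<in>B. form H v) = 0" if "v \<in> \<Union>U" "scalar_product \<alpha> v = 0" for v
      using insert.prems(3)[OF that] insert.hyps by (simp add: mult.assoc)
  qed
  obtain e where e: "scalar_product \<alpha> e = 0" "form H e \<noteq> 0" using insert.prems(2) by blast
  show ?case
    by (rule regular_zero_on_line[OF assms(1) insert.prems(1) _ e insert.prems(4,5)])
      (use 0 in auto)
qed simp

text \<open>On the line \<open>H\<close> every term of \<open>\<nabla>f \<cdot> t\<close> except the one that differentiates \<open>\<alpha>\<^sub>H\<close> vanishes; what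
  is left is \<open>\<alpha>\<^sub>H(t)\<close> times the other forms, whose zeros are isolated on \<open>H\<close>.\<close>

lemma gradient_zero_imp_tangent:
  assumes A: "arrangement A" and U: "openin zariski U" and t: "vregular_on k U t" "gradient_zero A U t"
  shows "tangent A U t"
  unfolding tangent_def
proof (intro ballI impI)
  fix H v assume H: "H \<in> A" and v: "v \<in> \<Union>U" "form H v = 0"
  have fin: "finite A" using A unfolding arrangement_def by blast
  show "form H (t v) = 0"
  proof (rule regular_zero_on_line_off_others[OF U regular_on_form[OF U t(1)] _ _ _ v])
    show "finite (A - {H})" using fin by simp
    show "\<exists>e. form H e = 0 \<and> form H' e \<noteq> 0" if "H' \<in> A - {H}" for H'
      using distinct_lines_separated[OF A H, of H'] that by blast
    fix v assume v: "v \<in> \<Union>U" "form H v = 0"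
    have others: "(\<Prod>H''\<in>A - {H'}. form H'' v) = 0" if "H' \<in> A - {H}" for H'
      by (rule prod_zero) (use that H v(2) fin in auto)
    have "0 = (\<Sum>H\<in>A. form H (t v) * (\<Prod>H'\<in>A - {H}. form H' v))"
      using t(2) v(1) unfolding gradient_zero_def gradient_defining_poly[OF fin] by fastforce
    also have "\<dots> = form H (t v) * (\<Prod>H'\<in>A - {H}. form H' v)"
      by (simp add: sum.remove[OF fin H] others)
    finally show "form H (t v) * (\<Prod>H'\<in>A - {H}. form H' v) = 0" ..
  qed
qed

lemma gradient_euler:
  assumes "finite A"
  shows "scalar_product (gradient (defining_poly A) v) v = of_nat (card A) * (\<Prod>H\<in>A. form H v)"
proof -
  have "form H v * (\<Prod>H'\<in>A - {H}. form H' v) = (\<Prod>H\<in>A. form H v)" if "H \<in> A" for H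
    by (rule prod.remove[OF assms that, symmetric])
  then show ?thesis unfolding gradient_defining_poly[OF assms] by simp
qed

text \<open>A tangent field becomes a field killed by \<open>\<nabla>f\<close> after subtracting a multiple of the Euler field:
  \<open>\<nabla>f \<cdot> t = f \<Sum>\<^sub>H \<alpha>\<^sub>H(t) / \<alpha>\<^sub>H\<close>, where the quotients are regular by tangency, and \<open>\<nabla>f \<cdot> v = n f\<close>.\<close>

lemma tangent_normalize:
  assumes A: "arrangement A" "A \<noteq> {}" and U: "openin zariski U" and t: "vregular_on k U t" "tangent A U t"
  obtains \<nu> where "regular_on (k - 1) U \<nu>" "gradient_zero A U (\<lambda>v. t v - \<nu> v *s v)"
proof -
  have fin: "finite A" using A unfolding arrangement_def by blast
  have "\<exists>\<rho>. regular_on (k - 1) U \<rho> \<and> (\<forall>v. v \<in> \<Union>U \<longrightarrow> form H (t v) = form H v * \<rho> v)" if H: "H \<in> A" for H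
  proof (rule regular_on_divide[OF U regular_on_form[OF U t(1)] form_of_line(1)[OF A(1) H]])
    show "form H (t v) = 0" if "v \<in> \<Union>U" "form H v = 0" for v
      using t(2) H that unfolding tangent_def by blast
  qed blast
  then obtain \<rho> where \<rho>: "\<And>H. H \<in> A \<Longrightarrow> regular_on (k - 1) U (\<rho> H)"
    "\<And>H v. H \<in> A \<Longrightarrow> v \<in> \<Union>U \<Longrightarrow> form H (t v) = form H v * \<rho> H v"
    by metis
  define \<nu> where "\<nu> v = inverse (of_nat (card A)) * (\<Sum>H\<in>A. \<rho> H v)" for v
  have n: "of_nat (card A) \<noteq> (0 :: complex)" using fin A(2) by simp
  show thesis
  proof (rule that)
    show "regular_on (k - 1) U \<nu>"
      unfolding \<nu>_def by (intro regular_on_cmult regular_on_sum U \<rho>(1))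
    show "gradient_zero A U (\<lambda>v. t v - \<nu> v *s v)"
      unfolding gradient_zero_def
    proof
      fix v assume v: "v \<in> \<Union>U"
      have "scalar_product (gradient (defining_poly A) v) (t v) =
          (\<Sum>H\<in>A. form H v * \<rho> H v * (\<Prod>H'\<in>A - {H}. form H' v))"
        unfolding gradient_defining_poly[OF fin] using \<rho>(2) v by (intro sum.cong) auto
      also have "\<dots> = (\<Sum>H\<in>A. \<rho> H v * (\<Prod>H'\<in>A. form H' v))"
        by (intro sum.cong refl) (simp add: prod.remove[OF fin])
      also have "\<dots> = (\<Sum>H\<in>A. \<rho> H v) * (\<Prod>H\<in>A. form H v)"
        by (rule sum_distrib_right[symmetric])
      also have "\<dots> = \<nu> v * scalar_product (gradient (defining_poly A) v) v"
        unfolding gradient_euler[OF fin] \<nu>_def using n by simp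
      finally show "scalar_product (gradient (defining_poly A) v) (t v - \<nu> v *s v) = 0"
        by (simp add: scalar_product_simps)
    qed
  qed
qed

text \<open>The kernel of the gradient contains no multiples of the Euler field, since \<open>\<nabla>f \<cdot> (m v) = m n f\<close>.\<close>

lemma parallel_gradient_zero:
  assumes A: "arrangement A" "A \<noteq> {}" and U: "openin zariski U" and w: "vregular_on k U w" "gradient_zero A U w"
    and par: "\<And>v. v \<in> \<Union>U \<Longrightarrow> parallel v (w v)" and v: "v \<in> \<Union>U"
  shows "w v = 0"
proof -
  have fin: "finite A" using A unfolding arrangement_def by blast
  have "w v $ i = 0" for i
  proof (rule regular_zero_off_arrangement[OF U _ fin _ _ v])
    show "regular_on k U (\<lambda>v. w v $ i)" using w(1) unfolding vregular_on_def by blast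
    show "form_of_line H \<noteq> 0" if "H \<in> A" for H using form_of_line(1)[OF A(1) that] .
    fix v assume v: "v \<in> \<Union>U"
    then have "v \<noteq> 0" using in_cone_iff[OF openin_subset_P2[OF U]] by blast
    then obtain m where m: "w v = m *s v" using par[OF v] by (elim parallelE)
    have "scalar_product (gradient (defining_poly A) v) (w v) = 0"
      using w(2) v unfolding gradient_zero_def by blast
    then have "m * (\<Prod>H\<in>A. form H v) = 0"
      using fin A(2) by (simp add: m scalar_product_scale gradient_euler)
    then show "w v $ i * (\<Prod>H\<in>A. form H v) = 0" by (auto simp: m)
  qed
  then show ?thesis by (simp add: vec_eq_iff)
qed

lemma gradient_zero_combination:
  assumes "U \<subseteq> P2" "\<And>j. gradient_zero A P2 (\<theta> j)"
  shows "gradient_zero A U (\<lambda>v. \<Sum>j\<in>UNIV. s v $ j *s (\<theta> :: 3 \<Rightarrow> 3 sect) j v)"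
  unfolding gradient_zero_def
proof
  fix v assume "v \<in> \<Union>U"
  then have "v \<in> \<Union>P2" using assms(1) by blast
  then have "scalar_product (gradient (defining_poly A) v) (\<theta> j v) = 0" for j
    using assms(2)[of j] unfolding gradient_zero_def by blast
  then show "scalar_product (gradient (defining_poly A) v) (\<Sum>j\<in>UNIV. s v $ j *s \<theta> j v) = 0"
    unfolding sum_3 by (simp add: scalar_product_simps)
qed

lemma gradient_zero_diff:
  "gradient_zero A U s \<Longrightarrow> gradient_zero A U t \<Longrightarrow> gradient_zero A U (\<lambda>v. s v - t v)"
  unfolding gradient_zero_def by (simp add: scalar_product_simps)

lemma gradient_zero_subset:
  "gradient_zero A U s \<Longrightarrow> V \<subseteq> U \<Longrightarrow> gradient_zero A V s"
  unfolding gradient_zero_def by blast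

text \<open>Passing between the kernel of the gradient and tangent fields modulo the Euler field leaves
  the relation unchanged; only the generators move by multiples of the Euler field.\<close>

lemma presentation_tangent:
  assumes A: "arrangement A" "A \<noteq> {}" and pres: "presentation (\<lambda>v w. w = 0) (gradient_zero A) \<kappa> e \<theta> g"
  shows "presentation parallel (tangent A) \<kappa> e \<theta> g"
proof (rule presentationI)
  fix j
  show \<theta>: "vregular_on (\<kappa> $ j) P2 (\<theta> j)" by (rule presentationD(1)[OF pres])
  show "tangent A P2 (\<theta> j)"
    by (rule gradient_zero_imp_tangent[OF A(1) openin_P2 \<theta> presentationD(2)[OF pres]])
  show "regular_on (e - \<kappa> $ j) P2 (\<lambda>v. g v $ j)" by (rule presentationD(3)[OF pres])
next
  show "parallel v (\<Sum>j\<in>UNIV. g v $ j *s \<theta> j v)" if "v \<noteq> 0" for v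
    using presentationD(4)[OF pres that] by (simp add: parallel_zero)
next
  show "r v = 0" if "openin zariski U" "regular_on (- e) U r" "\<And>v. v \<in> \<Union>U \<Longrightarrow> r v *s g v = 0"
      "v \<in> \<Union>U" for U r v
    using presentation_injective[OF pres that] .
next
  fix U s v assume U: "openin zariski U" and s: "\<And>j. regular_on (- \<kappa> $ j) U (\<lambda>v. s v $ j)"
    and par: "\<And>v. v \<in> \<Union>U \<Longrightarrow> parallel v (\<Sum>j\<in>UNIV. s v $ j *s \<theta> j v)" and v: "v \<in> \<Union>U"
  have "vregular_on 0 U (\<lambda>v. \<Sum>j\<in>UNIV. s v $ j *s \<theta> j v)"
    by (rule vregular_on_combination[OF U])
      (use s vregular_on_subset[OF presentationD(1)[OF pres] U openin_subset_P2[OF U]] in auto)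
  then have zero: "(\<Sum>j\<in>UNIV. s v $ j *s \<theta> j v) = 0" if "v \<in> \<Union>U" for v
    using parallel_gradient_zero[OF A U _ gradient_zero_combination[OF openin_subset_P2[OF U] presentationD(2)[OF pres]] par that]
    by blast
  obtain V r where "openin zariski V" "v \<in> \<Union>V" "V \<subseteq> U" "regular_on (- e) V r"
    "\<forall>w\<in>\<Union>V. s w = r w *s g w"
    by (rule presentation_relation[OF pres U s zero v])
  then show "\<exists>V r. openin zariski V \<and> v \<in> \<Union>V \<and> V \<subseteq> U \<and> regular_on (- e) V r \<and> (\<forall>w\<in>\<Union>V. s w = r w *s g w)"
    by (intro exI conjI)
next
  fix U t v assume U: "openin zariski U" and t: "vregular_on 0 U t" "tangent A U t" and v: "v \<in> \<Union>U"
  obtain \<nu> where \<nu>: "regular_on (0 - 1) U \<nu>" "gradient_zero A U (\<lambda>v. t v - \<nu> v *s v)"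
    using tangent_normalize[OF A U t] .
  define t' where "t' v = t v - \<nu> v *s v" for v
  have t': "vregular_on 0 U t'" "gradient_zero A U t'"
    unfolding t'_def
    by (intro vregular_on_diff U t vregular_on_smult[OF U \<nu>(1) vregular_on_euler[OF U]] \<nu>(2); simp)+
  obtain V s where V: "openin zariski V" "v \<in> \<Union>V" "V \<subseteq> U" "\<forall>j. regular_on (- \<kappa> $ j) V (\<lambda>v. s v $ j)"
    and eq: "\<forall>w\<in>\<Union>V. t' w - (\<Sum>j\<in>UNIV. s w $ j *s \<theta> j w) = 0"
    by (rule presentation_generate[OF pres U t' v])
  have "parallel w (t w - (\<Sum>j\<in>UNIV. s w $ j *s \<theta> j w))" if "w \<in> \<Union>V" for w
  proof -
    have "t w - (\<Sum>j\<in>UNIV. s w $ j *s \<theta> j w) = \<nu> w *s w"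
      using bspec[OF eq that] by (simp add: t'_def algebra_simps)
    then show ?thesis by (simp add: parallel_multiple)
  qed
  then show "\<exists>V s. openin zariski V \<and> v \<in> \<Union>V \<and> V \<subseteq> U \<and> (\<forall>j. regular_on (- \<kappa> $ j) V (\<lambda>v. s v $ j)) \<and>
      (\<forall>w\<in>\<Union>V. parallel w (t w - (\<Sum>j\<in>UNIV. s w $ j *s \<theta> j w)))"
    using V by blast
qed

lemma presentation_gradient_zero:
  assumes A: "arrangement A" "A \<noteq> {}" and pres: "presentation parallel (tangent A) \<kappa> e \<theta> g"
  obtains \<theta>' where "presentation (\<lambda>v w. w = 0) (gradient_zero A) \<kappa> e \<theta>' g"
proof -
  have "\<exists>\<nu>. regular_on (\<kappa> $ j - 1) P2 \<nu> \<and> gradient_zero A P2 (\<lambda>v. \<theta> j v - \<nu> v *s v)" for j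
    using tangent_normalize[OF A openin_P2 presentationD(1)[OF pres, of j] presentationD(2)[OF pres, of j]] by blast
  then have "\<forall>j. \<exists>\<nu>. regular_on (\<kappa> $ j - 1) P2 \<nu> \<and> gradient_zero A P2 (\<lambda>v. \<theta> j v - \<nu> v *s v)" ..
  from choice[OF this] obtain \<nu>
    where "\<forall>j. regular_on (\<kappa> $ j - 1) P2 (\<nu> j) \<and> gradient_zero A P2 (\<lambda>v. \<theta> j v - \<nu> j v *s v)" ..
  then have \<nu>: "\<And>j. regular_on (\<kappa> $ j - 1) P2 (\<nu> j)"
    "\<And>j. gradient_zero A P2 (\<lambda>v. \<theta> j v - \<nu> j v *s v)" by simp_all
  define \<theta>' where "\<theta>' j v = \<theta> j v - \<nu> j v *s v" for j v
  have reg: "vregular_on (\<kappa> $ j) P2 (\<theta>' j)" for j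
    unfolding \<theta>'_def
    by (intro vregular_on_diff openin_P2 presentationD(1)[OF pres]
        vregular_on_smult[OF openin_P2 \<nu>(1) vregular_on_euler[OF openin_P2]]) simp
  have grad: "gradient_zero A P2 (\<theta>' j)" for j
    using \<nu>(2)[of j] unfolding \<theta>'_def .
  have regc: "vregular_on k U (\<lambda>v. \<Sum>j\<in>UNIV. s v $ j *s \<theta>' j v)"
    if "openin zariski U" "\<And>j. regular_on (k - \<kappa> $ j) U (\<lambda>v. s v $ j)" for U k s
    by (rule vregular_on_combination[OF that])
      (rule vregular_on_subset[OF reg that(1) openin_subset_P2[OF that(1)]])
  have sum: "(\<Sum>j\<in>UNIV. s v $ j *s \<theta>' j v) =
      (\<Sum>j\<in>UNIV. s v $ j *s \<theta> j v) - (\<Sum>j\<in>UNIV. s v $ j * \<nu> j v) *s v" for s :: "3 sect" and v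
    unfolding \<theta>'_def sum_3 by (simp add: vec_eq_iff algebra_simps)
  have "presentation (\<lambda>v w. w = 0) (gradient_zero A) \<kappa> e \<theta>' g"
  proof (rule presentationI)
    fix j
    show "vregular_on (\<kappa> $ j) P2 (\<theta>' j)" "gradient_zero A P2 (\<theta>' j)" by (fact reg grad)+
    show "regular_on (e - \<kappa> $ j) P2 (\<lambda>v. g v $ j)" by (rule presentationD(3)[OF pres])
  next
    fix v :: "complex ^ 3" assume v: "v \<noteq> 0"
    show "(\<Sum>j\<in>UNIV. g v $ j *s \<theta>' j v) = 0"
    proof (rule parallel_gradient_zero[OF A openin_P2 regc[OF openin_P2] gradient_zero_combination[OF subset_refl grad]])
      show "regular_on (e - \<kappa> $ j) P2 (\<lambda>v. g v $ j)" for j by (rule presentationD(3)[OF pres])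
      show "v \<in> \<Union>P2" using v by (simp add: in_cone_P2 del: Union_iff)
      show "parallel v (\<Sum>j\<in>UNIV. g v $ j *s \<theta>' j v)" if "v \<in> \<Union>P2" for v
        unfolding sum using that presentationD(4)[OF pres]
        by (intro parallel_diff parallel_multiple) (simp add: in_cone_P2 del: Union_iff)
    qed
  next
    show "r v = 0" if "openin zariski U" "regular_on (- e) U r" "\<And>v. v \<in> \<Union>U \<Longrightarrow> r v *s g v = 0"
        "v \<in> \<Union>U" for U r v
      using presentation_injective[OF pres that] .
  next
    fix U s v assume U: "openin zariski U" and s: "\<And>j. regular_on (- \<kappa> $ j) U (\<lambda>v. s v $ j)"
      and zero: "\<And>v. v \<in> \<Union>U \<Longrightarrow> (\<Sum>j\<in>UNIV. s v $ j *s \<theta>' j v) = 0" and v: "v \<in> \<Union>U"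
    have par: "parallel v (\<Sum>j\<in>UNIV. s v $ j *s \<theta> j v)" if "v \<in> \<Union>U" for v
    proof -
      have "(\<Sum>j\<in>UNIV. s v $ j *s \<theta> j v) = (\<Sum>j\<in>UNIV. s v $ j * \<nu> j v) *s v"
        using zero[OF that] unfolding sum by simp
      then show ?thesis by (simp add: parallel_multiple)
    qed
    obtain V r where "openin zariski V" "v \<in> \<Union>V" "V \<subseteq> U" "regular_on (- e) V r"
      "\<forall>w\<in>\<Union>V. s w = r w *s g w"
      by (rule presentation_relation[OF pres U s par v])
    then show "\<exists>V r. openin zariski V \<and> v \<in> \<Union>V \<and> V \<subseteq> U \<and> regular_on (- e) V r \<and> (\<forall>w\<in>\<Union>V. s w = r w *s g w)"
      by (intro exI conjI)
  next
    fix U t v assume U: "openin zariski U" and t: "vregular_on 0 U t" "gradient_zero A U t" and v: "v \<in> \<Union>U"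
    obtain V s where V: "openin zariski V" "v \<in> \<Union>V" "V \<subseteq> U" and s: "\<forall>j. regular_on (- \<kappa> $ j) V (\<lambda>v. s v $ j)"
      and par: "\<forall>w\<in>\<Union>V. parallel w (t w - (\<Sum>j\<in>UNIV. s w $ j *s \<theta> j w))"
      by (rule presentation_generate[OF pres U t(1) gradient_zero_imp_tangent[OF A(1) U t] v])
    have VP: "V \<subseteq> P2" by (rule openin_subset_P2[OF V(1)])
    have "t w - (\<Sum>j\<in>UNIV. s w $ j *s \<theta>' j w) = 0" if w: "w \<in> \<Union>V" for w
    proof (rule parallel_gradient_zero[OF A V(1) _ _ _ w])
      show "vregular_on 0 V (\<lambda>w. t w - (\<Sum>j\<in>UNIV. s w $ j *s \<theta>' j w))"
        by (intro vregular_on_diff V(1) vregular_on_subset[OF t(1) V(1,3)] regc) (use s in simp)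
      show "gradient_zero A V (\<lambda>w. t w - (\<Sum>j\<in>UNIV. s w $ j *s \<theta>' j w))"
        by (intro gradient_zero_diff gradient_zero_subset[OF t(2) V(3)] gradient_zero_combination VP grad)
      show "parallel w (t w - (\<Sum>j\<in>UNIV. s w $ j *s \<theta>' j w))" if "w \<in> \<Union>V" for w
        using parallel_add[OF bspec[OF par that] parallel_multiple[of w "\<Sum>j\<in>UNIV. s w $ j * \<nu> j w"]]
        unfolding sum by (simp add: algebra_simps)
    qed
    then show "\<exists>V s. openin zariski V \<and> v \<in> \<Union>V \<and> V \<subseteq> U \<and> (\<forall>j. regular_on (- \<kappa> $ j) V (\<lambda>v. s v $ j)) \<and>
        (\<forall>w\<in>\<Union>V. t w - (\<Sum>j\<in>UNIV. s w $ j *s \<theta>' j w) = 0)"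
      using V s by blast
  qed
  then show thesis by (rule that)
qed

section \<open>Restriction to a line\<close>

text \<open>Coordinates adapted to the line \<open>\<alpha> = 0\<close>: the vectors \<open>u\<close>, \<open>w\<close> span it, and \<open>\<xi>\<close>, \<open>\<eta>\<close> are the
  coordinates along them.\<close>

locale line_frame =
  fixes \<alpha> u w e \<xi> \<eta> :: "complex ^ 3"
  assumes nonzero: "\<alpha> \<noteq> 0"
    and expand: "\<And>v. v = scalar_product \<xi> v *s u + scalar_product \<eta> v *s w + scalar_product \<alpha> v *s e"
    and dual: "scalar_product \<xi> u = 1" "scalar_product \<xi> w = 0" "scalar_product \<eta> u = 0"
      "scalar_product \<eta> w = 1" "scalar_product \<alpha> u = 0" "scalar_product \<alpha> w = 0"

lemma complement_3: "\<exists>j k :: 3. i \<noteq> j \<and> i \<noteq> k \<and> j \<noteq> k \<and> UNIV = {i, j, k}"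
proof -
  have ne: "(1::3) \<noteq> 2" "(1::3) \<noteq> 3" "(2::3) \<noteq> 3" "(2::3) \<noteq> 1" "(3::3) \<noteq> 1" "(3::3) \<noteq> 2" by simp_all
  have perm: "{1::3, 2, 3} = {2, 1, 3}" "{1::3, 2, 3} = {3, 1, 2}"
    by (rule insert_commute) (simp only: insert_commute)
  have "i = 1 \<or> i = 2 \<or> i = 3" by (rule exhaust_3)
  then show ?thesis
  proof (elim disjE)
    assume "i = 1"
    then show ?thesis unfolding UNIV_3 by (intro exI[of _ 2] exI[of _ 3]) (simp only: ne simp_thms)
  next
    assume "i = 2"
    then show ?thesis unfolding UNIV_3 by (intro exI[of _ 1] exI[of _ 3]) (simp only: ne perm(1) simp_thms)
  next
    assume "i = 3"
    then show ?thesis unfolding UNIV_3 by (intro exI[of _ 1] exI[of _ 2]) (simp only: ne perm(2) simp_thms)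
  qed
qed

lemma line_frame_exists:
  assumes "\<alpha> \<noteq> 0"
  obtains u w e \<xi> \<eta> where "line_frame \<alpha> u w e \<xi> \<eta>"
proof -
  obtain i where i: "\<alpha> $ i \<noteq> 0" using assms by (auto simp: vec_eq_iff)
  obtain j k where jk: "i \<noteq> j" "i \<noteq> k" "j \<noteq> k" "UNIV = {i, j, k}"
    using complement_3[of i] by blast
  have sp: "scalar_product \<beta> v = \<beta> $ i * v $ i + \<beta> $ j * v $ j + \<beta> $ k * v $ k" for \<beta> v :: "complex ^ 3"
    unfolding scalar_product_def jk(4) using jk(1-3) by simp
  have cases: "x = i \<or> x = j \<or> x = k" for x :: 3
    using UNIV_I[of x] unfolding jk(4) by simp
  have all: "v = v'" if "v $ i = v' $ i" "v $ j = v' $ j" "v $ k = v' $ k" for v v' :: "complex ^ 3"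
    unfolding vec_eq_iff
  proof
    show "v $ x = v' $ x" for x using cases[of x] that by (elim disjE) simp_all
  qed
  have "line_frame \<alpha> (axis j 1 - axis i (\<alpha> $ j / \<alpha> $ i)) (axis k 1 - axis i (\<alpha> $ k / \<alpha> $ i))
      (axis i (1 / \<alpha> $ i)) (axis j 1) (axis k 1)"
    by unfold_locales (rule assms all | use jk(1-3) i in \<open>simp add: sp axis_def field_simps\<close>)+
  then show thesis by (rule that)
qed

text \<open>The homogenization of \<open>p\<close> in degree \<open>n\<close>, for \<open>p\<close> of degree at most \<open>n\<close>.\<close>

definition binary_form :: "complex poly \<Rightarrow> nat \<Rightarrow> complex \<Rightarrow> complex \<Rightarrow> complex"
  where "binary_form p n x y = (\<Sum>i\<le>n. coeff p i * x ^ i * y ^ (n - i))"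

lemma binary_form_dehomogenize: "degree p \<le> n \<Longrightarrow> binary_form p n x 1 = poly p x"
  unfolding binary_form_def poly_altdef
  by (intro sum.mono_neutral_cong_right) (auto simp: coeff_eq_0)

lemma binary_form_homog_poly:
  "(\<lambda>v. binary_form p n (scalar_product \<xi> v) (scalar_product \<eta> v)) \<in> homog_poly n"
  unfolding binary_form_def
proof (rule homog_poly_sum)
  fix i assume "i \<in> {..n}"
  have "(\<lambda>v. scalar_product \<xi> v ^ i) \<in> homog_poly i" "(\<lambda>v. scalar_product \<eta> v ^ (n - i)) \<in> homog_poly (n - i)"
    using homog_poly_power[OF homog_poly_linear] by simp_all
  from homog_poly_mult[OF homog_poly_cmult[OF this(1)] this(2)]
  show "(\<lambda>v. coeff p i * scalar_product \<xi> v ^ i * scalar_product \<eta> v ^ (n - i)) \<in> homog_poly n"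
    using \<open>i \<in> {..n}\<close> by simp
qed

context line_frame
begin

lemma on_line: "scalar_product \<alpha> v = 0 \<Longrightarrow> v = scalar_product \<xi> v *s u + scalar_product \<eta> v *s w"
  using expand[of v] by simp

lemma affine_coords: "scalar_product \<xi> (x *s u + w) = x" "scalar_product \<eta> (x *s u + w) = 1"
    "scalar_product \<alpha> (x *s u + w) = 0"
  by (simp_all add: scalar_product_simps dual)

lemma u_nonzero: "u \<noteq> 0" and w_nonzero: "w \<noteq> 0"
  using dual by auto

lemma affine_nonzero: "x *s u + w \<noteq> 0"
  using affine_coords(2)[of x] by auto

lemma alpha_nonzero_or: "v \<noteq> 0 \<Longrightarrow> scalar_product \<alpha> v = 0 \<Longrightarrow> scalar_product \<xi> v \<noteq> 0 \<or> scalar_product \<eta> v \<noteq> 0"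
  using on_line[of v] by auto

text \<open>Dehomogenised, a global section on the line is entire, and homogeneity bounds its growth at
  infinity by its values near the other chart; Liouville's theorem makes it a polynomial.\<close>

lemma regular_on_line_nonneg:
  assumes s: "regular_on (int n) P2 s"
  shows "\<exists>p. degree p \<le> n \<and> (\<forall>x. s (x *s u + w) = poly p x) \<and> s u = coeff p n"
proof -
  define P where "P x = s (w + x *s u)" for x
  define Q where "Q y = s (u + y *s w)" for y
  have nz: "w + x *s u \<noteq> 0" for x
    using affine_nonzero[of x] by (simp add: add.commute)
  have nz': "u + x *s w \<noteq> 0" for x
  proof
    assume "u + x *s w = 0"
    then have "scalar_product \<xi> (u + x *s w) = 0" by simp
    then show False by (simp add: scalar_product_simps dual)
  qed
  have P: "P holomorphic_on UNIV"
    unfolding P_def by (rule regular_on_holomorphic_line[OF openin_P2 s]) (simp add: in_cone_P2 nz nz' del: Union_iff)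
  have Q: "Q holomorphic_on UNIV"
    unfolding Q_def by (rule regular_on_holomorphic_line[OF openin_P2 s]) (simp add: in_cone_P2 nz nz' del: Union_iff)
  have PQ: "P x = x ^ n * Q (1 / x)" if "x \<noteq> 0" for x
  proof -
    have eq: "w + x *s u = x *s (u + (1 / x) *s w)"
      using that by (simp add: vec_eq_iff field_simps)
    have "s (x *s (u + (1 / x) *s w)) = x powi int n * s (u + (1 / x) *s w)"
      by (rule regular_on_scale[OF openin_P2 s _ that]) (simp only: in_cone_P2 nz' simp_thms)
    then show ?thesis
      unfolding P_def Q_def eq by simp
  qed
  have compact: "compact (Q ` cball 0 1)"
    using holomorphic_on_imp_continuous_on[OF Q] by (intro compact_continuous_image) (auto intro: continuous_on_subset)
  obtain B where "\<forall>z\<in>Q ` cball 0 1. norm z \<le> B"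
    using compact_imp_bounded[OF compact] unfolding bounded_iff ..
  then have B: "norm (Q y) \<le> B" if "y \<in> cball 0 1" for y
    using that by (metis imageI)
  have growth: "norm (P x) \<le> B * norm x ^ n" if "1 \<le> norm x" for x
  proof -
    have "x \<noteq> 0" "1 / x \<in> cball 0 1" using that by (auto simp: norm_divide divide_simps)
    then show ?thesis using B[of "1 / x"] PQ[of x] by (simp add: norm_mult norm_power mult.commute mult_left_mono)
  qed
  define c where "c i = (deriv ^^ i) P 0 / fact i" for i
  have Pc: "P x = (\<Sum>i\<le>n. c i * x ^ i)" for x
    unfolding c_def using Liouville_polynomial[OF P growth] .
  define p where "p = (\<Sum>i\<le>n. monom (c i) i)"
  have deg: "degree p \<le> n"
    unfolding p_def by (rule degree_sum_le) (auto intro: order_trans[OF degree_monom_le])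
  have poly: "poly p x = P x" for x
    by (simp add: p_def poly_sum poly_monom Pc)
  have coeff: "coeff p n = c n"
    by (simp add: p_def coeff_sum if_distrib cong: if_cong)
  have "Q y = (\<Sum>i\<le>n. c i * y ^ (n - i))" if "y \<noteq> 0" for y
  proof -
    have "Q y = y ^ n * P (1 / y)" using PQ[of "1 / y"] that by (simp add: field_simps)
    also have "\<dots> = (\<Sum>i\<le>n. c i * y ^ (n - i))"
      unfolding Pc sum_distrib_left
      by (rule sum.cong) (use that in \<open>auto simp: power_divide power_diff\<close>)
    finally show ?thesis .
  qed
  then have "\<forall>\<^sub>F y in at 0. Q y = (\<Sum>i\<le>n. c i * y ^ (n - i))"
    by (auto simp: eventually_at intro!: exI[of _ 1])
  moreover have "((\<lambda>y. \<Sum>i\<le>n. c i * y ^ (n - i)) \<longlongrightarrow> (\<Sum>i\<le>n. c i * 0 ^ (n - i))) (at 0)"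
    by (intro tendsto_intros)
  ultimately have "(Q \<longlongrightarrow> (\<Sum>i\<le>n. c i * 0 ^ (n - i))) (at 0)"
    by (rule tendsto_cong[THEN iffD2])
  moreover have "(Q \<longlongrightarrow> Q 0) (at 0)"
    using holomorphic_on_imp_continuous_on[OF Q] by (simp add: continuous_on_eq_continuous_at isCont_def)
  ultimately have "Q 0 = (\<Sum>i\<le>n. c i * 0 ^ (n - i))"
    by (intro tendsto_unique[OF at_neq_bot])
  also have "\<dots> = (\<Sum>i\<le>n. if i = n then c n else 0)"
    by (rule sum.cong) (auto simp: power_0_left)
  finally have "Q 0 = c n" by simp
  then show ?thesis
    using deg poly coeff by (intro exI[of _ p]) (simp add: P_def Q_def add.commute)
qed

lemma regular_on_line:
  assumes s: "regular_on k P2 s"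
  obtains p where "p = 0 \<or> int (degree p) \<le> k" "\<And>x. s (x *s u + w) = poly p x"
    "s u = (if k \<ge> 0 then coeff p (nat k) else 0)"
proof (cases "k \<ge> 0")
  case True
  then have "regular_on (int (nat k)) P2 s" using s by simp
  from regular_on_line_nonneg[OF this] obtain p
    where "degree p \<le> nat k" "\<forall>x. s (x *s u + w) = poly p x" "s u = coeff p (nat k)" by blast
  then show thesis using True by (intro that[of p]) auto
next
  case False
  define n where "n = nat (- k)"
  have n: "int n = - k" "n > 0" using False by (auto simp: n_def)
  have pow: "(\<lambda>v. scalar_product \<beta> v ^ n) \<in> homog_poly n" for \<beta>
    using homog_poly_power[OF homog_poly_linear] by simp
  have reg: "regular_on (int 0) P2 (\<lambda>v. s v * scalar_product \<beta> v ^ n)" for \<beta>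
    by (rule regular_on_mult'[OF openin_P2 s regular_on_homog[OF openin_P2 pow]]) (use n in simp)
  \<comment> \<open>a negative twist becomes a constant after multiplication by a power of a coordinate, and that
    constant is zero because the coordinate vanishes somewhere on the line\<close>
  obtain p where p: "degree p \<le> 0" "\<And>x. s (x *s u + w) * scalar_product \<eta> (x *s u + w) ^ n = poly p x"
      "s u * scalar_product \<eta> u ^ n = coeff p 0"
    using regular_on_line_nonneg[OF reg[of \<eta>]] by blast
  obtain c where "p = [:c:]" using p(1) by (auto elim: degree_eq_zeroE)
  then have zero: "s (x *s u + w) = 0" for x
    using p(2)[of x] p(3) n(2) by (simp add: affine_coords dual power_0_left)
  obtain p' where p': "\<And>x. s (x *s u + w) * scalar_product \<xi> (x *s u + w) ^ n = poly p' x"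
      "s u * scalar_product \<xi> u ^ n = coeff p' 0"
    using regular_on_line_nonneg[OF reg[of \<xi>]] by blast
  have "poly p' = poly 0" using p'(1) zero by (auto simp: fun_eq_iff)
  then have "p' = 0" by (simp only: poly_eq_poly_eq_iff)
  then have "s u = 0" using p'(2) by (simp add: dual)
  then show thesis using that[of 0] zero False by simp
qed

lemma regular_zero_on_affine_part:
  assumes s: "regular_on k P2 s" and zero: "\<And>x. s (x *s u + w) = 0"
    and v: "v \<noteq> 0" "scalar_product \<alpha> v = 0"
  shows "s v = 0"
proof -
  obtain p where p: "\<And>x. s (x *s u + w) = poly p x" "s u = (if k \<ge> 0 then coeff p (nat k) else 0)"
    using regular_on_line[OF s] by metis
  have "poly p = poly 0" using p(1) zero by (auto simp: fun_eq_iff)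
  then have "p = 0" by (simp only: poly_eq_poly_eq_iff)
  then have u: "s u = 0" using p(2) by simp
  define x y where "x = scalar_product \<xi> v" and "y = scalar_product \<eta> v"
  have vxy: "v = x *s u + y *s w" using on_line[OF v(2)] by (simp add: x_def y_def)
  show ?thesis
  proof (cases "y = 0")
    case True
    then have "x \<noteq> 0" using vxy v(1) by auto
    then show ?thesis
      using regular_on_scale[OF openin_P2 s, of u x] u u_nonzero vxy True by (simp add: in_cone_P2 del: Union_iff)
  next
    case False
    then have "v = y *s ((x / y) *s u + w)" using vxy by (simp add: vec_eq_iff field_simps)
    then show ?thesis
      using regular_on_scale[OF openin_P2 s, of "(x / y) *s u + w" y] zero False affine_nonzero
      by (simp add: in_cone_P2 del: Union_iff)
  qed
qed

text \<open>The component of a vector transverse to \<open>v\<close> inside the line: it measures a tangent field modulo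
  the Euler field.\<close>

definition wedge :: "complex ^ 3 \<Rightarrow> complex ^ 3 \<Rightarrow> complex"
  where "wedge v x = scalar_product \<xi> v * scalar_product \<eta> x - scalar_product \<eta> v * scalar_product \<xi> x"

lemma wedge_simps: "wedge v (x + y) = wedge v x + wedge v y" "wedge v (x - y) = wedge v x - wedge v y"
    "wedge v (c *s x) = c * wedge v x" "wedge v 0 = 0" "wedge v v = 0"
  by (simp_all add: wedge_def scalar_product_simps algebra_simps)

lemma parallel_imp_wedge:
  assumes "parallel v x" "v \<noteq> 0"
  shows "wedge v x = 0"
proof -
  obtain m where "x = m *s v" using assms by (rule parallelE)
  then show ?thesis by (simp only: wedge_simps mult_zero_right)
qed

lemma wedge_imp_parallel:
  assumes "scalar_product \<alpha> v = 0" "scalar_product \<alpha> x = 0" "wedge v x = 0"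
  shows "parallel v x"
proof -
  define a b a' b' where "a = scalar_product \<xi> v" "b = scalar_product \<eta> v"
    "a' = scalar_product \<xi> x" "b' = scalar_product \<eta> x"
  have v: "v = a *s u + b *s w" and x: "x = a' *s u + b' *s w"
    using on_line assms(1,2) by (auto simp: a_b_a'_b'_def)
  have "a * b' = b * a'" using assms(3) by (simp add: wedge_def a_b_a'_b'_def)
  then have "v $ i * x $ j - v $ j * x $ i = 0" for i j
  proof -
    have "v $ i * x $ j - v $ j * x $ i = (a * b' - b * a') * (u $ i * w $ j - u $ j * w $ i)"
      unfolding v x by (simp add: algebra_simps)
    then show ?thesis using \<open>a * b' = b * a'\<close> by simp
  qed
  then show ?thesis unfolding parallel_def by simp
qed

lemma wedge_regular:
  assumes "openin zariski U" "vregular_on k U \<theta>"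
  shows "regular_on (k + 1) U (\<lambda>v. wedge v (\<theta> v))"
  unfolding wedge_def
  by (intro regular_on_diff assms(1) regular_on_mult'[OF assms(1) regular_on_linear[OF assms(1)] regular_on_form[OF assms]]) simp_all

text \<open>A field that is tangent to the line and has no transverse component there is a multiple of the
  Euler field along the line. The factor is a binary form, and extends to the plane.\<close>

lemma divide_modulo_euler:
  assumes \<theta>: "vregular_on k P2 \<theta>"
    and tan: "\<And>v. v \<noteq> 0 \<Longrightarrow> scalar_product \<alpha> v = 0 \<Longrightarrow> scalar_product \<alpha> (\<theta> v) = 0"
    and wed: "\<And>v. v \<noteq> 0 \<Longrightarrow> scalar_product \<alpha> v = 0 \<Longrightarrow> wedge v (\<theta> v) = 0"
  obtains \<mu> \<theta>' where "regular_on (k - 1) P2 \<mu>" "vregular_on (k - 1) P2 \<theta>'"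
    "\<And>v. v \<noteq> 0 \<Longrightarrow> \<theta> v = scalar_product \<alpha> v *s \<theta>' v + \<mu> v *s v"
proof -
  have par: "parallel v (\<theta> v)" if "v \<noteq> 0" "scalar_product \<alpha> v = 0" for v
    using wedge_imp_parallel[OF that(2) tan[OF that] wed[OF that]] .
  have reg\<xi>: "regular_on k P2 (\<lambda>v. scalar_product \<xi> (\<theta> v))"
    by (rule regular_on_form[OF openin_P2 \<theta>])
  obtain p where p: "p = 0 \<or> int (degree p) \<le> k" "\<And>x. scalar_product \<xi> (\<theta> (x *s u + w)) = poly p x"
    using regular_on_line[OF reg\<xi>] by metis
  have "poly p 0 = 0"
  proof -
    have "parallel w (\<theta> w)" using par w_nonzero dual by blast
    then obtain m where "\<theta> w = m *s w" using w_nonzero by (rule parallelE)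
    then show ?thesis using p(2)[of 0] by (simp add: scalar_product_scale dual)
  qed
  then obtain p' where p': "p = [:0, 1:] * p'"
    by (metis dvdE minus_zero poly_eq_0_iff_dvd)
  have "\<exists>\<mu>. regular_on (k - 1) P2 \<mu> \<and> (\<forall>x. \<mu> (x *s u + w) = poly p' x)"
  proof (cases "p = 0")
    case True
    then have "p' = 0" using p' by simp
    then show ?thesis using regular_on_zero[OF openin_P2] by (intro exI[of _ "\<lambda>v. 0"]) simp
  next
    case False
    then have "p' \<noteq> 0" using p' by auto
    then have "degree p = degree p' + 1" unfolding p' by (subst degree_mult_eq) auto
    then have deg: "int (degree p') \<le> k - 1" using p(1) False by simp
    define n where "n = nat (k - 1)"
    have n: "int n = k - 1" "degree p' \<le> n" using deg by (auto simp: n_def)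
    show ?thesis
      using regular_on_homog[OF openin_P2 binary_form_homog_poly[of p' n \<xi> \<eta>]] n
      by (intro exI[of _ "\<lambda>v. binary_form p' n (scalar_product \<xi> v) (scalar_product \<eta> v)"])
        (simp add: affine_coords binary_form_dehomogenize)
  qed
  then obtain \<mu> where \<mu>: "regular_on (k - 1) P2 \<mu>" "\<And>x. \<mu> (x *s u + w) = poly p' x" by blast
  have regd: "regular_on k P2 (\<lambda>v. scalar_product \<xi> (\<theta> v) - scalar_product \<xi> v * \<mu> v)"
    by (intro regular_on_diff openin_P2 reg\<xi> regular_on_mult'[OF openin_P2 regular_on_linear[OF openin_P2] \<mu>(1)]) simp
  have eq: "scalar_product \<xi> (\<theta> v) - scalar_product \<xi> v * \<mu> v = 0" if "v \<noteq> 0" "scalar_product \<alpha> v = 0" for v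
    by (rule regular_zero_on_affine_part[OF regd _ that]) (simp add: affine_coords p(2) \<mu>(2) p')
  have regi: "regular_on k P2 (\<lambda>v. \<theta> v $ i - \<mu> v * v $ i)" for i
    by (intro regular_on_diff openin_P2 regular_on_mult'[OF openin_P2 \<mu>(1) regular_on_coord[OF openin_P2]])
      (use \<theta> in \<open>simp_all add: vregular_on_def\<close>)
  have on: "\<theta> v $ i - \<mu> v * v $ i = 0" if v: "v \<in> \<Union>P2" "scalar_product \<alpha> v = 0" for v i
  proof (rule regular_zero_on_line[OF openin_P2 regi _ _ _ v])
    show "scalar_product \<alpha> u = 0" "scalar_product \<xi> u \<noteq> 0" using dual by auto
    fix v assume v: "v \<in> \<Union>P2" "scalar_product \<alpha> v = 0" "scalar_product \<xi> v \<noteq> 0"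
    then have nz: "v \<noteq> 0" by auto
    obtain m where m: "\<theta> v = m *s v" using par[OF nz v(2)] nz by (rule parallelE)
    then have "m = \<mu> v" using eq[OF nz v(2)] v(3) by (simp add: scalar_product_scale algebra_simps)
    then show "\<theta> v $ i - \<mu> v * v $ i = 0" by (simp add: m)
  qed
  have "\<forall>i. \<exists>q. regular_on (k - 1) P2 q \<and> (\<forall>v. v \<in> \<Union>P2 \<longrightarrow> \<theta> v $ i - \<mu> v * v $ i = scalar_product \<alpha> v * q v)"
  proof
    fix i
    show "\<exists>q. regular_on (k - 1) P2 q \<and> (\<forall>v. v \<in> \<Union>P2 \<longrightarrow> \<theta> v $ i - \<mu> v * v $ i = scalar_product \<alpha> v * q v)"
      by (rule regular_on_divide[OF openin_P2 regi[of i] nonzero on]) blast+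
  qed
  from choice[OF this] obtain q where q: "\<forall>i. regular_on (k - 1) P2 (q i) \<and>
      (\<forall>v. v \<in> \<Union>P2 \<longrightarrow> \<theta> v $ i - \<mu> v * v $ i = scalar_product \<alpha> v * q i v)" ..
  show thesis
  proof (rule that[OF \<mu>(1)])
    show "vregular_on (k - 1) P2 (\<lambda>v. \<chi> i. q i v)" using q unfolding vregular_on_def by simp
    show "\<theta> v = scalar_product \<alpha> v *s (\<chi> i. q i v) + \<mu> v *s v" if "v \<noteq> 0" for v
    proof -
      have "v \<in> \<Union>P2" using that by (simp add: in_cone_P2 del: Union_iff)
      then have "\<theta> v $ i - \<mu> v * v $ i = scalar_product \<alpha> v * q i v" for i using q by blast
      then show ?thesis by (simp add: vec_eq_iff algebra_simps)
    qed
  qed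
qed

end

section \<open>Operations on presentations\<close>

lemma tangent_smult:
  "tangent A U t \<Longrightarrow> V \<subseteq> U \<Longrightarrow> tangent A V (\<lambda>v. r v *s t v)"
  unfolding tangent_def by (simp add: scalar_product_scale) blast

lemma scaled_combination: "(\<Sum>j\<in>UNIV. (c *s s) $ j *s \<theta> j) = c *s (\<Sum>j\<in>UNIV. s $ j *s (\<theta> j :: complex ^ 3))"
  by (simp add: vec.scale_sum_right vector_smult_assoc)

lemma chart_neighbourhood:
  assumes "openin zariski U" "v \<in> \<Union>U"
  obtains V i where "openin zariski V" "V \<subseteq> U" "V \<subseteq> chart i" "v \<in> \<Union>V" "\<forall>w\<in>\<Union>V. w $ i \<noteq> 0"
proof -
  have "v \<noteq> 0" using in_cone_iff[OF openin_subset_P2[OF assms(1)]] assms(2) by blast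
  then obtain i where i: "v \<in> \<Union>(chart i)" by (rule exists_chart)
  have 1: "v \<in> \<Union>(U \<inter> chart i)"
    unfolding cone_Int[OF assms(1) openin_chart] using assms(2) i by blast
  have 2: "w $ i \<noteq> 0" if "w \<in> \<Union>(U \<inter> chart i)" for w
    using that unfolding cone_Int[OF assms(1) openin_chart] Int_iff cone_chart by blast
  show thesis
    by (rule that[OF openin_Int[OF assms(1) openin_chart] Int_lower1 Int_lower2 1 ballI[OF 2]])
qed

text \<open>The defining properties of a presentation concern fields of degree zero; multiplication by
  powers of a coordinate transports them to every degree.\<close>

lemma presentation_injective_twist:
  assumes pres: "presentation Z D \<kappa> e \<theta> g" and U: "openin zariski U" and r: "regular_on (m - e) U r"
    and zero: "\<And>v. v \<in> \<Union>U \<Longrightarrow> r v *s g v = 0" and v: "v \<in> \<Union>U"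
  shows "r v = 0"
proof -
  obtain V i where V: "openin zariski V" "V \<subseteq> U" "V \<subseteq> chart i" "v \<in> \<Union>V"
    and nz: "\<forall>w\<in>\<Union>V. w $ i \<noteq> 0"
    using chart_neighbourhood[OF U v] .
  have "v $ i powi (- m) * r v = 0"
  proof (rule presentation_injective[OF pres V(1) _ _ V(4)])
    show "regular_on (- e) V (\<lambda>v. v $ i powi (- m) * r v)"
      by (rule regular_on_mult'[OF V(1) regular_on_coord_powi[OF V(1,3)] regular_on_subset[OF r V(1,2)]]) simp
    show "(w $ i powi (- m) * r w) *s g w = 0" if "w \<in> \<Union>V" for w
    proof -
      have "w \<in> \<Union>U" using that V(2) by blast
      then show ?thesis using zero[of w] by simp
    qed
  qed
  then show ?thesis using bspec[OF nz V(4)] by simp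
qed

lemma presentation_relation_twist:
  fixes \<kappa> :: "int ^ 3"
  assumes pres: "presentation parallel D \<kappa> e \<theta> g" and U: "openin zariski U"
    and s: "\<And>j. regular_on (m - \<kappa> $ j) U (\<lambda>v. s v $ j)"
    and par: "\<And>v. v \<in> \<Union>U \<Longrightarrow> parallel v (\<Sum>j\<in>UNIV. s v $ j *s \<theta> j v)" and v: "v \<in> \<Union>U"
  obtains V r where "openin zariski V" "v \<in> \<Union>V" "V \<subseteq> U" "regular_on (m - e) V r"
    "\<forall>w\<in>\<Union>V. s w = r w *s g w"
proof -
  obtain W i where W: "openin zariski W" "W \<subseteq> U" "W \<subseteq> chart i" "v \<in> \<Union>W"
    and nz: "\<forall>w\<in>\<Union>W. w $ i \<noteq> 0"
    using chart_neighbourhood[OF U v] .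
  define s' where "s' v = v $ i powi (- m) *s s v" for v
  have s'_reg: "regular_on (- \<kappa> $ j) W (\<lambda>v. s' v $ j)" for j
    unfolding s'_def vector_smult_component
    by (rule regular_on_mult'[OF W(1) regular_on_coord_powi[OF W(1,3)] regular_on_subset[OF s W(1,2)]]) simp
  have s'_par: "parallel w (\<Sum>j\<in>UNIV. s' w $ j *s \<theta> j w)" if "w \<in> \<Union>W" for w
  proof -
    have "w \<in> \<Union>U" using that W(2) by blast
    then show ?thesis unfolding s'_def scaled_combination by (intro parallel_scale par)
  qed
  obtain V r where V: "openin zariski V" "v \<in> \<Union>V" "V \<subseteq> W" and r: "regular_on (- e) V r"
    "\<forall>w\<in>\<Union>V. s' w = r w *s g w"
    by (rule presentation_relation[OF pres W(1) s'_reg s'_par W(4)])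
  have VU: "V \<subseteq> U" and Vc: "V \<subseteq> chart i" using V(3) W(2,3) by auto
  have reg: "regular_on (m - e) V (\<lambda>v. v $ i powi m * r v)"
    by (rule regular_on_mult'[OF V(1) regular_on_coord_powi[OF V(1) Vc] r(1)]) simp
  have "s w = (w $ i powi m * r w) *s g w" if "w \<in> \<Union>V" for w
  proof -
    have "w \<in> \<Union>W" using that V(3) by blast
    then have "w $ i \<noteq> 0" by (rule bspec[OF nz])
    then have "s w = w $ i powi m *s s' w" unfolding s'_def by (simp add: vector_smult_assoc power_int_minus)
    then show ?thesis using bspec[OF r(2) that] by (simp add: vector_smult_assoc)
  qed
  then show thesis using that[OF V(1,2) VU reg] by blast
qed

lemma presentation_generate_twist:
  fixes \<kappa> :: "int ^ 3"
  assumes pres: "presentation parallel (tangent A) \<kappa> e \<theta> g" and U: "openin zariski U"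
    and t: "vregular_on m U t" "tangent A U t" and v: "v \<in> \<Union>U"
  obtains V s where "openin zariski V" "v \<in> \<Union>V" "V \<subseteq> U" "\<forall>j. regular_on (m - \<kappa> $ j) V (\<lambda>v. s v $ j)"
    "\<forall>w\<in>\<Union>V. parallel w (t w - (\<Sum>j\<in>UNIV. s w $ j *s \<theta> j w))"
proof -
  obtain W i where W: "openin zariski W" "W \<subseteq> U" "W \<subseteq> chart i" "v \<in> \<Union>W"
    and nz: "\<forall>w\<in>\<Union>W. w $ i \<noteq> 0"
    using chart_neighbourhood[OF U v] .
  define t' where "t' v = v $ i powi (- m) *s t v" for v
  have t': "vregular_on 0 W t'" "tangent A W t'"
    unfolding t'_def
    by (rule vregular_on_smult[OF W(1) regular_on_coord_powi[OF W(1,3)] vregular_on_subset[OF t(1) W(1,2)]], simp)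
      (rule tangent_smult[OF t(2) W(2)])
  obtain V s where V: "openin zariski V" "v \<in> \<Union>V" "V \<subseteq> W" and s: "\<forall>j. regular_on (- \<kappa> $ j) V (\<lambda>v. s v $ j)"
    "\<forall>w\<in>\<Union>V. parallel w (t' w - (\<Sum>j\<in>UNIV. s w $ j *s \<theta> j w))"
    by (rule presentation_generate[OF pres W(1) t' W(4)])
  have VU: "V \<subseteq> U" and Vc: "V \<subseteq> chart i" using V(3) W(2,3) by auto
  define s' where "s' v = v $ i powi m *s s v" for v
  have 1: "\<forall>j. regular_on (m - \<kappa> $ j) V (\<lambda>v. s' v $ j)"
    unfolding s'_def vector_smult_component
    by (intro allI, rule regular_on_mult'[OF V(1) regular_on_coord_powi[OF V(1) Vc] s(1)[rule_format]]) simp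
  have 2: "parallel w (t w - (\<Sum>j\<in>UNIV. s' w $ j *s \<theta> j w))" if "w \<in> \<Union>V" for w
  proof -
    have "w \<in> \<Union>W" using that V(3) by blast
    then have "w $ i \<noteq> 0" by (rule bspec[OF nz])
    then have "t w = w $ i powi m *s t' w" unfolding t'_def by (simp add: vector_smult_assoc power_int_minus)
    then have "t w - (\<Sum>j\<in>UNIV. s' w $ j *s \<theta> j w) = w $ i powi m *s (t' w - (\<Sum>j\<in>UNIV. s w $ j *s \<theta> j w))"
      unfolding s'_def scaled_combination by (simp add: vector_ssub_ldistrib)
    then show ?thesis using parallel_scale[OF bspec[OF s(2) that]] by simp
  qed
  show thesis by (rule that[OF V(1,2) VU 1 ballI[OF 2]])
qed

lemma presentation_permute:
  fixes \<kappa> :: "int ^ 3"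
  assumes pres: "presentation Z D \<kappa> e \<theta> g" and \<tau>: "\<And>j. \<tau> (\<tau> j) = j" "\<And>j. \<kappa> $ (\<tau> j) = \<kappa> $ j"
  shows "presentation Z D \<kappa> e (\<lambda>j. \<theta> (\<tau> j)) (\<lambda>v. \<chi> j. g v $ \<tau> j)"
proof -
  have "bij \<tau>" by (rule o_bij[of \<tau>]) (auto simp: \<tau>)
  then have sum: "(\<Sum>j\<in>UNIV. (\<chi> j. s $ \<tau> j) $ j *s \<theta> (\<tau> j) v) = (\<Sum>j\<in>UNIV. s $ j *s \<theta> j v)"
    for s :: "complex ^ 3" and v
    using sum.reindex_bij_betw[of \<tau> UNIV UNIV "\<lambda>j. s $ j *s \<theta> j v"] by simp
  have twice: "(\<chi> j. (\<chi> j. s $ \<tau> j) $ \<tau> j) = s" for s :: "complex ^ 3"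
    by (simp add: vec_eq_iff \<tau>)
  have sum': "(\<Sum>j\<in>UNIV. s $ j *s \<theta> (\<tau> j) v) = (\<Sum>j\<in>UNIV. (\<chi> j. s $ \<tau> j) $ j *s \<theta> j v)"
    for s :: "complex ^ 3" and v
    using sum[of "\<chi> j. s $ \<tau> j" v] unfolding twice .
  show ?thesis
  proof (rule presentationI)
    show "vregular_on (\<kappa> $ j) P2 (\<theta> (\<tau> j))" for j using presentationD(1)[OF pres, of "\<tau> j"] by (simp add: \<tau>)
    show "D P2 (\<theta> (\<tau> j))" for j by (rule presentationD(2)[OF pres])
    show "regular_on (e - \<kappa> $ j) P2 (\<lambda>v. (\<chi> j. g v $ \<tau> j) $ j)" for j
      using presentationD(3)[OF pres, of "\<tau> j"] by (simp add: \<tau>)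
    show "Z v (\<Sum>j\<in>UNIV. (\<chi> j. g v $ \<tau> j) $ j *s \<theta> (\<tau> j) v)" if "v \<noteq> 0" for v
      unfolding sum by (rule presentationD(4)[OF pres that])
  next
    fix U r v assume U: "openin zariski U" and r: "regular_on (- e) U r"
      and zero: "\<And>v. v \<in> \<Union>U \<Longrightarrow> r v *s (\<chi> j. g v $ \<tau> j) = 0" and v: "v \<in> \<Union>U"
    show "r v = 0"
    proof (rule presentation_injective[OF pres U r _ v])
      show "r v *s g v = 0" if "v \<in> \<Union>U" for v
      proof -
        have "r v * g v $ j = 0" for j
          using arg_cong[OF zero[OF that], of "\<lambda>x. x $ \<tau> j"] by (simp add: \<tau>)
        then show ?thesis by (simp add: vec_eq_iff)
      qed
    qed
  next
    fix U s v assume U: "openin zariski U" and s: "\<And>j. regular_on (- \<kappa> $ j) U (\<lambda>v. s v $ j)"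
      and Z: "\<And>v. v \<in> \<Union>U \<Longrightarrow> Z v (\<Sum>j\<in>UNIV. s v $ j *s \<theta> (\<tau> j) v)" and v: "v \<in> \<Union>U"
    define s' :: "3 sect" where "s' v = (\<chi> j. s v $ \<tau> j)" for v
    have s'_reg: "regular_on (- \<kappa> $ j) U (\<lambda>v. s' v $ j)" for j
      using s[of "\<tau> j"] by (simp add: s'_def \<tau>)
    have s'_Z: "Z v (\<Sum>j\<in>UNIV. s' v $ j *s \<theta> j v)" if "v \<in> \<Union>U" for v
      using Z[OF that] unfolding sum' s'_def .
    obtain V r where V: "openin zariski V" "v \<in> \<Union>V" "V \<subseteq> U" "regular_on (- e) V r"
      and eq: "\<forall>w\<in>\<Union>V. s' w = r w *s g w"
      by (rule presentation_relation[OF pres U s'_reg s'_Z v])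
    have "s w = r w *s (\<chi> j. g w $ \<tau> j)" if "w \<in> \<Union>V" for w
    proof -
      have "s' w $ \<tau> j = (r w *s g w) $ \<tau> j" for j using bspec[OF eq that] by simp
      then show ?thesis by (simp add: vec_eq_iff s'_def \<tau>)
    qed
    then show "\<exists>V r. openin zariski V \<and> v \<in> \<Union>V \<and> V \<subseteq> U \<and> regular_on (- e) V r \<and>
        (\<forall>w\<in>\<Union>V. s w = r w *s (\<chi> j. g w $ \<tau> j))"
      using V by (intro exI conjI ballI)
  next
    fix U t v assume U: "openin zariski U" and t: "vregular_on 0 U t" "D U t" and v: "v \<in> \<Union>U"
    obtain V s where V: "openin zariski V" "v \<in> \<Union>V" "V \<subseteq> U" and s: "\<forall>j. regular_on (- \<kappa> $ j) V (\<lambda>v. s v $ j)"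
      and Z: "\<forall>w\<in>\<Union>V. Z w (t w - (\<Sum>j\<in>UNIV. s w $ j *s \<theta> j w))"
      by (rule presentation_generate[OF pres U t v])
    define s' :: "3 sect" where "s' v = (\<chi> j. s v $ \<tau> j)" for v
    have "\<forall>j. regular_on (- \<kappa> $ j) V (\<lambda>v. s' v $ j)"
    proof
      show "regular_on (- \<kappa> $ j) V (\<lambda>v. s' v $ j)" for j
        using s[rule_format, of "\<tau> j"] by (simp add: s'_def \<tau>)
    qed
    moreover have "\<forall>w\<in>\<Union>V. Z w (t w - (\<Sum>j\<in>UNIV. s' w $ j *s \<theta> (\<tau> j) w))"
      unfolding s'_def sum by (rule Z)
    ultimately show "\<exists>V s. openin zariski V \<and> v \<in> \<Union>V \<and> V \<subseteq> U \<and> (\<forall>j. regular_on (- \<kappa> $ j) V (\<lambda>v. s v $ j)) \<and>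
        (\<forall>w\<in>\<Union>V. Z w (t w - (\<Sum>j\<in>UNIV. s w $ j *s \<theta> (\<tau> j) w)))"
      using V by (intro exI conjI)
  qed
qed

text \<open>Subtracting multiples of the middle generator from the others changes only the middle
  coefficient of the relation.\<close>

lemma presentation_eliminate:
  fixes \<kappa> :: "int ^ 3"
  assumes pres: "presentation Z (tangent A) \<kappa> e \<theta> g"
    and c: "\<And>j. regular_on (\<kappa> $ j - \<kappa> $ 2) P2 (c j)" "c 2 = (\<lambda>v. 0)"
  shows "presentation Z (tangent A) \<kappa> e (\<lambda>j v. \<theta> j v - c j v *s \<theta> 2 v)
    (\<lambda>v. g v + axis 2 (\<Sum>j\<in>UNIV. g v $ j * c j v))"
proof -
  \<comment> \<open>the change of coefficients that compensates the change of generators, and its inverse\<close>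
  define T where "T s v = s + axis 2 (\<Sum>j\<in>UNIV. s $ j * c j v)" for s :: "complex ^ 3" and v
  define T' where "T' s v = s - axis 2 (\<Sum>j\<in>UNIV. s $ j * c j v)" for s :: "complex ^ 3" and v
  have TT': "T (T' s v) v = s" for s v
    by (simp add: T_def T'_def vec_eq_iff sum_3 c(2) axis_def forall_3)
  have T_scale: "T (r *s s) v = r *s T s v" for r s v
    by (simp add: T_def vec_eq_iff sum_3 axis_def forall_3 algebra_simps)
  have sum: "(\<Sum>j\<in>UNIV. T s v $ j *s (\<theta> j v - c j v *s \<theta> 2 v)) = (\<Sum>j\<in>UNIV. s $ j *s \<theta> j v)" for s v
    by (simp add: T_def vec_eq_iff sum_3 c(2) axis_def forall_3 algebra_simps)
  have sum': "(\<Sum>j\<in>UNIV. s $ j *s (\<theta> j v - c j v *s \<theta> 2 v)) = (\<Sum>j\<in>UNIV. T' s v $ j *s \<theta> j v)" for s v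
    using sum[of "T' s v" v] unfolding TT' .
  have reg_sum: "regular_on (m - \<kappa> $ 2) U (\<lambda>v. \<Sum>j\<in>UNIV. s v $ j * c j v)"
    if U: "openin zariski U" and s: "\<And>j. regular_on (m - \<kappa> $ j) U (\<lambda>v. s v $ j)" for U s m
    by (intro regular_on_sum U regular_on_mult'[OF U s regular_on_subset[OF c(1) U openin_subset_P2[OF U]]]) simp
  have T_reg: "regular_on (m - \<kappa> $ j) U (\<lambda>v. T (s v) v $ j)" and T'_reg: "regular_on (m - \<kappa> $ j) U (\<lambda>v. T' (s v) v $ j)"
    if U: "openin zariski U" and s: "\<And>j. regular_on (m - \<kappa> $ j) U (\<lambda>v. s v $ j)" for U s m j
    using regular_on_add[OF U s[of 2] reg_sum[OF U s]] regular_on_diff[OF U s[of 2] reg_sum[OF U s]] s[of j]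
    by (cases "j = 2"; simp add: T_def T'_def axis_def)+
  have "presentation Z (tangent A) \<kappa> e (\<lambda>j v. \<theta> j v - c j v *s \<theta> 2 v) (\<lambda>v. T (g v) v)"
  proof (rule presentationI)
    fix j
    show "vregular_on (\<kappa> $ j) P2 (\<lambda>v. \<theta> j v - c j v *s \<theta> 2 v)"
      by (intro vregular_on_diff openin_P2 presentationD(1)[OF pres] vregular_on_smult[OF openin_P2 c(1) presentationD(1)[OF pres]]) simp
    show "tangent A P2 (\<lambda>v. \<theta> j v - c j v *s \<theta> 2 v)"
      using presentationD(2)[OF pres] unfolding tangent_def by (simp add: scalar_product_simps del: Union_iff)
    show "regular_on (e - \<kappa> $ j) P2 (\<lambda>v. T (g v) v $ j)"
      by (rule T_reg[OF openin_P2 presentationD(3)[OF pres]])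
  next
    show "Z v (\<Sum>j\<in>UNIV. T (g v) v $ j *s (\<theta> j v - c j v *s \<theta> 2 v))" if "v \<noteq> 0" for v
      unfolding sum by (rule presentationD(4)[OF pres that])
  next
    fix U r v assume U: "openin zariski U" and r: "regular_on (- e) U r"
      and zero: "\<And>v. v \<in> \<Union>U \<Longrightarrow> r v *s T (g v) v = 0" and v: "v \<in> \<Union>U"
    show "r v = 0"
    proof (rule presentation_injective[OF pres U r _ v])
      show "r v *s g v = 0" if "v \<in> \<Union>U" for v
      proof -
        have "T (r v *s g v) v = 0" using zero[OF that] unfolding T_scale .
        then show ?thesis
          by (simp add: T_def vec_eq_iff sum_3 c(2) axis_def forall_3) (auto simp: algebra_simps)
      qed
    qed
  next
    fix U s v assume U: "openin zariski U" and s: "\<And>j. regular_on (- \<kappa> $ j) U (\<lambda>v. s v $ j)"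
      and Z: "\<And>v. v \<in> \<Union>U \<Longrightarrow> Z v (\<Sum>j\<in>UNIV. s v $ j *s (\<theta> j v - c j v *s \<theta> 2 v))" and v: "v \<in> \<Union>U"
    have s': "regular_on (- \<kappa> $ j) U (\<lambda>v. T' (s v) v $ j)" for j
      using T'_reg[OF U, of 0 s j] s by simp
    obtain V r where V: "openin zariski V" "v \<in> \<Union>V" "V \<subseteq> U" "regular_on (- e) V r"
      and eq: "\<forall>w\<in>\<Union>V. T' (s w) w = r w *s g w"
      by (rule presentation_relation[OF pres U s' Z[unfolded sum'] v])
    have "s w = r w *s T (g w) w" if "w \<in> \<Union>V" for w
      using arg_cong[OF bspec[OF eq that], of "\<lambda>x. T x w"] unfolding TT' T_scale .
    then show "\<exists>V r. openin zariski V \<and> v \<in> \<Union>V \<and> V \<subseteq> U \<and> regular_on (- e) V r \<and>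
        (\<forall>w\<in>\<Union>V. s w = r w *s T (g w) w)"
      using V by (intro exI conjI ballI)
  next
    fix U t v assume U: "openin zariski U" and t: "vregular_on 0 U t" "tangent A U t" and v: "v \<in> \<Union>U"
    obtain V s where V: "openin zariski V" "v \<in> \<Union>V" "V \<subseteq> U" and s: "\<forall>j. regular_on (- \<kappa> $ j) V (\<lambda>v. s v $ j)"
      and Z: "\<forall>w\<in>\<Union>V. Z w (t w - (\<Sum>j\<in>UNIV. s w $ j *s \<theta> j w))"
      by (rule presentation_generate[OF pres U t v])
    have "\<forall>j. regular_on (- \<kappa> $ j) V (\<lambda>v. T (s v) v $ j)"
      using T_reg[OF V(1), of 0 s] s by simp
    then show "\<exists>V s. openin zariski V \<and> v \<in> \<Union>V \<and> V \<subseteq> U \<and> (\<forall>j. regular_on (- \<kappa> $ j) V (\<lambda>v. s v $ j)) \<and>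
        (\<forall>w\<in>\<Union>V. Z w (t w - (\<Sum>j\<in>UNIV. s w $ j *s (\<theta> j w - c j w *s \<theta> 2 w))))"
      using V Z by (intro exI[of _ V] exI[of _ "\<lambda>v. T (s v) v"]) (simp only: sum simp_thms)
  qed
  then show ?thesis unfolding T_def .
qed

lemma parallel_divide:
  assumes U: "openin zariski U" and x: "vregular_on k U x" and \<alpha>: "\<alpha> \<noteq> 0"
    and par: "\<And>v. v \<in> \<Union>U \<Longrightarrow> parallel v (scalar_product \<alpha> v *s x v)" and v: "v \<in> \<Union>U"
  shows "parallel v (x v)"
proof -
  have "v $ i * x v $ j - v $ j * x v $ i = 0" for i j
  proof (rule regular_zero_off_line[OF U _ \<alpha> _ v])
    show "regular_on (1 + k) U (\<lambda>v. v $ i * x v $ j - v $ j * x v $ i)"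
      by (intro regular_on_diff U regular_on_mult regular_on_coord) (use x in \<open>simp_all add: vregular_on_def\<close>)
    show "v $ i * x v $ j - v $ j * x v $ i = 0" if "v \<in> \<Union>U" "scalar_product \<alpha> v \<noteq> 0" for v
      using par[OF that(1)] that(2) unfolding parallel_def by (simp add: mult.left_commute)
  qed
  then show ?thesis unfolding parallel_def by simp
qed

text \<open>A field for the smaller arrangement is the same as a field for the larger one that is divisible,
  modulo the Euler field, by the deleted form.\<close>

lemma tangent_divide:
  assumes A: "arrangement A" "l \<in> A" and U: "openin zariski U" and t: "tangent A U t" and t': "vregular_on k U t'"
    and par: "\<And>v. v \<in> \<Union>U \<Longrightarrow> parallel v (t v - form l v *s t' v)"
  shows "tangent (A - {l}) U t'"
  unfolding tangent_def
proof (intro ballI impI)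
  fix H v assume H: "H \<in> A - {l}" and v: "v \<in> \<Union>U" "form H v = 0"
  obtain e where e: "form H e = 0" "form l e \<noteq> 0"
    using distinct_lines_separated[OF A(1), of H l] H A(2) by blast
  show "form H (t' v) = 0"
  proof (rule regular_zero_on_line[OF U regular_on_form[OF U t'] _ e v])
    fix v assume v: "v \<in> \<Union>U" "form H v = 0" "form l v \<noteq> 0"
    then have "v \<noteq> 0" by auto
    then obtain m where "t v - form l v *s t' v = m *s v" using par[OF v(1)] by (elim parallelE)
    then have "form H (t v - form l v *s t' v) = 0" using v(2) by (simp add: scalar_product_scale)
    moreover have "form H (t v) = 0" using t H v unfolding tangent_def by blast
    ultimately show "form H (t' v) = 0" using v(3) by (simp add: scalar_product_simps)
  qed
qed

lemma tangent_multiple: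
  "tangent (A - {l}) U t \<Longrightarrow> tangent A U (\<lambda>v. form l v *s t v)"
  unfolding tangent_def by (simp add: scalar_product_scale del: Union_iff) blast

context line_frame
begin

text \<open>Moving along the line away from a point, one meets the exceptional points at finitely many times
  only.\<close>

lemma zero_on_line_off_finite:
  assumes U: "openin zariski U" and s: "regular_on k U s" and I: "finite I"
    and zero: "\<And>v. v \<in> \<Union>U \<Longrightarrow> scalar_product \<alpha> v = 0 \<Longrightarrow> pt v \<notin> I \<Longrightarrow> s v = 0"
    and v: "v \<in> \<Union>U" "scalar_product \<alpha> v = 0"
  shows "s v = 0"
proof -
  have nz: "v \<noteq> 0" using in_cone_iff[OF openin_subset_P2[OF U]] v(1) by blast
  obtain d \<beta> where d: "scalar_product \<alpha> d = 0" "scalar_product \<beta> d = 0" "scalar_product \<beta> v \<noteq> 0" "d \<noteq> 0"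
    using alpha_nonzero_or[OF nz v(2)] dual u_nonzero w_nonzero by metis
  have "inj (\<lambda>t. pt (v + t *s d))"
  proof (rule injI)
    fix t t' assume "pt (v + t *s d) = pt (v + t' *s d)"
    then have "v + t *s d \<in> pt (v + t' *s d)" using pt_self by metis
    then obtain c where c: "v + t *s d = c *s (v + t' *s d)" by (auto simp: pt_def)
    from arg_cong[OF c, of "scalar_product \<beta>"] have "c = 1"
      using d by (simp add: scalar_product_simps)
    then have "(t - t') *s d = 0" using c by (simp add: vector_sub_rdistrib)
    then show "t = t'" using d(4) by simp
  qed
  then have "finite ((\<lambda>t. pt (v + t *s d)) -` I)" using I by (intro finite_vimageI)
  then have "\<forall>\<^sub>F t in at 0. t \<notin> (\<lambda>t. pt (v + t *s d)) -` I" by (rule eventually_at_avoid_finite)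
  then have "\<forall>\<^sub>F t in at 0. v + t *s d \<in> \<Union>U \<longrightarrow> s (v + t *s d) = 0"
  proof eventually_elim
    case (elim t)
    then show ?case using zero[of "v + t *s d"] d(1) v(2) by (simp add: scalar_product_simps)
  qed
  then show ?thesis by (rule regular_zero_by_density[OF U s v(1)])
qed

lemma wedge_sum: "wedge v (\<Sum>j\<in>UNIV. s $ j *s x j) = (\<Sum>j\<in>(UNIV::3 set). s $ j * wedge v (x j))"
  by (simp add: sum_3 wedge_simps)

end

section \<open>Deleting a line\<close>

context line_frame
begin

text \<open>If all generators but the middle one are multiples of the Euler field along the line, they can be
  divided by \<open>\<alpha>\<close>. The middle coefficient of a relation is then divisible by \<open>\<alpha>\<close>, since it is the
  only one that contributes a transverse component along the line; dividing it as well gives the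
  relation for the smaller arrangement.\<close>

lemma presentation_delete:
  fixes \<kappa> :: "int ^ 3"
  assumes A: "arrangement A" "l \<in> A" "\<alpha> = form_of_line l" and I: "finite I"
    and pres: "presentation parallel (tangent A) \<kappa> e' \<theta> g"
    and wedge0: "\<And>j v. j \<noteq> 2 \<Longrightarrow> v \<noteq> 0 \<Longrightarrow> scalar_product \<alpha> v = 0 \<Longrightarrow> wedge v (\<theta> j v) = 0"
    and wedge2: "\<And>v. v \<noteq> 0 \<Longrightarrow> scalar_product \<alpha> v = 0 \<Longrightarrow> pt v \<notin> I \<Longrightarrow> wedge v (\<theta> 2 v) \<noteq> 0"
  shows "\<exists>\<theta>' g'. presentation parallel (tangent (A - {l})) (\<kappa> - vector [1, 0, 1]) (e' - 1) \<theta>' g'"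
proof -
  have "\<forall>j. \<exists>\<mu> q. j \<noteq> 2 \<longrightarrow> vregular_on (\<kappa> $ j - 1) P2 q \<and>
      (\<forall>v. v \<noteq> 0 \<longrightarrow> \<theta> j v = scalar_product \<alpha> v *s q v + \<mu> v *s v)"
  proof
    fix j
    show "\<exists>\<mu> q. j \<noteq> 2 \<longrightarrow> vregular_on (\<kappa> $ j - 1) P2 q \<and>
      (\<forall>v. v \<noteq> 0 \<longrightarrow> \<theta> j v = scalar_product \<alpha> v *s q v + \<mu> v *s v)"
    proof (cases "j = 2")
      case False
      have tan: "scalar_product \<alpha> (\<theta> j v) = 0" if "v \<noteq> 0" "scalar_product \<alpha> v = 0" for v
      proof -
        have "v \<in> \<Union>P2" using that(1) by (simp add: in_cone_P2 del: Union_iff)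
        then show ?thesis using presentationD(2)[OF pres, of j] A(2) that(2) unfolding tangent_def A(3) by blast
      qed
      obtain \<mu> q where "vregular_on (\<kappa> $ j - 1) P2 q"
        "\<And>v. v \<noteq> 0 \<Longrightarrow> \<theta> j v = scalar_product \<alpha> v *s q v + \<mu> v *s v"
        using divide_modulo_euler[OF presentationD(1)[OF pres] tan wedge0[OF False]] by blast
      then show ?thesis by blast
    qed simp
  qed
  from choice[OF this] obtain \<mu> where "\<forall>j. \<exists>q. j \<noteq> 2 \<longrightarrow> vregular_on (\<kappa> $ j - 1) P2 q \<and>
      (\<forall>v. v \<noteq> 0 \<longrightarrow> \<theta> j v = scalar_product \<alpha> v *s q v + \<mu> j v *s v)" ..
  from choice[OF this] obtain q where q: "\<forall>j. j \<noteq> 2 \<longrightarrow> vregular_on (\<kappa> $ j - 1) P2 (q j) \<and>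
      (\<forall>v. v \<noteq> 0 \<longrightarrow> \<theta> j v = scalar_product \<alpha> v *s q j v + \<mu> j v *s v)" ..
  have q_reg: "vregular_on (\<kappa> $ j - 1) P2 (q j)" if "j \<noteq> 2" for j using q that by blast
  have q_eq: "\<theta> j v = scalar_product \<alpha> v *s q j v + \<mu> j v *s v" if "j \<noteq> 2" "v \<noteq> 0" for j v
    using q that by blast
  define \<theta>' where "\<theta>' j = (if j = 2 then \<theta> 2 else q j)" for j
  define \<kappa>' where "\<kappa>' = \<kappa> - vector [1, 0, 1]"
  have \<kappa>': "\<kappa>' $ j = \<kappa> $ j - (if j = 2 then 0 else 1)" for j
    using exhaust_3[of j] by (auto simp: \<kappa>'_def)
  \<comment> \<open>a combination of the new generators, multiplied by \<open>\<alpha>\<close>, is the combination of the old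
    ones with the lifted coefficients, up to a multiple of the Euler field\<close>
  define lift :: "complex ^ 3 \<Rightarrow> complex ^ 3 \<Rightarrow> complex ^ 3"
    where "lift s v = (\<chi> j. if j = 2 then scalar_product \<alpha> v * s $ j else s $ j)" for s v
  have lift_scale: "lift (r *s s) v = r *s lift s v" for r s v
    by (simp add: lift_def vec_eq_iff)
  have lift_sum: "(\<Sum>j\<in>UNIV. lift s v $ j *s \<theta> j v) =
      scalar_product \<alpha> v *s (\<Sum>j\<in>UNIV. s $ j *s \<theta>' j v) + (s $ 1 * \<mu> 1 v + s $ 3 * \<mu> 3 v) *s v"
    if v: "v \<noteq> 0" for s v
    using q_eq[of 1, OF _ v] q_eq[of 3, OF _ v] unfolding sum_3
    by (simp add: lift_def \<theta>'_def vec_eq_iff algebra_simps)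
  have lift_par: "parallel v (scalar_product \<alpha> v *s x - scalar_product \<alpha> v *s (\<Sum>j\<in>UNIV. s $ j *s \<theta>' j v)) \<longleftrightarrow>
      parallel v (scalar_product \<alpha> v *s x - (\<Sum>j\<in>UNIV. lift s v $ j *s \<theta> j v))" if v: "v \<noteq> 0" for s v x
  proof -
    define m where "m = s $ 1 * \<mu> 1 v + s $ 3 * \<mu> 3 v"
    define y where "y = scalar_product \<alpha> v *s x - scalar_product \<alpha> v *s (\<Sum>j\<in>UNIV. s $ j *s \<theta>' j v)"
    have eq: "scalar_product \<alpha> v *s x - (\<Sum>j\<in>UNIV. lift s v $ j *s \<theta> j v) = y - m *s v"
      unfolding lift_sum[OF v] y_def m_def by simp
    have "parallel v y \<longleftrightarrow> parallel v (y - m *s v)"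
      using parallel_diff[OF _ parallel_multiple[of v m]] parallel_add[OF _ parallel_multiple[of v m], of "y - m *s v"] by auto
    then show ?thesis unfolding eq y_def[symmetric] .
  qed
  have nz: "v \<noteq> 0" if "openin zariski U" "v \<in> \<Union>U" for U v
    using in_cone_iff[OF openin_subset_P2[OF that(1)]] that(2) by blast
  have lift_reg: "regular_on (m + 1 - \<kappa> $ j) U (\<lambda>v. lift (s v) v $ j)"
    if U: "openin zariski U" and s: "\<And>j. regular_on (m - \<kappa>' $ j) U (\<lambda>v. s v $ j)" for U s m j
    using regular_on_mult'[OF U regular_on_linear[OF U, of \<alpha>] s[of 2], of "m + 1 - \<kappa> $ 2"] s[of j]
    by (cases "j = 2") (simp_all add: lift_def \<kappa>' algebra_simps)
  \<comment> \<open>conversely, coefficients of a combination without transverse component along the line are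
    lifted, since their middle one is divisible by \<open>\<alpha>\<close>\<close>
  have unlift: "\<exists>s'. (\<forall>j. regular_on (m - 1 - \<kappa>' $ j) U (\<lambda>v. s' v $ j)) \<and> (\<forall>v\<in>\<Union>U. s v = lift (s' v) v)"
    if U: "openin zariski U" and s: "\<And>j. regular_on (m - \<kappa> $ j) U (\<lambda>v. s v $ j)"
      and par: "\<And>v. v \<in> \<Union>U \<Longrightarrow> scalar_product \<alpha> v = 0 \<Longrightarrow> parallel v (\<Sum>j\<in>UNIV. s v $ j *s \<theta> j v)" for U s m
  proof -
    have "s v $ 2 = 0" if v: "v \<in> \<Union>U" "scalar_product \<alpha> v = 0" for v
    proof (rule zero_on_line_off_finite[OF U s I _ v])
      fix v assume v: "v \<in> \<Union>U" "scalar_product \<alpha> v = 0" "pt v \<notin> I"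
      have "0 = (\<Sum>j\<in>UNIV. s v $ j * wedge v (\<theta> j v))"
        using parallel_imp_wedge[OF par[OF v(1,2)] nz[OF U v(1)]] unfolding wedge_sum ..
      also have "\<dots> = s v $ 2 * wedge v (\<theta> 2 v)"
        using wedge0[of _ v, OF _ nz[OF U v(1)] v(2)] by (simp add: sum_3)
      finally show "s v $ 2 = 0" using wedge2[OF nz[OF U v(1)] v(2,3)] by simp
    qed
    from regular_on_divide[OF U s nonzero this] obtain p where p: "regular_on (m - \<kappa> $ 2 - 1) U p"
      "\<And>v. v \<in> \<Union>U \<Longrightarrow> s v $ 2 = scalar_product \<alpha> v * p v" by blast
    have "regular_on (m - 1 - \<kappa>' $ j) U (\<lambda>v. (\<chi> j. if j = 2 then p v else s v $ j) $ j)" for j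
      using p(1) s[of j] by (cases "j = 2") (simp_all add: \<kappa>' algebra_simps)
    moreover have "s v = lift (\<chi> j. if j = 2 then p v else s v $ j) v" if "v \<in> \<Union>U" for v
      using p(2)[OF that] by (simp add: lift_def vec_eq_iff)
    ultimately show ?thesis by (intro exI[of _ "\<lambda>v. \<chi> j. if j = 2 then p v else s v $ j"]) blast
  qed
  have \<theta>'_reg: "vregular_on (\<kappa>' $ j) P2 (\<theta>' j)" for j
    using q_reg[of j] presentationD(1)[OF pres, of 2] by (simp add: \<theta>'_def \<kappa>')
  have comb_reg: "vregular_on m U (\<lambda>v. \<Sum>j\<in>UNIV. s v $ j *s \<theta>' j v)"
    if "openin zariski U" "\<And>j. regular_on (m - \<kappa>' $ j) U (\<lambda>v. s v $ j)" for U s m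
    by (rule vregular_on_combination[OF that]) (rule vregular_on_subset[OF \<theta>'_reg that(1) openin_subset_P2[OF that(1)]])
  have "parallel v (\<Sum>j\<in>UNIV. g v $ j *s \<theta> j v)" if "v \<in> \<Union>P2" for v
    using presentationD(4)[OF pres nz[OF openin_P2 that]] .
  then obtain g' where g': "\<And>j. regular_on (e' - 1 - \<kappa>' $ j) P2 (\<lambda>v. g' v $ j)"
    "\<And>v. v \<in> \<Union>P2 \<Longrightarrow> g v = lift (g' v) v"
    using unlift[OF openin_P2 presentationD(3)[OF pres]] by blast
  have gU: "g v = lift (g' v) v" if "openin zariski U" "v \<in> \<Union>U" for U v
    using g'(2) nz[OF that] by (simp add: in_cone_P2 del: Union_iff)
  have "presentation parallel (tangent (A - {l})) \<kappa>' (e' - 1) \<theta>' g'"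
  proof (rule presentationI)
    fix j
    show "vregular_on (\<kappa>' $ j) P2 (\<theta>' j)" by (rule \<theta>'_reg)
    show "regular_on (e' - 1 - \<kappa>' $ j) P2 (\<lambda>v. g' v $ j)" by (rule g'(1))
    show "tangent (A - {l}) P2 (\<theta>' j)"
    proof (cases "j = 2")
      case True
      then show ?thesis using presentationD(2)[OF pres, of 2] unfolding tangent_def \<theta>'_def by simp
    next
      case False
      have "tangent (A - {l}) P2 (q j)"
      proof (rule tangent_divide[OF A(1,2) openin_P2 presentationD(2)[OF pres] q_reg[OF False]])
        fix v assume "v \<in> \<Union>P2"
        then have "\<theta> j v - form l v *s q j v = \<mu> j v *s v"
          using q_eq[OF False nz[OF openin_P2]] unfolding A(3) by simp
        then show "parallel v (\<theta> j v - form l v *s q j v)" by (simp add: parallel_multiple)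
      qed
      then show ?thesis using False by (simp add: \<theta>'_def)
    qed
  next
    fix v :: "complex ^ 3" assume v: "v \<noteq> 0"
    show "parallel v (\<Sum>j\<in>UNIV. g' v $ j *s \<theta>' j v)"
    proof (rule parallel_divide[OF openin_P2 comb_reg[OF openin_P2 g'(1)] nonzero])
      show "v \<in> \<Union>P2" using v by (simp add: in_cone_P2 del: Union_iff)
      fix v assume v: "v \<in> \<Union>P2"
      have "parallel v (scalar_product \<alpha> v *s 0 - (\<Sum>j\<in>UNIV. lift (g' v) v $ j *s \<theta> j v))"
        using parallel_scale[OF presentationD(4)[OF pres nz[OF openin_P2 v]], of "- 1"] gU[OF openin_P2 v] by simp
      from lift_par[THEN iffD2, OF nz[OF openin_P2 v] this]
      have "parallel v ((- 1) *s (scalar_product \<alpha> v *s 0 - scalar_product \<alpha> v *s (\<Sum>j\<in>UNIV. g' v $ j *s \<theta>' j v)))"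
        by (rule parallel_scale)
      then show "parallel v (scalar_product \<alpha> v *s (\<Sum>j\<in>UNIV. g' v $ j *s \<theta>' j v))" by simp
    qed
  next
    fix U r v assume U: "openin zariski U" and r: "regular_on (- (e' - 1)) U r"
      and zero: "\<And>v. v \<in> \<Union>U \<Longrightarrow> r v *s g' v = 0" and v: "v \<in> \<Union>U"
    show "r v = 0"
    proof (rule presentation_injective_twist[OF pres U _ _ v])
      show "regular_on (1 - e') U r" using r by simp
      fix v assume v: "v \<in> \<Union>U"
      have "r v *s g v = lift (r v *s g' v) v" unfolding lift_scale gU[OF U v] ..
      also have "\<dots> = 0" unfolding zero[OF v] by (simp add: lift_def vec_eq_iff)
      finally show "r v *s g v = 0" .
    qed
  next
    fix U s v assume U: "openin zariski U" and s: "\<And>j. regular_on (- \<kappa>' $ j) U (\<lambda>v. s v $ j)"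
      and par: "\<And>v. v \<in> \<Union>U \<Longrightarrow> parallel v (\<Sum>j\<in>UNIV. s v $ j *s \<theta>' j v)" and v: "v \<in> \<Union>U"
    have lreg: "regular_on (1 - \<kappa> $ j) U (\<lambda>v. lift (s v) v $ j)" for j
      using lift_reg[OF U, of 0 s j] s by simp
    have lpar: "parallel v (\<Sum>j\<in>UNIV. lift (s v) v $ j *s \<theta> j v)" if "v \<in> \<Union>U" for v
      unfolding lift_sum[OF nz[OF U that]]
      by (intro parallel_add parallel_scale par[OF that] parallel_multiple)
    obtain V r where V: "openin zariski V" "v \<in> \<Union>V" "V \<subseteq> U" and r: "regular_on (1 - e') V r"
      and eq: "\<forall>w\<in>\<Union>V. lift (s w) w = r w *s g w"
      by (rule presentation_relation_twist[OF pres U lreg lpar v])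
    have leq: "lift (s x) x = lift (r x *s g' x) x" if "x \<in> \<Union>V" for x
      using bspec[OF eq that] gU[OF V(1) that] by (simp add: lift_scale)
    have g'V: "regular_on (e' - 1 - \<kappa>' $ j) V (\<lambda>v. g' v $ j)" for j
      by (rule regular_on_subset[OF g'(1) V(1) openin_subset_P2[OF V(1)]])
    have "s x = r x *s g' x" if x: "x \<in> \<Union>V" for x
    proof -
      have two: "s x $ 2 - r x * g' x $ 2 = 0"
      proof (rule regular_zero_off_line[OF V(1) _ nonzero _ x])
        show "regular_on (- \<kappa>' $ 2) V (\<lambda>x. s x $ 2 - r x * g' x $ 2)"
          by (intro regular_on_diff V(1) regular_on_subset[OF s V(1,3)] regular_on_mult'[OF V(1) r g'V]) simp
        fix x assume x: "x \<in> \<Union>V" "scalar_product \<alpha> x \<noteq> 0"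
        have "scalar_product \<alpha> x * s x $ 2 = scalar_product \<alpha> x * (r x * g' x $ 2)"
          using arg_cong[OF leq[OF x(1)], of "\<lambda>y. y $ 2"] by (simp add: lift_def)
        then show "s x $ 2 - r x * g' x $ 2 = 0" using x(2) by simp
      qed
      have "s x $ j = (r x *s g' x) $ j" for j
        using arg_cong[OF leq[OF x], of "\<lambda>y. y $ j"] two by (cases "j = 2") (simp_all add: lift_def)
      then show ?thesis by (simp add: vec_eq_iff)
    qed
    moreover have "regular_on (- (e' - 1)) V r" using r by simp
    ultimately show "\<exists>V r. openin zariski V \<and> v \<in> \<Union>V \<and> V \<subseteq> U \<and> regular_on (- (e' - 1)) V r \<and>
        (\<forall>w\<in>\<Union>V. s w = r w *s g' w)"
      using V by (intro exI conjI ballI)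
  next
    fix U t v assume U: "openin zariski U" and t: "vregular_on 0 U t" "tangent (A - {l}) U t" and v: "v \<in> \<Union>U"
    define t' where "t' v = scalar_product \<alpha> v *s t v" for v
    have t': "vregular_on 1 U t'" "tangent A U t'"
      unfolding t'_def using tangent_multiple[OF t(2)] vregular_on_smult[OF U regular_on_linear[OF U] t(1)] A(3) by simp_all
    obtain V s where V: "openin zariski V" "v \<in> \<Union>V" "V \<subseteq> U" and s: "\<forall>j. regular_on (1 - \<kappa> $ j) V (\<lambda>v. s v $ j)"
      and par: "\<forall>w\<in>\<Union>V. parallel w (t' w - (\<Sum>j\<in>UNIV. s w $ j *s \<theta> j w))"
      by (rule presentation_generate_twist[OF pres U t' v])
    have "parallel x (\<Sum>j\<in>UNIV. s x $ j *s \<theta> j x)" if "x \<in> \<Union>V" "scalar_product \<alpha> x = 0" for x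
      using parallel_scale[OF bspec[OF par that(1)], of "- 1"] that(2) by (simp add: t'_def)
    then obtain s' where s': "\<And>j. regular_on (1 - 1 - \<kappa>' $ j) V (\<lambda>v. s' v $ j)"
      "\<And>x. x \<in> \<Union>V \<Longrightarrow> s x = lift (s' x) x"
      using unlift[OF V(1) s[rule_format]] by blast
    have s'0: "regular_on (0 - \<kappa>' $ j) V (\<lambda>v. s' v $ j)" for j using s'(1)[of j] by simp
    have "parallel x (t x - (\<Sum>j\<in>UNIV. s' x $ j *s \<theta>' j x))" if x: "x \<in> \<Union>V" for x
    proof (rule parallel_divide[OF V(1) _ nonzero _ x])
      show "vregular_on 0 V (\<lambda>x. t x - (\<Sum>j\<in>UNIV. s' x $ j *s \<theta>' j x))"
        by (intro vregular_on_diff V(1) vregular_on_subset[OF t(1) V(1,3)] comb_reg s'0)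
      fix x assume x: "x \<in> \<Union>V"
      have "parallel x (scalar_product \<alpha> x *s t x - (\<Sum>j\<in>UNIV. lift (s' x) x $ j *s \<theta> j x))"
        using bspec[OF par x] unfolding s'(2)[OF x] t'_def .
      from lift_par[THEN iffD2, OF nz[OF V(1) x] this]
      show "parallel x (scalar_product \<alpha> x *s (t x - (\<Sum>j\<in>UNIV. s' x $ j *s \<theta>' j x)))"
        by (simp only: vector_ssub_ldistrib)
    qed
    moreover have "\<forall>j. regular_on (- \<kappa>' $ j) V (\<lambda>v. s' v $ j)" using s'(1) by simp
    ultimately show "\<exists>V s. openin zariski V \<and> v \<in> \<Union>V \<and> V \<subseteq> U \<and> (\<forall>j. regular_on (- \<kappa>' $ j) V (\<lambda>v. s v $ j)) \<and>
        (\<forall>w\<in>\<Union>V. parallel w (t w - (\<Sum>j\<in>UNIV. s w $ j *s \<theta>' j w)))"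
      using V by (intro exI conjI ballI)
  qed
  then show ?thesis unfolding \<kappa>'_def by blast
qed

end

section \<open>Generators along the deleted line\<close>

lemma root_product_dvd:
  fixes p :: "complex poly"
  assumes "finite X" "\<And>x. x \<in> X \<Longrightarrow> poly p x = 0"
  shows "(\<Prod>x\<in>X. [:- x, 1:]) dvd p"
  using assms
proof (induction X arbitrary: p rule: finite_induct)
  case (insert x X)
  then obtain q where q: "p = [:- x, 1:] * q" by (metis insertI1 poly_eq_0_iff_dvd dvdE)
  have "(\<Prod>x\<in>X. [:- x, 1:]) dvd q"
  proof (rule insert.IH)
    fix y assume y: "y \<in> X"
    then have "poly p y = 0" "y \<noteq> x" using insert by auto
    then show "poly q y = 0" by (simp add: q)
  qed
  then show ?case unfolding q prod.insert[OF insert.hyps] by (rule mult_dvd_mono[OF dvd_refl])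
qed simp

lemma degree_root_product: "degree (\<Prod>x\<in>X. [:- x, 1:]) = card (X :: complex set)"
  by (subst degree_prod_sum_eq) auto

lemma monic_root_product: "lead_coeff (\<Prod>x\<in>X. [:- x, 1:]) = (1 :: complex)"
  by (simp add: lead_coeff_prod)

lemma card_roots_rsquarefree:
  fixes p :: "complex poly"
  assumes "rsquarefree p"
  shows "card {x. poly p x = 0} = degree p"
proof -
  have "p \<noteq> 0" using assms by (auto simp: rsquarefree_def)
  then have "degree (smult (lead_coeff p) (\<Prod>z | poly p z = 0. [:- z, 1:])) = card {z. poly p z = 0}"
    by (simp add: degree_root_product)
  then show ?thesis unfolding complex_poly_decompose_rsquarefree[OF assms] ..
qed

lemma homog_poly_prod: "finite B \<Longrightarrow> (\<lambda>v. \<Prod>H\<in>B. scalar_product (f H) v) \<in> homog_poly (card B)"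
proof (induction B rule: finite_induct)
  case empty
  then show ?case by (simp add: homog_poly_const)
next
  case (insert H B)
  then show ?case using homog_poly_mult[OF homog_poly_linear[of "f H"] insert.IH] by simp
qed

text \<open>The direction \<open>u\<close> can be varied along \<open>u + c w\<close>, which meets a finite set of points for finitely
  many \<open>c\<close> only.\<close>

lemma line_frame_avoiding:
  assumes "\<alpha> \<noteq> 0" "finite I"
  obtains u w e \<xi> \<eta> where "line_frame \<alpha> u w e \<xi> \<eta>" "pt u \<notin> I"
proof -
  obtain u w e \<xi> \<eta> where "line_frame \<alpha> u w e \<xi> \<eta>" using line_frame_exists[OF assms(1)] .
  then interpret line_frame \<alpha> u w e \<xi> \<eta> .
  have "inj (\<lambda>c. pt (u + c *s w))"
  proof (rule injI)
    fix c c' assume "pt (u + c *s w) = pt (u + c' *s w)"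
    then have "u + c *s w \<in> pt (u + c' *s w)" using pt_self by metis
    then obtain r where r: "u + c *s w = r *s (u + c' *s w)" by (auto simp: pt_def)
    from arg_cong[OF r, of "scalar_product \<xi>"] have "r = 1" by (simp add: scalar_product_simps dual)
    with arg_cong[OF r, of "scalar_product \<eta>"] show "c = c'" by (simp add: scalar_product_simps dual)
  qed
  then have "finite ((\<lambda>c. pt (u + c *s w)) -` I)" using assms(2) by (intro finite_vimageI)
  then obtain c where c: "pt (u + c *s w) \<notin> I"
    using infinite_UNIV_char_0[where 'a = complex] by (metis UNIV_I finite_subset subsetI vimageI2)
  have \<eta>: "scalar_product (\<eta> - c *s \<xi>) v = scalar_product \<eta> v - c * scalar_product \<xi> v" for v
    by (simp add: scalar_product_def sum_subtractf sum_distrib_left algebra_simps)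
  have "line_frame \<alpha> (u + c *s w) w e \<xi> (\<eta> - c *s \<xi>)"
  proof
    fix v
    have "scalar_product \<xi> v *s (u + c *s w) + (scalar_product \<eta> v - c * scalar_product \<xi> v) *s w + scalar_product \<alpha> v *s e
        = scalar_product \<xi> v *s u + scalar_product \<eta> v *s w + scalar_product \<alpha> v *s e"
      by (simp add: vec_eq_iff algebra_simps)
    also have "\<dots> = v" by (rule expand[symmetric])
    finally show "v = scalar_product \<xi> v *s (u + c *s w) + scalar_product (\<eta> - c *s \<xi>) v *s w + scalar_product \<alpha> v *s e"
      unfolding \<eta> ..
  qed (simp_all add: nonzero scalar_product_simps dual \<eta>)
  then show thesis using c by (rule that)
qed

text \<open>Each other line meets \<open>l\<close> in a single point, whose coordinates are the values of its form on the
  frame.\<close>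

lemma finite_intersection_points:
  assumes A: "arrangement A" "l \<in> A"
  shows "finite (intersection_points l A)"
proof -
  obtain u w e \<xi> \<eta> where "line_frame (form_of_line l) u w e \<xi> \<eta>"
    using line_frame_exists[OF form_of_line(1)[OF A]] .
  then interpret line_frame "form_of_line l" u w e \<xi> \<eta> .
  have fin: "finite A" using A(1) unfolding arrangement_def by blast
  have "intersection_points l A \<subseteq> (\<lambda>H. pt (form H w *s u - form H u *s w)) ` (A - {l})"
  proof
    fix p assume "p \<in> intersection_points l A"
    then obtain H where p: "p \<in> l" and H: "H \<in> A" "H \<noteq> l" "p \<in> H"
      unfolding intersection_points_def by blast
    have "p \<in> P2" using p form_of_line(2)[OF A] unfolding line_of_form_def by auto
    then obtain v where v: "v \<noteq> 0" "p = pt v" unfolding P2_eq by auto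
    have fv: "form l v = 0" "form H v = 0"
      using pt_in_line[OF A v(1)] pt_in_line[OF A(1) H(1) v(1)] p H(3) v(2) by auto
    define x y where "x = scalar_product \<xi> v" and "y = scalar_product \<eta> v"
    have vxy: "v = x *s u + y *s w" using on_line[OF fv(1)] by (simp add: x_def y_def)
    have rel: "x * form H u + y * form H w = 0"
      using fv(2) unfolding vxy by (simp add: scalar_product_simps)
    obtain d where d: "form l d = 0" "form H d \<noteq> 0"
      using distinct_lines_separated[OF A(1,2) H(1)] H(2) by blast
    have ab: "form H u \<noteq> 0 \<or> form H w \<noteq> 0"
    proof (rule ccontr)
      assume "\<not> ?thesis"
      then have "form H (scalar_product \<xi> d *s u + scalar_product \<eta> d *s w) = 0" by (simp add: scalar_product_simps)
      then show False using on_line[OF d(1)] d(2) by simp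
    qed
    have "\<exists>c. c \<noteq> 0 \<and> v = c *s (form H w *s u - form H u *s w)"
    proof (cases "form H w = 0")
      case True
      then have "x = 0" using rel ab by simp
      have "y \<noteq> 0"
      proof
        assume "y = 0"
        then have "v = 0" unfolding vxy \<open>x = 0\<close> by simp
        then show False using v(1) by simp
      qed
      then show ?thesis using True \<open>x = 0\<close> ab vxy by (intro exI[of _ "- y / form H u"]) (simp add: vec_eq_iff)
    next
      case False
      then have y: "y = - (x / form H w * form H u)" using rel by (simp add: field_simps add_eq_0_iff)
      have "x \<noteq> 0"
      proof
        assume "x = 0"
        then have "v = 0" unfolding vxy y by simp
        then show False using v(1) by simp
      qed
      then show ?thesis using False vxy
        by (intro exI[of _ "x / form H w"]) (simp add: y vec_eq_iff right_diff_distrib)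
    qed
    then have "p = pt (form H w *s u - form H u *s w)" unfolding v(2) using pt_scale by blast
    then show "p \<in> (\<lambda>H. pt (form H w *s u - form H u *s w)) ` (A - {l})" using H by blast
  qed
  then show ?thesis using fin by (meson finite_Diff finite_imageI finite_subset)
qed

text \<open>The frame is chosen such that \<open>u\<close> is not an intersection point. All intersection points then lie
  in the affine part \<open>x u + w\<close> of the line, and \<open>u\<close> is its point at infinity.\<close>

locale deleted_line = line_frame +
  fixes A :: "point set set" and l :: "point set" and I :: "point set"
  assumes A: "arrangement A" "l \<in> A" and \<alpha>: "\<alpha> = form_of_line l"
  defines "I \<equiv> intersection_points l A"
  assumes u: "pt u \<notin> I"
begin

definition roots :: "complex set"
  where "roots = {x. pt (x *s u + w) \<in> I}"

definition root_poly :: "complex poly"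
  where "root_poly = (\<Prod>x\<in>roots. [:- x, 1:])"

lemma finite_I: "finite I"
  unfolding I_def by (rule finite_intersection_points[OF A])

lemma bij_betw_roots: "bij_betw (\<lambda>x. pt (x *s u + w)) roots I"
  unfolding bij_betw_def
proof
  show "inj_on (\<lambda>x. pt (x *s u + w)) roots"
  proof (rule inj_onI)
    fix x y assume "pt (x *s u + w) = pt (y *s u + w)"
    then have "x *s u + w \<in> pt (y *s u + w)" using pt_self by metis
    then obtain r where r: "x *s u + w = r *s (y *s u + w)" by (auto simp: pt_def)
    from arg_cong[OF r, of "scalar_product \<eta>"] have "r = 1" by (simp add: scalar_product_simps dual)
    with arg_cong[OF r, of "scalar_product \<xi>"] show "x = y" by (simp add: scalar_product_simps dual)
  qed
  have "p \<in> (\<lambda>x. pt (x *s u + w)) ` roots" if p: "p \<in> I" for p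
  proof -
    have pl: "p \<in> l" using p unfolding I_def intersection_points_def by blast
    then have "p \<in> P2" using form_of_line(2)[OF A] unfolding line_of_form_def by auto
    then obtain v where v: "v \<noteq> 0" "p = pt v" unfolding P2_eq by auto
    have fv: "scalar_product \<alpha> v = 0" using pt_in_line[OF A v(1)] pl v(2) \<alpha> by simp
    define x y where "x = scalar_product \<xi> v" and "y = scalar_product \<eta> v"
    have vxy: "v = x *s u + y *s w" using on_line[OF fv] by (simp add: x_def y_def)
    have "y \<noteq> 0"
    proof
      assume "y = 0"
      then have "x \<noteq> 0" "v = x *s u" using vxy v(1) by auto
      then show False using pt_scale u p v(2) by metis
    qed
    then have "v = y *s ((x / y) *s u + w)" using vxy by (simp add: vec_eq_iff field_simps)
    then have "p = pt ((x / y) *s u + w)" using pt_scale[OF \<open>y \<noteq> 0\<close>] v(2) by metis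
    then show ?thesis using p unfolding roots_def by blast
  qed
  then show "(\<lambda>x. pt (x *s u + w)) ` roots = I" unfolding roots_def by blast
qed

lemma card_roots: "card roots = card I" and finite_roots: "finite roots"
  using bij_betw_same_card[OF bij_betw_roots] bij_betw_finite[OF bij_betw_roots] finite_I by auto

text \<open>At a point where another line crosses, a tangent field is tangent to two lines and hence has
  the direction of the point itself.\<close>

lemma wedge_at_intersection:
  assumes t: "tangent A U t" and v: "v \<in> \<Union>U" "v \<noteq> 0" "pt v \<in> I"
  shows "wedge v (t v) = 0"
proof -
  obtain H where H: "pt v \<in> l" "H \<in> A" "H \<noteq> l" "pt v \<in> H"
    using v(3) unfolding I_def intersection_points_def by blast
  have fv: "form l v = 0" "form H v = 0"
    using pt_in_line[OF A v(2)] pt_in_line[OF A(1) H(2) v(2)] H by auto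
  then have ft: "form l (t v) = 0" "form H (t v) = 0"
    using t v(1) A(2) H(2) unfolding tangent_def by blast+
  obtain d where d: "form l d = 0" "form H d \<noteq> 0"
    using distinct_lines_separated[OF A H(2)] H(3) by blast
  \<comment> \<open>both \<open>v\<close> and the field lie on the two lines, so that their coordinates are proportional\<close>
  define x y x' y' where "x = scalar_product \<xi> v" "y = scalar_product \<eta> v"
    "x' = scalar_product \<xi> (t v)" "y' = scalar_product \<eta> (t v)"
  have "form H (scalar_product \<xi> z *s u + scalar_product \<eta> z *s w) = form H z" if "form l z = 0" for z
    using on_line[of z] that \<alpha> by simp
  then have form: "scalar_product \<xi> z * form H u + scalar_product \<eta> z * form H w = form H z" if "form l z = 0" for z
    using that by (simp add: scalar_product_simps)
  have "x * form H u + y * form H w = 0" "x' * form H u + y' * form H w = 0"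
    using form[OF fv(1)] form[OF ft(1)] fv(2) ft(2) by (simp_all add: x_y_x'_y'_def)
  then have "(x * y' - y * x') * form H u = 0" "(x * y' - y * x') * form H w = 0"
    by algebra+
  moreover have "form H u \<noteq> 0 \<or> form H w \<noteq> 0" using form[OF d(1)] d(2) by auto
  ultimately show ?thesis by (auto simp: wedge_def x_y_x'_y'_def)
qed

text \<open>The transverse component is a form of degree \<open>k + 1\<close> that vanishes at the \<open>h\<close> intersection points,
  which leaves a factor of degree \<open>k + 1 - h\<close>. Its value at \<open>u\<close> is the coefficient
  of that degree.\<close>

lemma wedge_along_line:
  assumes \<theta>: "vregular_on k P2 \<theta>" "tangent A P2 \<theta>"
  obtains q where "q = 0 \<or> int (degree q) \<le> k + 1 - int (card I)"
    "\<And>x. wedge (x *s u + w) (\<theta> (x *s u + w)) = poly root_poly x * poly q x"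
    "wedge u (\<theta> u) = (if k + 1 \<ge> int (card I) then coeff q (nat (k + 1 - int (card I))) else 0)"
proof -
  obtain p where p: "p = 0 \<or> int (degree p) \<le> k + 1"
    "\<And>x. wedge (x *s u + w) (\<theta> (x *s u + w)) = poly p x"
    "wedge u (\<theta> u) = (if k + 1 \<ge> 0 then coeff p (nat (k + 1)) else 0)"
    using regular_on_line[OF wedge_regular[OF openin_P2 \<theta>(1)]] by metis
  have "poly p x = 0" if "x \<in> roots" for x
  proof -
    have "x *s u + w \<in> \<Union>P2" by (simp only: in_cone_P2 affine_nonzero simp_thms)
    then have "wedge (x *s u + w) (\<theta> (x *s u + w)) = 0"
      by (rule wedge_at_intersection[OF \<theta>(2) _ affine_nonzero]) (use that in \<open>simp add: roots_def\<close>)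
    then show ?thesis by (simp only: p(2))
  qed
  then have "root_poly dvd p" unfolding root_poly_def by (rule root_product_dvd[OF finite_roots])
  then obtain q where q: "p = root_poly * q" by (elim dvdE)
  have lead: "degree root_poly = card I" "lead_coeff root_poly = 1"
    unfolding root_poly_def by (simp add: degree_root_product card_roots, rule monic_root_product)
  then have nz: "root_poly \<noteq> 0" by auto
  have deg: "q = 0 \<or> int (degree q) \<le> k + 1 - int (card I)"
  proof (cases "q = 0")
    case False
    then have "degree p = card I + degree q" unfolding q using nz lead by (simp add: degree_mult_eq)
    moreover have "p \<noteq> 0" unfolding q using False nz by simp
    ultimately show ?thesis using p(1) by simp
  qed simp
  have top: "wedge u (\<theta> u) = (if k + 1 \<ge> int (card I) then coeff q (nat (k + 1 - int (card I))) else 0)"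
  proof (cases "q = 0")
    case True
    then show ?thesis using p(3) q by simp
  next
    case False
    define N where "N = nat (k + 1 - int (card I))"
    have N: "nat (k + 1) = card I + N" "degree q \<le> N" "k + 1 \<ge> int (card I)"
      using deg False by (auto simp: N_def)
    have "coeff p (card I + N) = coeff q N"
    proof (cases "N = degree q")
      case True
      then show ?thesis unfolding q using coeff_mult_degree_sum[of root_poly q] lead by simp
    next
      case False
      then have "degree q < N" using N by simp
      then have "degree p < card I + N" unfolding q using degree_mult_le[of root_poly q] lead by linarith
      then show ?thesis using \<open>degree q < N\<close> by (simp add: coeff_eq_0)
    qed
    then show ?thesis using p(3) N by (simp add: N_def)
  qed
  show thesis
    by (rule that[OF deg _ top]) (simp add: p(2) q)
qed

text \<open>Near a point of the line, a constant vector field is tangent to the arrangement as soon as its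
  direction lies on the lines through that point.\<close>

lemma constant_field_generated:
  fixes \<kappa> :: "int ^ 3"
  assumes pres: "presentation parallel (tangent A) \<kappa> e' \<theta> g"
    and zero: "\<And>j v. j \<noteq> 1 \<Longrightarrow> v \<noteq> 0 \<Longrightarrow> scalar_product \<alpha> v = 0 \<Longrightarrow> wedge v (\<theta> j v) = 0"
    and v: "v \<noteq> 0" and x: "\<And>H. H \<in> A \<Longrightarrow> pt v \<in> H \<Longrightarrow> form H x = 0"
  obtains V s where "openin zariski V" "v \<in> \<Union>V" "regular_on (- \<kappa> $ 1) V s"
    "\<forall>w'\<in>\<Union>V. scalar_product \<alpha> w' = 0 \<longrightarrow> wedge w' x = s w' * wedge w' (\<theta> 1 w')"
proof -
  \<comment> \<open>the complement of the lines that miss the point\<close>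
  define B where "B = {H \<in> A. form H v \<noteq> 0}"
  have fin: "finite B" using A(1) unfolding arrangement_def B_def by simp
  define F where "F = (\<lambda>v. \<Prod>H\<in>B. form H v)"
  have F: "F \<in> homog_poly (card B)" unfolding F_def by (rule homog_poly_prod[OF fin])
  define U where "U = nonvanishing F"
  have U: "openin zariski U" unfolding U_def by (rule openin_nonvanishing[OF F])
  have vU: "v \<in> \<Union>U"
    unfolding U_def cone_nonvanishing[OF F] using v fin by (simp add: F_def B_def)
  define t :: "3 sect" where "t v = x" for v
  have t1: "vregular_on 0 U t" unfolding t_def vregular_on_def by (simp add: regular_on_const[OF U])
  have t2: "tangent A U t"
    unfolding tangent_def t_def
  proof (intro ballI impI)
    fix H w' assume H: "H \<in> A" and w': "w' \<in> \<Union>U" "form H w' = 0"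
    have "F w' \<noteq> 0" using w'(1) unfolding U_def cone_nonvanishing[OF F] by blast
    then have "H \<notin> B" using w'(2) fin unfolding F_def by auto
    then have "pt v \<in> H" using H pt_in_line[OF A(1) H v] unfolding B_def by blast
    then show "form H x = 0" by (rule x[OF H])
  qed
  obtain V s where V: "openin zariski V" "v \<in> \<Union>V" "V \<subseteq> U"
    and s: "\<forall>j. regular_on (- \<kappa> $ j) V (\<lambda>v. s v $ j)"
    and par: "\<forall>w\<in>\<Union>V. parallel w (t w - (\<Sum>j\<in>UNIV. s w $ j *s \<theta> j w))"
    by (rule presentation_generate[OF pres U t1 t2 vU])
  have "wedge w' x = s w' $ 1 * wedge w' (\<theta> 1 w')" if w': "w' \<in> \<Union>V" "scalar_product \<alpha> w' = 0" for w'
  proof -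
    have nz: "w' \<noteq> 0" using in_cone_iff[OF openin_subset_P2[OF V(1)]] w'(1) by blast
    have "wedge w' x = (\<Sum>j\<in>UNIV. s w' $ j * wedge w' (\<theta> j w'))"
      using parallel_imp_wedge[OF bspec[OF par w'(1)] nz] unfolding wedge_simps wedge_sum t_def by simp
    then show ?thesis using zero[OF _ nz w'(2)] by (simp add: sum_3)
  qed
  then show thesis using that[OF V(1,2) s[rule_format, of 1]] by blast
qed

end

context deleted_line
begin

text \<open>Suppose the generators of lower degree had no transverse component along the line. The transverse
  component of the first generator would then have to produce those of the constant fields above. So it
  is nonzero off the intersection points and has simple zeros at them, which makes its degree the
  number of intersection points; but its degree is larger.\<close>

lemma transverse_generator:
  fixes \<kappa> :: "int ^ 3"
  assumes pres: "presentation parallel (tangent A) \<kappa> e' \<theta> g" and deg: "\<kappa> $ 1 \<ge> int (card I)"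
  shows "\<exists>j v. j \<noteq> 1 \<and> v \<noteq> 0 \<and> scalar_product \<alpha> v = 0 \<and> wedge v (\<theta> j v) \<noteq> 0"
proof (rule ccontr)
  assume "\<not> ?thesis"
  then have zero: "\<And>j v. j \<noteq> 1 \<Longrightarrow> v \<noteq> 0 \<Longrightarrow> scalar_product \<alpha> v = 0 \<Longrightarrow> wedge v (\<theta> j v) = 0" by blast
  define W where "W v = wedge v (\<theta> 1 v)" for v
  have W_reg: "regular_on (\<kappa> $ 1 + 1) P2 W"
    using wedge_regular[OF openin_P2 presentationD(1)[OF pres, of 1]] unfolding W_def .
  define n where "n = nat (\<kappa> $ 1 + 1)"
  have n: "int n = \<kappa> $ 1 + 1" using deg by (simp add: n_def)
  obtain p where p: "degree p \<le> n" "\<forall>x. W (x *s u + w) = poly p x" "W u = coeff p n"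
    using regular_on_line_nonneg[of n W] W_reg n by auto
  have nonzero_off: "W v \<noteq> 0" if v: "v \<noteq> 0" "scalar_product \<alpha> v = 0" "pt v \<notin> I" for v
  proof -
    \<comment> \<open>only \<open>l\<close> passes through this point, so any constant direction along \<open>l\<close> is tangent nearby\<close>
    obtain x where x: "scalar_product \<alpha> x = 0" "wedge v x \<noteq> 0"
    proof (cases "scalar_product \<xi> v = 0")
      case True
      then have "scalar_product \<eta> v \<noteq> 0" using alpha_nonzero_or[OF v(1,2)] by blast
      then show thesis by (intro that[of u]) (simp_all add: wedge_def dual)
    next
      case False
      then show thesis by (intro that[of w]) (simp_all add: wedge_def dual)
    qed
    have x_tangent: "form H x = 0" if "H \<in> A" "pt v \<in> H" for H
    proof -
      have "pt v \<in> l" using pt_in_line[OF A v(1)] v(2) \<alpha> by simp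
      then have "H = l" using that v(3) unfolding I_def intersection_points_def by blast
      then show ?thesis using x(1) \<alpha> by simp
    qed
    obtain V s where V: "openin zariski V" "v \<in> \<Union>V" "regular_on (- \<kappa> $ 1) V s"
      and s: "\<forall>w'\<in>\<Union>V. scalar_product \<alpha> w' = 0 \<longrightarrow> wedge w' x = s w' * wedge w' (\<theta> 1 w')"
      by (rule constant_field_generated[OF pres zero v(1) x_tangent])
    then have "wedge v x = s v * W v" using v(2) unfolding W_def by blast
    then show ?thesis using x(2) by auto
  qed
  \<comment> \<open>at an intersection point the field with constant value \<open>v\<close> is available; its transverse
    component vanishes there to first order only, so that of the generator cannot vanish doubly\<close>
  have simple: "\<not> (poly p x = 0 \<and> poly (pderiv p) x = 0)" for x
  proof
    assume root: "poly p x = 0 \<and> poly (pderiv p) x = 0"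
    define v where "v = x *s u + w"
    have v: "v \<noteq> 0" "scalar_product \<alpha> v = 0" unfolding v_def by (rule affine_nonzero, rule affine_coords)
    have v_tangent: "form H v = 0" if "H \<in> A" "pt v \<in> H" for H
      using pt_in_line[OF A(1) that(1) v(1)] that(2) by simp
    obtain V s where V: "openin zariski V" "v \<in> \<Union>V" and s_reg: "regular_on (- \<kappa> $ 1) V s"
      and s: "\<forall>w'\<in>\<Union>V. scalar_product \<alpha> w' = 0 \<longrightarrow> wedge w' v = s w' * wedge w' (\<theta> 1 w')"
      by (rule constant_field_generated[OF pres zero v(1) v_tangent])
    obtain p1 where p1: "p = [:- x, 1:] * p1" using root by (metis poly_eq_0_iff_dvd dvdE)
    have "poly (pderiv ([:- x, 1:] * p1)) x = poly p1 x"
      unfolding pderiv_mult poly_add poly_mult by (simp add: pderiv_pCons)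
    then have "poly p1 x = 0" using root p1 by simp
    then obtain p2 where p2: "p1 = [:- x, 1:] * p2" by (metis poly_eq_0_iff_dvd dvdE)
    have double: "poly p y = (y - x) * ((y - x) * poly p2 y)" for y
      unfolding p1 p2 by (simp add: algebra_simps)
    have line: "((\<lambda>t. v + t *s u) \<longlongrightarrow> v) (at 0)"
      using isCont_line[where a = v and b = u and t = 0] unfolding isCont_def by simp
    have "\<forall>\<^sub>F t in at 0. v + t *s u \<in> \<Union>V"
      using topological_tendstoD[OF line open_cone[OF V(1)] V(2)] .
    moreover have "\<forall>\<^sub>F t in at (0::complex). t \<noteq> 0" by (rule eventually_neq_at_within)
    ultimately have "\<forall>\<^sub>F t in at 0. 1 = t * s (v + t *s u) * poly p2 (x + t)"
    proof eventually_elim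
      case (elim t)
      have "scalar_product \<alpha> (v + t *s u) = 0" using v(2) by (simp add: scalar_product_simps dual)
      then have "wedge (v + t *s u) v = s (v + t *s u) * W (v + t *s u)"
        using s elim(1) unfolding W_def by blast
      moreover have "wedge (v + t *s u) v = t"
        by (simp add: wedge_def v_def scalar_product_simps dual algebra_simps)
      moreover have eq: "v + t *s u = (x + t) *s u + w"
        unfolding v_def by (simp add: vec_eq_iff algebra_simps)
      have "W (v + t *s u) = t * (t * poly p2 (x + t))"
        unfolding eq p(2)[rule_format] double by simp
      ultimately have "t * 1 = t * (t * s (v + t *s u) * poly p2 (x + t))" by (simp add: mult_ac)
      then show ?case using elim(2) mult_left_cancel by blast
    qed
    moreover have "((\<lambda>t. t * s (v + t *s u) * poly p2 (x + t)) \<longlongrightarrow> 0 * s v * poly p2 (x + 0)) (at 0)"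
      by (intro tendsto_intros isCont_tendsto_compose[OF regular_on_isCont[OF V(1) s_reg V(2)] line])
    ultimately have "((\<lambda>t::complex. 1 :: complex) \<longlongrightarrow> 0 * s v * poly p2 (x + 0)) (at 0)"
      by (rule tendsto_cong[THEN iffD2])
    then have "(1 :: complex) = 0 * s v * poly p2 (x + 0)"
      using tendsto_unique[OF at_neq_bot tendsto_const] by blast
    then show False by simp
  qed
  have "coeff p n \<noteq> 0" using nonzero_off[OF u_nonzero] dual(5) u p(3) by simp
  then have "degree p = n" using p(1) le_degree[of p n] by simp
  moreover have "rsquarefree p" unfolding rsquarefree_roots using simple by blast
  then have "card {x. poly p x = 0} = degree p" by (rule card_roots_rsquarefree)
  moreover have "{x. poly p x = 0} \<subseteq> roots"
  proof
    fix x assume "x \<in> {x. poly p x = 0}"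
    then have "W (x *s u + w) = 0" using p(2) by simp
    then show "x \<in> roots"
      using nonzero_off[OF affine_nonzero affine_coords(3)] unfolding roots_def by blast
  qed
  then have "card {x. poly p x = 0} \<le> card I"
    using card_mono[OF finite_roots] card_roots by simp
  ultimately show False using n deg by simp
qed

text \<open>With \<open>|l \<inter> A| = b + 1\<close>, the transverse component of a generator of degree \<open>b\<close> is a constant
  multiple of the product of linear forms vanishing at the intersection points. If the constant is not
  zero, it divides the transverse components of the other generators, which can be eliminated.\<close>

lemma presentation_delete_middle:
  fixes \<kappa> :: "int ^ 3"
  assumes pres: "presentation parallel (tangent A) \<kappa> e' \<theta> g" and deg: "\<kappa> $ 2 + 1 = int (card I)"
    and nz: "v0 \<noteq> 0" "scalar_product \<alpha> v0 = 0" "wedge v0 (\<theta> 2 v0) \<noteq> 0"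
  shows "\<exists>\<theta>' g'. presentation parallel (tangent (A - {l})) (\<kappa> - vector [1, 0, 1]) (e' - 1) \<theta>' g'"
proof -
  note \<theta> = presentationD(1,2)[OF pres]
  define W where "W j v = wedge v (\<theta> j v)" for j v
  have W_reg: "regular_on (\<kappa> $ j + 1) P2 (W j)" for j
    using wedge_regular[OF openin_P2 \<theta>(1)[of j]] unfolding W_def .
  obtain q where q: "q = 0 \<or> int (degree q) \<le> \<kappa> $ 2 + 1 - int (card I)"
    "\<And>x. W 2 (x *s u + w) = poly root_poly x * poly q x"
    "W 2 u = (if \<kappa> $ 2 + 1 \<ge> int (card I) then coeff q (nat (\<kappa> $ 2 + 1 - int (card I))) else 0)"
    unfolding W_def by (rule wedge_along_line[OF \<theta>[of 2]]) blast
  have "degree q = 0" using q(1) deg by auto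
  then obtain c where c: "q = [:c:]" by (rule degree_eq_zeroE)
  have c0: "c \<noteq> 0"
  proof
    assume "c = 0"
    then have "W 2 (x *s u + w) = 0" for x using q(2) c by simp
    then have "W 2 v0 = 0" by (rule regular_zero_on_affine_part[OF W_reg _ nz(1,2)])
    then show False using nz(3) unfolding W_def by simp
  qed
  have W2: "W 2 v \<noteq> 0" if v: "v \<noteq> 0" "scalar_product \<alpha> v = 0" "pt v \<notin> I" for v
  proof -
    define x y where "x = scalar_product \<xi> v" and "y = scalar_product \<eta> v"
    have vxy: "v = x *s u + y *s w" using on_line[OF v(2)] by (simp add: x_def y_def)
    show ?thesis
    proof (cases "y = 0")
      case True
      then have "x \<noteq> 0" "v = x *s u" using vxy v(1) by auto
      moreover have "W 2 (x *s u) = x powi (\<kappa> $ 2 + 1) * W 2 u"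
        by (rule regular_on_scale[OF openin_P2 W_reg _ \<open>x \<noteq> 0\<close>]) (simp only: in_cone_P2 u_nonzero simp_thms)
      moreover have "W 2 u = c" using q(3) c deg by simp
      ultimately show ?thesis using c0 by simp
    next
      case False
      then have veq: "v = y *s ((x / y) *s u + w)" using vxy by (simp add: vec_eq_iff field_simps)
      then have "pt v = pt ((x / y) *s u + w)" using pt_scale[OF False] by metis
      then have "x / y \<notin> roots" using v(3) unfolding roots_def by simp
      then have "poly root_poly (x / y) \<noteq> 0"
        unfolding root_poly_def poly_prod using finite_roots by auto
      then have "W 2 ((x / y) *s u + w) \<noteq> 0" using q(2) c c0 by simp
      moreover have "W 2 (y *s ((x / y) *s u + w)) = y powi (\<kappa> $ 2 + 1) * W 2 ((x / y) *s u + w)"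
        by (rule regular_on_scale[OF openin_P2 W_reg _ False]) (simp only: in_cone_P2 affine_nonzero simp_thms)
      ultimately show ?thesis using False veq by simp
    qed
  qed
  have "\<forall>j. \<exists>f. regular_on (\<kappa> $ j - \<kappa> $ 2) P2 f \<and>
      (\<forall>x. W j (x *s u + w) - f (x *s u + w) * W 2 (x *s u + w) = 0)"
  proof
    fix j
    obtain r where r: "r = 0 \<or> int (degree r) \<le> \<kappa> $ j + 1 - int (card I)"
      "\<And>x. W j (x *s u + w) = poly root_poly x * poly r x"
      unfolding W_def by (rule wedge_along_line[OF \<theta>[of j]]) blast
    show "\<exists>f. regular_on (\<kappa> $ j - \<kappa> $ 2) P2 f \<and>
      (\<forall>x. W j (x *s u + w) - f (x *s u + w) * W 2 (x *s u + w) = 0)"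
    proof (cases "r = 0")
      case True
      then show ?thesis using r(2) regular_on_zero[OF openin_P2] by (intro exI[of _ "\<lambda>v. 0"]) simp
    next
      case False
      define n where "n = nat (\<kappa> $ j - \<kappa> $ 2)"
      have n: "int n = \<kappa> $ j - \<kappa> $ 2" "degree r \<le> n" using r(1) False deg by (auto simp: n_def)
      define f where "f v = inverse c * binary_form r n (scalar_product \<xi> v) (scalar_product \<eta> v)" for v
      have "regular_on (\<kappa> $ j - \<kappa> $ 2) P2 f"
        unfolding f_def
        using regular_on_cmult[OF openin_P2 regular_on_homog[OF openin_P2 binary_form_homog_poly[of r n \<xi> \<eta>]]] n(1) by simp
      moreover have "f (x *s u + w) = inverse c * poly r x" for x
        unfolding f_def by (simp add: affine_coords binary_form_dehomogenize n(2))
      ultimately show ?thesis using c0 by (intro exI[of _ f]) (simp add: r(2) q(2) c)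
    qed
  qed
  from choice[OF this] obtain f where f: "\<forall>j. regular_on (\<kappa> $ j - \<kappa> $ 2) P2 (f j) \<and>
      (\<forall>x. W j (x *s u + w) - f j (x *s u + w) * W 2 (x *s u + w) = 0)" ..
  define h where "h j = (if j = 2 then (\<lambda>v. 0) else f j)" for j
  have h: "regular_on (\<kappa> $ j - \<kappa> $ 2) P2 (h j)" "h 2 = (\<lambda>v. 0)" for j
    using f regular_on_zero[OF openin_P2] by (simp_all add: h_def)
  define \<theta>' where "\<theta>' = (\<lambda>j v. \<theta> j v - h j v *s \<theta> 2 v)"
  have pres': "presentation parallel (tangent A) \<kappa> e' \<theta>' (\<lambda>v. g v + axis 2 (\<Sum>j\<in>UNIV. g v $ j * h j v))"
    unfolding \<theta>'_def by (rule presentation_eliminate[OF pres h])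
  have W': "wedge v (\<theta>' j v) = W j v - h j v * W 2 v" for j v
    by (simp add: \<theta>'_def W_def wedge_simps)
  show ?thesis
  proof (rule presentation_delete[OF A \<alpha> finite_I pres'])
    fix j v assume j: "j \<noteq> (2 :: 3)" and v: "v \<noteq> 0" "scalar_product \<alpha> v = 0"
    have reg: "regular_on (\<kappa> $ j + 1) P2 (\<lambda>v. W j v - h j v * W 2 v)"
      by (intro regular_on_diff openin_P2 W_reg regular_on_mult'[OF openin_P2 h(1) W_reg]) simp
    have "W j (x *s u + w) - h j (x *s u + w) * W 2 (x *s u + w) = 0" for x
      unfolding h_def if_not_P[OF j] using f[rule_format, of j, THEN conjunct2] by (rule spec)
    from regular_zero_on_affine_part[OF reg this v] show "wedge v (\<theta>' j v) = 0" unfolding W' .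
  next
    fix v assume v: "v \<noteq> 0" "scalar_product \<alpha> v = 0" "pt v \<notin> I"
    show "wedge v (\<theta>' 2 v) \<noteq> 0" unfolding W' h(2) using W2[OF v] by simp
  qed
qed

text \<open>For an arrangement consisting of \<open>l\<close> alone there are no intersection points, so \<open>b\<close> and \<open>a\<close> would be
  negative. Fields of negative degree vanish along \<open>l\<close>, which leaves no transverse generator.\<close>

lemma negative_field_zero:
  assumes \<theta>: "vregular_on k P2 \<theta>" "k < 0" and v: "v \<noteq> 0" "scalar_product \<alpha> v = 0"
  shows "\<theta> v = 0"
proof -
  have "\<theta> v $ i = 0" for i
  proof (rule regular_zero_on_affine_part[OF _ _ v])
    show reg: "regular_on k P2 (\<lambda>v. \<theta> v $ i)" using \<theta>(1) unfolding vregular_on_def by blast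
    show "\<theta> (x *s u + w) $ i = 0" for x
    proof -
      obtain p where p: "p = 0 \<or> int (degree p) \<le> k" "\<And>x. \<theta> (x *s u + w) $ i = poly p x"
        using regular_on_line[OF reg] by metis
      have "p = 0" using p(1) \<theta>(2) by auto
      then show ?thesis using p(2) by simp
    qed
  qed
  then show ?thesis by (simp add: vec_eq_iff)
qed

lemma presentation_deletion:
  assumes pres: "presentation parallel (tangent A) (vector [d, b, a]) e' \<theta> g"
    and deg: "a \<le> b" "b < d" "b + 1 = int (card I)"
  shows "A - {l} \<noteq> {}"
    and "\<exists>\<theta>' g'. presentation parallel (tangent (A - {l})) (vector [d - 1, b, a - 1]) (e' - 1) \<theta>' g'"
proof -
  define \<kappa> :: "int ^ 3" where "\<kappa> = vector [d, b, a]"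
  have \<kappa>: "\<kappa> $ 1 = d" "\<kappa> $ 2 = b" "\<kappa> $ 3 = a" by (simp_all add: \<kappa>_def)
  note pres = pres[folded \<kappa>_def]
  have "\<kappa> $ 1 \<ge> int (card I)" using deg \<kappa> by simp
  then obtain j v where jv: "j \<noteq> 1" "v \<noteq> 0" "scalar_product \<alpha> v = 0" "wedge v (\<theta> j v) \<noteq> 0"
    using transverse_generator[OF pres] by blast
  then have j: "j = 2 \<or> j = 3" using exhaust_3[of j] by blast
  show "A - {l} \<noteq> {}"
  proof
    assume "A - {l} = {}"
    then have "I = {}" unfolding I_def intersection_points_def by blast
    then have "\<kappa> $ j < 0" using deg j \<kappa> by auto
    then have "\<theta> j v = 0" by (rule negative_field_zero[OF presentationD(1)[OF pres] _ jv(2,3)])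
    then show False using jv(4) by (simp add: wedge_simps)
  qed
  have \<kappa>': "\<kappa> - vector [1, 0, 1] = vector [d - 1, b, a - 1]"
    by (simp add: vec_eq_iff forall_3 \<kappa>)
  have "\<exists>\<theta>' g'. presentation parallel (tangent (A - {l})) (\<kappa> - vector [1, 0, 1]) (e' - 1) \<theta>' g'"
    using j
  proof
    assume "j = 2"
    then show ?thesis using presentation_delete_middle[OF pres _ jv(2,3)] jv(4) deg(3) \<kappa>(2) by simp
  next
    assume j3: "j = 3"
    have "\<kappa> $ 3 = \<kappa> $ 2"
    proof (rule ccontr)
      assume "\<kappa> $ 3 \<noteq> \<kappa> $ 2"
      then have less: "\<kappa> $ 3 + 1 < int (card I)" using deg \<kappa> by simp
      obtain q where q: "q = 0 \<or> int (degree q) \<le> \<kappa> $ 3 + 1 - int (card I)"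
        "\<And>x. wedge (x *s u + w) (\<theta> 3 (x *s u + w)) = poly root_poly x * poly q x"
        by (rule wedge_along_line[OF presentationD(1,2)[OF pres, of 3]]) blast
      have "q = 0" using q(1) less by auto
      then have "wedge v (\<theta> 3 v) = 0"
        using q(2) by (intro regular_zero_on_affine_part[OF wedge_regular[OF openin_P2 presentationD(1)[OF pres]] _ jv(2,3)]) simp
      then show False using jv(4) j3 by simp
    qed
    \<comment> \<open>the two generators have equal degrees, so they can be interchanged\<close>
    define \<tau> :: "3 \<Rightarrow> 3" where "\<tau> j = (if j = 2 then 3 else if j = 3 then 2 else j)" for j
    have "presentation parallel (tangent A) \<kappa> e' (\<lambda>j. \<theta> (\<tau> j)) (\<lambda>v. \<chi> j. g v $ \<tau> j)"
      by (rule presentation_permute[OF pres]) (simp_all add: \<tau>_def \<open>\<kappa> $ 3 = \<kappa> $ 2\<close>)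
    then show ?thesis
      by (rule presentation_delete_middle[OF _ _ jv(2,3)]) (use jv(4) j3 deg(3) \<kappa>(2) in \<open>simp_all add: \<tau>_def\<close>)
  qed
  then show "\<exists>\<theta>' g'. presentation parallel (tangent (A - {l})) (vector [d - 1, b, a - 1]) (e' - 1) \<theta>' g'"
    unfolding \<kappa>' .
qed

end

theorem proposition2p7:
  fixes A :: "point set set" and l :: "point set" and a b d :: int
  assumes "arrangement A"
    and "plus_one_generated A a b d"
    and "d > b"
    and "l \<in> A"
    and "int (card (intersection_points l A)) = b + 1"
  shows "plus_one_generated (A - {l}) (a - 1) b (d - 1)"
proof -
  have nonempty: "A \<noteq> {}" using assms(4) by blast
  have ab: "a \<le> b" using assms(2) unfolding plus_one_generated_def by blast
  obtain \<theta> g where "presentation (\<lambda>v w. w = 0) (gradient_zero A) (vector [d, b, a]) (1 + d) \<theta> g"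
    using plus_one_generated_presentation[OF assms(2)] .
  then have pres: "presentation parallel (tangent A) (vector [d, b, a]) (1 + d) \<theta> g"
    by (rule presentation_tangent[OF assms(1) nonempty])
  obtain u w e \<xi> \<eta> where frame: "line_frame (form_of_line l) u w e \<xi> \<eta>" "pt u \<notin> intersection_points l A"
    using line_frame_avoiding[OF form_of_line(1)[OF assms(1,4)] finite_intersection_points[OF assms(1,4)]] .
  interpret deleted_line "form_of_line l" u w e \<xi> \<eta> A l "intersection_points l A"
    by (intro deleted_line.intro deleted_line_axioms.intro frame assms(1,4) refl)
  have A': "arrangement (A - {l})" using assms(1) unfolding arrangement_def by simp
  note del = presentation_deletion[OF pres ab assms(3) assms(5)[symmetric]]
  obtain \<theta>' g' where "presentation parallel (tangent (A - {l})) (vector [d - 1, b, a - 1]) (1 + d - 1) \<theta>' g'"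
    using del(2) by blast
  then obtain \<theta>'' where "presentation (\<lambda>v w. w = 0) (gradient_zero (A - {l})) (vector [d - 1, b, a - 1])
      (1 + d - 1) \<theta>'' g'"
    by (rule presentation_gradient_zero[OF A' del(1)])
  then show ?thesis
    using ab assms(3) by (intro plus_one_generatedI) simp_all
qed

end
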